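(* Let $\mu$ be a locally finite complex Borel measure on $[0,1)$ for which $t|\mu|([0,1-t))$ is bounded as $t\to0_+$. Let $D_\mu f=Xf*\mu$ $(f\in L^1[0,1))$ and $\overline{D}_\mu\nu=X\nu*\mu$ $(\nu\in M[0,1))$ be the associated bounded derivations on $L^1[0,1)$ and $M[0,1)$. Then the following conditions are equivalent: (a) $D_{\mu}$ is a compact derivation on $L^1[0,1)$. (b) $D_{\mu}$ is a weakly compact derivation on $L^1[0,1)$. (c) $\mu$ is absolutely continuous (with respect to Lebesgue measure on $[0,1)$) and $t|\mu|([0,1-t))\to0$ as $t\to0_+$. (d) $\overline{D}_{\mu}$ is a compact derivation on $M[0,1)$. (e) $\overline{D}_{\mu}$ is a weakly compact derivation on $M[0,1)$.
   Context: All spaces are complex. $L^1[0,1)$ is the Volterra algebra: the (equivalence classes of) integrable functions on $[0,1)$ with norm $\|f\|=\int_0^1|f(t)|\,dt$ and product $(f*g)(t)=\int_0^t f(s)g(t-s)\,ds$. $M[0,1)$ is the Banach algebra of finite complex Borel measures on $[0,1)$ with total variation norm and convolution truncated to $[0,1)$; $L^1[0,1)$ is regarded as a subalgebra of $M[0,1)$ via $f\mapsto f(t)\,dt$. A measure $\mu$ on $[0,1)$ is here allowed to be only locally finite, i.e. $|\mu|([0,a])<\infty$ for every $a<1$ (a complex Radon measure, where $|\mu|$ is its total variation measure). For locally finite complex measures $\nu,\mu$ on $[0,1)$, the convolution $\nu*\mu$ is the locally finite measure on $[0,1)$ determined by $\int_{[0,1)}h\,d(\nu*\mu)=\int_{[0,1)}\int_{[0,1-t)}h(t+s)\,d\mu(s)\,d\nu(t)$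 for continuous $h$ with compact support in $[0,1)$. $X$ is multiplication by the coordinate: $(Xf)(t)=tf(t)$ for functions and $d(X\nu)(t)=t\,d\nu(t)$ for measures. A derivation on an algebra $\mathcal B$ is a linear map $D:\mathcal B\to\mathcal B$ with $D(a*b)=D(a)*b+a*D(b)$. For $\mu$ with $t|\mu|([0,1-t))$ bounded as $t\to0_+$, $D_\mu$ and $\overline D_\mu$ are bounded derivations on $L^1[0,1)$ and $M[0,1)$ respectively, and $\overline D_\mu$ extends $D_\mu$. *)

theory Defs
  imports "HOL-Analysis.Analysis"
begin

section \<open>Complex normed spaces, compact and weakly compact operators\<close>

class complex_normed_vector = real_normed_vector +
  fixes scaleC :: "complex \<Rightarrow> 'a \<Rightarrow> 'a" (infixr \<open>*\<^sub>C\<close> 75)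
  assumes scaleC_add_right: "c *\<^sub>C (x + y) = c *\<^sub>C x + c *\<^sub>C y"
    and scaleC_add_left: "(c + d) *\<^sub>C x = c *\<^sub>C x + d *\<^sub>C x"
    and scaleC_scaleC: "c *\<^sub>C d *\<^sub>C x = (c * d) *\<^sub>C x"
    and scaleC_of_real: "complex_of_real r *\<^sub>C x = r *\<^sub>R x"
    and norm_scaleC: "norm (c *\<^sub>C x) = cmod c * norm x"

definition clinear :: "('a::complex_normed_vector \<Rightarrow> 'b::complex_normed_vector) \<Rightarrow> bool" where
  "clinear T \<longleftrightarrow> (\<forall>x y. T (x + y) = T x + T y) \<and> (\<forall>c x. T (c *\<^sub>C x) = c *\<^sub>C T x)"

definition cdual :: "('a::complex_normed_vector \<Rightarrow> complex) set" where
  "cdual = {\<phi>. bounded_linear \<phi> \<and> (\<forall>c x. \<phi> (c *\<^sub>C x) = c * \<phi> x)}"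

definition weak_topology :: "'a::complex_normed_vector topology" where
  "weak_topology = topology_generated_by {\<phi> -` U | \<phi> U. \<phi> \<in> cdual \<and> open U}"

definition compact_operator ::
    "('a::complex_normed_vector \<Rightarrow> 'b::complex_normed_vector) \<Rightarrow> bool" where
  "compact_operator T \<longleftrightarrow> clinear T \<and> compact (closure (T ` cball 0 1))"

definition weakly_compact_operator ::
    "('a::complex_normed_vector \<Rightarrow> 'b::complex_normed_vector) \<Rightarrow> bool" where
  "weakly_compact_operator T \<longleftrightarrow>
     clinear T \<and> compactin weak_topology (weak_topology closure_of (T ` cball 0 1))"

definition derivation :: "('a::{complex_normed_vector,times} \<Rightarrow> 'a) \<Rightarrow> bool" where
  "derivation D \<longleftrightarrow> clinear D \<and> (\<forall>a b. D (a * b) = D a * b + a * D b)"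

definition compact_derivation :: "('a::{complex_normed_vector,times} \<Rightarrow> 'a) \<Rightarrow> bool" where
  "compact_derivation D \<longleftrightarrow> derivation D \<and> compact_operator D"

definition weakly_compact_derivation :: "('a::{complex_normed_vector,times} \<Rightarrow> 'a) \<Rightarrow> bool" where
  "weakly_compact_derivation D \<longleftrightarrow> derivation D \<and> weakly_compact_operator D"


section \<open>Complex measures on $[0,1)$\<close>

text \<open>
  A finite complex measure on $[0,1)$ is a set function on the Borel subsets of $[0,1)$. A locally
  finite one need not have a value on all of these, so it is a set function on the ring of Borel
  sets contained in some $[0,a]$ with $a<1$. In both cases the value outside the domain is set
  to \<open>0\<close>, so that equality of measures is equality of set functions.
\<close>

definition borel01 :: "real set set" where
  "borel01 = {A \<in> sets borel. A \<subseteq> {0..<1}}"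

definition lc_borel01 :: "real set set" where
  "lc_borel01 = {A \<in> sets borel. \<exists>a<1. A \<subseteq> {0..a}}"

definition cmeasure_on :: "real set set \<Rightarrow> (real set \<Rightarrow> complex) \<Rightarrow> bool" where
  "cmeasure_on R m \<longleftrightarrow>
     (\<forall>A. A \<notin> R \<longrightarrow> m A = 0) \<and>
     (\<forall>A. range A \<subseteq> R \<longrightarrow> disjoint_family A \<longrightarrow> (\<Union>i. A i) \<in> R \<longrightarrow>
        (\<lambda>i::nat. m (A i)) sums m (\<Union>i. A i))"

text \<open>
  The total variation $|m|(A)$. For a locally finite measure the blocks outside \<^const>\<open>lc_borel01\<close>
  contribute \<open>0\<close>.
\<close>

definition variation :: "(real set \<Rightarrow> complex) \<Rightarrow> real set \<Rightarrow> ennreal" where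
  "variation m A =
     (SUP P\<in>{P. finite P \<and> disjoint P \<and> P \<subseteq> sets borel \<and> \<Union>P \<subseteq> A}. \<Sum>B\<in>P. ennreal (cmod (m B)))"

text \<open>
  The integral against a complex measure is taken through the Jordan decompositions of the real and
  imaginary parts; \<open>upper_variation r\<close> is the positive part of the real-valued set function \<open>r\<close>
  (recall that \<^const>\<open>ennreal\<close> maps negative numbers to \<open>0\<close>).
\<close>

definition upper_variation :: "(real set \<Rightarrow> real) \<Rightarrow> real measure" where
  "upper_variation r =
     measure_of {0..<1} borel01 (\<lambda>A. SUP B\<in>{B \<in> sets borel. B \<subseteq> A}. ennreal (r B))"

definition cintegral :: "(real set \<Rightarrow> complex) \<Rightarrow> (real \<Rightarrow> complex) \<Rightarrow> complex" where
  "cintegral m f =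
     (LINT t|upper_variation (\<lambda>A. Re (m A)). f t) - (LINT t|upper_variation (\<lambda>A. - Re (m A)). f t)
     + \<i> * ((LINT t|upper_variation (\<lambda>A. Im (m A)). f t)
            - (LINT t|upper_variation (\<lambda>A. - Im (m A)). f t))"

lemma variation_mono: "A \<subseteq> B \<Longrightarrow> variation m A \<le> variation m B"
  unfolding variation_def by (rule SUP_subset_mono) auto

lemma variation_cong_le:
  assumes "\<And>A. A \<in> sets borel \<Longrightarrow> cmod (m A) \<le> cmod (n A)"
  shows "variation m A \<le> variation n A"
  unfolding variation_def using assms
  by (intro SUP_mono) (auto intro!: sum_mono ennreal_leI)

lemma variation_ge:
  assumes "A \<in> sets borel" shows "ennreal (cmod (m A)) \<le> variation m A"
proof -
  have "(\<Sum>B\<in>{A}. ennreal (cmod (m B))) \<le> variation m A"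
    unfolding variation_def by (rule SUP_upper) (use assms in \<open>auto simp: disjoint_def\<close>)
  then show ?thesis by simp
qed

lemma variation_zero [simp]: "variation (\<lambda>_. 0) A = 0"
  unfolding variation_def by (auto intro!: antisym SUP_least)

lemma variation_add: "variation (\<lambda>B. m B + n B) A \<le> variation m A + variation n A"
  unfolding variation_def[of "\<lambda>B. m B + n B"]
proof (rule SUP_least)
  fix P assume P: "P \<in> {P. finite P \<and> disjoint P \<and> P \<subseteq> sets borel \<and> \<Union>P \<subseteq> A}"
  have "(\<Sum>B\<in>P. ennreal (cmod (m B + n B)))
      \<le> (\<Sum>B\<in>P. ennreal (cmod (m B))) + (\<Sum>B\<in>P. ennreal (cmod (n B)))"
    unfolding sum.distrib[symmetric]
    by (intro sum_mono) (simp add: ennreal_leI norm_triangle_ineq flip: ennreal_plus)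
  also have "\<dots> \<le> variation m A + variation n A"
    unfolding variation_def using P by (intro add_mono SUP_upper) auto
  finally show "(\<Sum>B\<in>P. ennreal (cmod (m B + n B))) \<le> variation m A + variation n A" .
qed

lemma variation_mult: "variation (\<lambda>B. c * m B) A = ennreal (cmod c) * variation m A"
proof -
  have "(\<Sum>B\<in>P. ennreal (cmod (c * m B))) = ennreal (cmod c) * (\<Sum>B\<in>P. ennreal (cmod (m B)))" for P
    unfolding sum_distrib_left by (intro sum.cong) (auto simp: norm_mult ennreal_mult)
  then show ?thesis unfolding variation_def by (subst SUP_mult_left_ennreal) simp
qed


subsection \<open>Locally finite measures\<close>

typedef lfmeas =
  "{m. cmeasure_on lc_borel01 m \<and> (\<forall>a<1. variation m {0..a} < \<infinity>)}"
  by (rule exI[of _ "\<lambda>_. 0"]) (auto simp: cmeasure_on_def)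

setup_lifting type_definition_lfmeas

lift_definition total_variation :: "lfmeas \<Rightarrow> real set \<Rightarrow> real"
  is "\<lambda>m A. enn2real (variation m A)" .

lift_definition lf_integral :: "lfmeas \<Rightarrow> (real \<Rightarrow> complex) \<Rightarrow> complex" is cintegral .

definition lf_abs_continuous :: "lfmeas \<Rightarrow> bool" where
  "lf_abs_continuous \<mu> \<longleftrightarrow>
     (\<forall>A\<in>lc_borel01. emeasure lborel A = 0 \<longrightarrow> Rep_lfmeas \<mu> A = 0)"

definition Cc01 :: "(real \<Rightarrow> complex) set" where
  "Cc01 = {h. continuous_on {0..<1} h \<and> (\<exists>a<1. \<forall>t\<in>{0..<1}. a < t \<longrightarrow> h t = 0)}"

definition lf_conv :: "lfmeas \<Rightarrow> lfmeas \<Rightarrow> lfmeas" where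
  "lf_conv \<nu> \<mu> = (THE \<kappa>. \<forall>h\<in>Cc01. lf_integral \<kappa> h =
     lf_integral \<nu> (\<lambda>t. lf_integral \<mu> (\<lambda>s. indicator {0..<1 - t} s * h (t + s))))"


subsection \<open>The measure algebra $M[0,1)$\<close>

typedef M01 = "{m. cmeasure_on borel01 m \<and> variation m {0..<1} < \<infinity>}"
  by (rule exI[of _ "\<lambda>_. 0"]) (auto simp: cmeasure_on_def)

setup_lifting type_definition_M01

instantiation M01 :: complex_normed_vector
begin

lift_definition zero_M01 :: M01 is "\<lambda>_. 0"
  by (auto simp: cmeasure_on_def)

lift_definition plus_M01 :: "M01 \<Rightarrow> M01 \<Rightarrow> M01" is "\<lambda>m n A. m A + n A"
  by (auto simp: cmeasure_on_def sums_add intro: le_less_trans[OF variation_add])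

lift_definition scaleC_M01 :: "complex \<Rightarrow> M01 \<Rightarrow> M01" is "\<lambda>c m A. c * m A"
  by (auto simp: cmeasure_on_def variation_mult ennreal_mult_less_top intro: sums_mult)

definition uminus_M01 :: "M01 \<Rightarrow> M01" where "uminus_M01 x = (-1) *\<^sub>C x"
definition minus_M01 :: "M01 \<Rightarrow> M01 \<Rightarrow> M01" where "minus_M01 x y = x + - y"
definition scaleR_M01 :: "real \<Rightarrow> M01 \<Rightarrow> M01" where "scaleR_M01 r x = complex_of_real r *\<^sub>C x"

lift_definition norm_M01 :: "M01 \<Rightarrow> real" is "\<lambda>m. enn2real (variation m {0..<1})" .

definition sgn_M01 :: "M01 \<Rightarrow> M01" where "sgn_M01 x = inverse (norm x) *\<^sub>R x"
definition dist_M01 :: "M01 \<Rightarrow> M01 \<Rightarrow> real" where "dist_M01 x y = norm (x - y)"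
definition uniformity_M01 :: "(M01 \<times> M01) filter" where
  "uniformity_M01 = (INF e\<in>{0<..}. principal {(x, y). dist x y < e})"
definition open_M01 :: "M01 set \<Rightarrow> bool" where
  "open_M01 U = (\<forall>x\<in>U. eventually (\<lambda>(x', y). x' = x \<longrightarrow> y \<in> U) uniformity)"

instance
proof
  fix x y z :: M01 and c d :: complex and r s :: real
  show "x + y + z = x + (y + z)" by transfer (auto simp: add.assoc)
  show "x + y = y + x" by transfer (auto simp: add.commute)
  show "0 + x = x" by transfer auto
  show "- x + x = 0" unfolding uminus_M01_def by transfer auto
  show "x - y = x + - y" by (rule minus_M01_def)
  show "r *\<^sub>R (x + y) = r *\<^sub>R x + r *\<^sub>R y"
    unfolding scaleR_M01_def by transfer (auto simp: algebra_simps)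
  show "(r + s) *\<^sub>R x = r *\<^sub>R x + s *\<^sub>R x"
    unfolding scaleR_M01_def by transfer (auto simp: algebra_simps)
  show "r *\<^sub>R s *\<^sub>R x = (r * s) *\<^sub>R x"
    unfolding scaleR_M01_def by transfer (auto simp: algebra_simps)
  show "1 *\<^sub>R x = x" unfolding scaleR_M01_def by transfer auto
  show "dist x y = norm (x - y)" by (rule dist_M01_def)
  show "sgn x = inverse (norm x) *\<^sub>R x" by (rule sgn_M01_def)
  show "uniformity = (INF e\<in>{0<..}. principal {(x, y::M01). dist x y < e})"
    by (rule uniformity_M01_def)
  show "open U = (\<forall>x\<in>U. eventually (\<lambda>(x', y). x' = x \<longrightarrow> y \<in> U) uniformity)" for U :: "M01 set"
    by (rule open_M01_def)
  show "(norm x = 0) = (x = 0)"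
  proof transfer
    fix m assume m: "cmeasure_on borel01 m \<and> variation m {0..<1} < \<infinity>"
    have "m A = 0" if "variation m {0..<1} = 0" for A
    proof (cases "A \<in> borel01")
      case True
      then have "ennreal (cmod (m A)) \<le> variation m {0..<1}"
        by (intro order_trans[OF variation_ge variation_mono]) (auto simp: borel01_def)
      with that show ?thesis by simp
    qed (use m in \<open>auto simp: cmeasure_on_def\<close>)
    then show "(enn2real (variation m {0..<1}) = 0) = (m = (\<lambda>_. 0))"
      using m by (auto simp: enn2real_eq_0_iff)
  qed
  show "norm (x + y) \<le> norm x + norm y"
  proof transfer
    fix m n assume m: "cmeasure_on borel01 m \<and> variation m {0..<1} < \<infinity>"
      and n: "cmeasure_on borel01 n \<and> variation n {0..<1} < \<infinity>"
    then have "enn2real (variation (\<lambda>A. m A + n A) {0..<1})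
        \<le> enn2real (variation m {0..<1} + variation n {0..<1})"
      by (intro enn2real_mono variation_add) auto
    also have "\<dots> = enn2real (variation m {0..<1}) + enn2real (variation n {0..<1})"
      using m n by (intro enn2real_plus) auto
    finally show "enn2real (variation (\<lambda>A. m A + n A) {0..<1})
        \<le> enn2real (variation m {0..<1}) + enn2real (variation n {0..<1})" .
  qed
  show "norm (r *\<^sub>R x) = \<bar>r\<bar> * norm x"
    unfolding scaleR_M01_def by transfer (auto simp: variation_mult enn2real_mult)
  show "c *\<^sub>C (x + y) = c *\<^sub>C x + c *\<^sub>C y" by transfer (auto simp: algebra_simps)
  show "(c + d) *\<^sub>C x = c *\<^sub>C x + d *\<^sub>C x" by transfer (auto simp: algebra_simps)
  show "c *\<^sub>C d *\<^sub>C x = (c * d) *\<^sub>C x" by transfer (auto simp: algebra_simps)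
  show "complex_of_real r *\<^sub>C x = r *\<^sub>R x" by (rule scaleR_M01_def[symmetric])
  show "norm (c *\<^sub>C x) = cmod c * norm x"
    by transfer (auto simp: variation_mult enn2real_mult)
qed

end

lift_definition lf_of_M :: "M01 \<Rightarrow> lfmeas" is "\<lambda>m A. if A \<in> lc_borel01 then m A else 0"
proof -
  fix m assume m: "cmeasure_on borel01 m \<and> variation m {0..<1} < \<infinity>"
  have sub: "lc_borel01 \<subseteq> borel01" by (auto simp: lc_borel01_def borel01_def)
  let ?n = "\<lambda>A. if A \<in> lc_borel01 then m A else 0"
  have "cmeasure_on lc_borel01 ?n"
    unfolding cmeasure_on_def
  proof (intro conjI allI impI)
    fix A :: "nat \<Rightarrow> real set"
    assume A: "range A \<subseteq> lc_borel01" "disjoint_family A" "(\<Union>i. A i) \<in> lc_borel01"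
    then have "(\<lambda>i. m (A i)) sums m (\<Union>i. A i)"
      using m sub unfolding cmeasure_on_def by blast
    moreover have "A i \<in> lc_borel01" for i using A by auto
    ultimately show "(\<lambda>i. ?n (A i)) sums ?n (\<Union>i. A i)" using A by simp
  qed auto
  moreover have "variation ?n {0..a} < \<infinity>" if "a < 1" for a
  proof -
    have "variation ?n {0..a} \<le> variation m {0..a}" by (rule variation_cong_le) auto
    also have "\<dots> \<le> variation m {0..<1}" using that by (intro variation_mono) auto
    finally show ?thesis using m by (auto intro: le_less_trans)
  qed
  ultimately show "cmeasure_on lc_borel01 ?n \<and> (\<forall>a<1. variation ?n {0..a} < \<infinity>)" by auto
qed

instantiation M01 :: times
begin
definition times_M01 :: "M01 \<Rightarrow> M01 \<Rightarrow> M01" where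
  "\<nu> * \<kappa> = (THE \<rho>. lf_of_M \<rho> = lf_conv (lf_of_M \<nu>) (lf_of_M \<kappa>))"
instance ..
end

definition X_M :: "M01 \<Rightarrow> M01" where
  "X_M \<nu> = Abs_M01 (\<lambda>A. if A \<in> borel01
     then cintegral (Rep_M01 \<nu>) (\<lambda>t. indicator A t * complex_of_real t) else 0)"


subsection \<open>The Volterra algebra $L^1[0,1)$\<close>

definition leb01 :: "real measure" where
  "leb01 = restrict_space lborel {0..<1}"

definition L1_rel :: "(real \<Rightarrow> complex) \<Rightarrow> (real \<Rightarrow> complex) \<Rightarrow> bool" where
  "L1_rel f g \<longleftrightarrow> integrable leb01 f \<and> integrable leb01 g \<and> (AE t in leb01. f t = g t)"

quotient_type L1_01 = "real \<Rightarrow> complex" / partial: L1_rel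
proof (rule part_equivpI)
  show "\<exists>f. L1_rel f f" by (rule exI[of _ "\<lambda>_. 0"]) (auto simp: L1_rel_def)
  show "symp L1_rel" by (auto simp: symp_def L1_rel_def elim: AE_mp)
  show "transp L1_rel" by (auto simp: transp_def L1_rel_def elim: AE_mp)
qed

instantiation L1_01 :: complex_normed_vector
begin

lift_definition zero_L1_01 :: L1_01 is "\<lambda>_. 0" by (auto simp: L1_rel_def)

lift_definition plus_L1_01 :: "L1_01 \<Rightarrow> L1_01 \<Rightarrow> L1_01" is "\<lambda>f g t. f t + g t"
  by (auto simp: L1_rel_def)

lift_definition scaleC_L1_01 :: "complex \<Rightarrow> L1_01 \<Rightarrow> L1_01" is "\<lambda>c f t. c * f t"
  by (auto simp: L1_rel_def)

definition uminus_L1_01 :: "L1_01 \<Rightarrow> L1_01" where "uminus_L1_01 x = (-1) *\<^sub>C x"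
definition minus_L1_01 :: "L1_01 \<Rightarrow> L1_01 \<Rightarrow> L1_01" where "minus_L1_01 x y = x + - y"
definition scaleR_L1_01 :: "real \<Rightarrow> L1_01 \<Rightarrow> L1_01" where
  "scaleR_L1_01 r x = complex_of_real r *\<^sub>C x"

lift_definition norm_L1_01 :: "L1_01 \<Rightarrow> real" is "\<lambda>f. LINT t|leb01. cmod (f t)"
  by (auto simp: L1_rel_def intro!: integral_cong_AE)

definition sgn_L1_01 :: "L1_01 \<Rightarrow> L1_01" where "sgn_L1_01 x = inverse (norm x) *\<^sub>R x"
definition dist_L1_01 :: "L1_01 \<Rightarrow> L1_01 \<Rightarrow> real" where "dist_L1_01 x y = norm (x - y)"
definition uniformity_L1_01 :: "(L1_01 \<times> L1_01) filter" where
  "uniformity_L1_01 = (INF e\<in>{0<..}. principal {(x, y). dist x y < e})"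
definition open_L1_01 :: "L1_01 set \<Rightarrow> bool" where
  "open_L1_01 U = (\<forall>x\<in>U. eventually (\<lambda>(x', y). x' = x \<longrightarrow> y \<in> U) uniformity)"

instance
proof
  fix x y z :: L1_01 and c d :: complex and r s :: real
  show "x + y + z = x + (y + z)" by transfer (auto simp: L1_rel_def add.assoc)
  show "x + y = y + x" by transfer (auto simp: L1_rel_def add.commute)
  show "0 + x = x" by transfer (auto simp: L1_rel_def)
  show "- x + x = 0" unfolding uminus_L1_01_def by transfer (auto simp: L1_rel_def)
  show "x - y = x + - y" by (rule minus_L1_01_def)
  show "r *\<^sub>R (x + y) = r *\<^sub>R x + r *\<^sub>R y"
    unfolding scaleR_L1_01_def by transfer (auto simp: L1_rel_def algebra_simps)
  show "(r + s) *\<^sub>R x = r *\<^sub>R x + s *\<^sub>R x"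
    unfolding scaleR_L1_01_def by transfer (auto simp: L1_rel_def distrib_right)
  show "r *\<^sub>R s *\<^sub>R x = (r * s) *\<^sub>R x"
    unfolding scaleR_L1_01_def by transfer (auto simp: L1_rel_def mult.assoc)
  show "1 *\<^sub>R x = x" unfolding scaleR_L1_01_def by transfer (auto simp: L1_rel_def)
  show "dist x y = norm (x - y)" by (rule dist_L1_01_def)
  show "sgn x = inverse (norm x) *\<^sub>R x" by (rule sgn_L1_01_def)
  show "uniformity = (INF e\<in>{0<..}. principal {(x, y::L1_01). dist x y < e})"
    by (rule uniformity_L1_01_def)
  show "open U = (\<forall>x\<in>U. eventually (\<lambda>(x', y). x' = x \<longrightarrow> y \<in> U) uniformity)" for U :: "L1_01 set"
    by (rule open_L1_01_def)
  show "(norm x = 0) = (x = 0)"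
    by transfer (auto simp: L1_rel_def integral_nonneg_eq_0_iff_AE)
  show "norm (x + y) \<le> norm x + norm y"
  proof transfer
    fix f g assume "L1_rel f f" "L1_rel g g"
    then have f: "integrable leb01 f" and g: "integrable leb01 g" by (auto simp: L1_rel_def)
    then have "(LINT t|leb01. cmod (f t + g t)) \<le> (LINT t|leb01. cmod (f t) + cmod (g t))"
      by (intro integral_mono) (auto intro: norm_triangle_ineq)
    with f g show "(LINT t|leb01. cmod (f t + g t))
        \<le> (LINT t|leb01. cmod (f t)) + (LINT t|leb01. cmod (g t))" by simp
  qed
  show "norm (r *\<^sub>R x) = \<bar>r\<bar> * norm x"
    unfolding scaleR_L1_01_def by transfer (auto simp: norm_mult)
  show "c *\<^sub>C (x + y) = c *\<^sub>C x + c *\<^sub>C y"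
    by transfer (auto simp: L1_rel_def distrib_left)
  show "(c + d) *\<^sub>C x = c *\<^sub>C x + d *\<^sub>C x"
    by transfer (auto simp: L1_rel_def distrib_right)
  show "c *\<^sub>C d *\<^sub>C x = (c * d) *\<^sub>C x" by transfer (auto simp: L1_rel_def mult.assoc)
  show "complex_of_real r *\<^sub>C x = r *\<^sub>R x" by (rule scaleR_L1_01_def[symmetric])
  show "norm (c *\<^sub>C x) = cmod c * norm x" by transfer (auto simp: norm_mult)
qed

end

text \<open>
  The integrand below is absolutely integrable for almost every $t$, and the class of the resulting
  function does not depend on the representatives.
\<close>

instantiation L1_01 :: times
begin
definition times_L1_01 :: "L1_01 \<Rightarrow> L1_01 \<Rightarrow> L1_01" where
  "f * g = abs_L1_01 (\<lambda>t. LINT s:{0..t}|lborel. rep_L1_01 f s * rep_L1_01 g (t - s))"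
instance ..
end

lift_definition X_L1 :: "L1_01 \<Rightarrow> L1_01" is "\<lambda>f t. complex_of_real t * f t"
proof -
  fix f g assume fg: "L1_rel f g"
  have "integrable leb01 (\<lambda>t. complex_of_real t * h t)" if h: "integrable leb01 h" for h
  proof (rule Bochner_Integration.integrable_bound[OF h])
    have "complex_of_real \<in> borel_measurable leb01"
      unfolding leb01_def by (intro measurable_restrict_space1) measurable
    then show "(\<lambda>t. complex_of_real t * h t) \<in> borel_measurable leb01" using h by measurable
    show "AE t in leb01. norm (complex_of_real t * h t) \<le> norm (h t)"
      by (auto simp: leb01_def space_restrict_space norm_mult mult_left_le_one_le intro!: AE_I2)
  qed
  with fg show "L1_rel (\<lambda>t. complex_of_real t * f t) (\<lambda>t. complex_of_real t * g t)"
    by (auto simp: L1_rel_def)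
qed

lemma lc_borel01_sets: "lc_borel01 \<subseteq> sets leb01"
  by (force simp: lc_borel01_def leb01_def sets_restrict_space)

text \<open>The identification of \<open>f\<close> with the measure \<open>f(t)dt\<close>.\<close>

lift_definition lf_of_L1 :: "L1_01 \<Rightarrow> lfmeas"
  is "\<lambda>f A. if A \<in> lc_borel01 then LINT t:A|leb01. f t else 0"
proof -
  fix f g assume fg: "L1_rel f g"
  then have f: "integrable leb01 f" by (auto simp: L1_rel_def)
  have eq: "(\<lambda>A. if A \<in> lc_borel01 then LINT t:A|leb01. f t else 0)
      = (\<lambda>A. if A \<in> lc_borel01 then LINT t:A|leb01. g t else 0)"
  proof -
    have "(LINT t:A|leb01. f t) = (LINT t:A|leb01. g t)" if "A \<in> lc_borel01" for A
    proof -
      have "A \<in> sets leb01" using that lc_borel01_sets by auto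
      with fg show ?thesis unfolding set_lebesgue_integral_def L1_rel_def
        by (intro integral_cong_AE borel_measurable_scaleR borel_measurable_indicator) auto
    qed
    then show ?thesis by auto
  qed
  have si: "set_integrable leb01 A f" if "A \<in> sets leb01" for A
    using f that unfolding set_integrable_def by (intro integrable_mult_indicator)
  let ?n = "\<lambda>A. if A \<in> lc_borel01 then LINT t:A|leb01. f t else 0"
  have "cmeasure_on lc_borel01 ?n"
    unfolding cmeasure_on_def
  proof (intro conjI allI impI)
    fix A :: "nat \<Rightarrow> real set"
    assume A: "range A \<subseteq> lc_borel01" "disjoint_family A" "(\<Union>i. A i) \<in> lc_borel01"
    then have lc: "A i \<in> lc_borel01" for i by auto
    then have sets: "A i \<in> sets leb01" for i using lc_borel01_sets by auto
    have "(\<lambda>n. LINT t:(\<Union>i<n. A i)|leb01. f t) \<longlonglongrightarrow> (LINT t:(\<Union>n. \<Union>i<n. A i)|leb01. f t)"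
    proof (rule set_integral_cont_up)
      show "incseq (\<lambda>n. \<Union>i<n. A i)" by (rule monoI) force
      show "set_integrable leb01 (\<Union>n. \<Union>i<n. A i) f" by (intro si sets.countable_UN) (auto intro: sets)
    qed (auto intro: sets)
    moreover have "(\<Union>n. \<Union>i<n. A i) = (\<Union>i. A i)" by auto
    moreover have "(LINT t:(\<Union>i<n. A i)|leb01. f t) = (\<Sum>i<n. LINT t:A i|leb01. f t)" for n
      using A(2) by (intro set_integral_finite_Union)
        (auto intro: si sets simp: disjoint_family_on_def)
    ultimately show "(\<lambda>i. ?n (A i)) sums ?n (\<Union>i. A i)"
      using lc A by (simp add: sums_def)
  qed auto
  moreover have "variation ?n {0..a} < \<infinity>" if a: "a < 1" for a
  proof -
    have "variation ?n {0..a} \<le> ennreal (LINT t|leb01. cmod (f t))"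
      unfolding variation_def
    proof (rule SUP_least)
      fix P assume P: "P \<in> {P. finite P \<and> disjoint P \<and> P \<subseteq> sets borel \<and> \<Union>P \<subseteq> {0..a}}"
      have B: "B \<in> lc_borel01" "B \<in> sets leb01" if "B \<in> P" for B
      proof -
        show "B \<in> lc_borel01" using P that a by (auto simp: lc_borel01_def)
        then show "B \<in> sets leb01" using lc_borel01_sets by auto
      qed
      have "(\<Sum>B\<in>P. cmod (?n B)) = (\<Sum>B\<in>P. cmod (LINT t:B|leb01. f t))"
        using B by (intro sum.cong) auto
      also have "\<dots> \<le> (\<Sum>B\<in>P. LINT t:B|leb01. cmod (f t))"
        using B by (intro sum_mono set_integral_norm_bound si) auto
      also have "\<dots> = (LINT t:(\<Union>B\<in>P. B)|leb01. cmod (f t))"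
        using P B by (intro set_integral_finite_Union[symmetric])
          (auto simp: disjoint_family_on_def disjoint_def intro: set_integrable_norm si)
      also have "\<dots> \<le> (LINT t|leb01. cmod (f t))"
      proof -
        have "(\<Union>B\<in>P. B) \<in> sets leb01" using P B by auto
        then have "integrable leb01 (\<lambda>t. indicator (\<Union>B\<in>P. B) t *\<^sub>R cmod (f t))"
          using f by (intro integrable_mult_indicator) auto
        with f show ?thesis unfolding set_lebesgue_integral_def
          by (intro integral_mono) (auto split: split_indicator)
      qed
      finally show "(\<Sum>B\<in>P. ennreal (cmod (?n B))) \<le> ennreal (LINT t|leb01. cmod (f t))"
        by (subst sum_ennreal) (auto intro: ennreal_leI)
    qed
    then show ?thesis by (auto intro: le_less_trans)
  qed
  ultimately show "(cmeasure_on lc_borel01 ?n \<and> (\<forall>a<1. variation ?n {0..a} < \<infinity>)) \<and>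
      ?n = (\<lambda>A. if A \<in> lc_borel01 then LINT t:A|leb01. g t else 0)"
    using eq by auto
qed


section \<open>The derivations $D_\mu$ and $\overline D_\mu$\<close>

text \<open>
  If $t|\mu|([0,1-t))$ is bounded as $t\to0_+$, the locally finite measure $Xf*\mu$ has an integrable
  density and $X\nu*\mu$ is the restriction of a finite measure; both are then unique.
\<close>

definition D_L1 :: "lfmeas \<Rightarrow> L1_01 \<Rightarrow> L1_01" where
  "D_L1 \<mu> f = (THE g. lf_of_L1 g = lf_conv (lf_of_L1 (X_L1 f)) \<mu>)"

definition D_M :: "lfmeas \<Rightarrow> M01 \<Rightarrow> M01" where
  "D_M \<mu> \<nu> = (THE \<kappa>. lf_of_M \<kappa> = lf_conv (lf_of_M (X_M \<nu>)) \<mu>)"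

end

theory Submission
  imports Defs
begin

text \<open>
  Put $\Phi(t) = t\,\delta_t*\mu$ for $0\le t<1$ and $\Phi(1)=0$; the growth condition makes these
  finite measures of bounded norm, and $\overline D_\mu\nu = \int\Phi\,d\nu$.

  If (c) holds, then $\Phi$ is norm continuous on $[0,1]$: away from $0$ because translation is
  continuous in $L^1$, and at $0$ because $\|\Phi(t)\| = t|\mu|([0,1-t))$. Replacing $\Phi$ by a step
  function shows that $\overline D_\mu$ is a norm limit of operators of finite rank. Since $D_\mu$ is the
  restriction of $\overline D_\mu$ to the closed subspace of absolutely continuous measures, both
  operators are compact.

  Conversely, let a weakly compact set $K$ of measures contain the image under $\overline D_\mu$ of the unit ball of
  $L^1$. An approximate identity shifted by $t$ shows that $\Phi(t)$ is a weak cluster point of absolutely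
  continuous elements of $K$, so that $\Phi(t)\in K$ and $\mu$ is absolutely continuous. If $\|\Phi(t)\|$ did not
  tend to $0$, then, as $\Phi(t)([0,b))\to0$ for all $b<1$, a gliding hump yields $t_k\to0$ and a Borel set $A$
  with $|\Phi(t_k)(A)|$ bounded away from $0$, although the only weak cluster point of $\Phi(t_k)$ is $0$.
\<close>

section \<open>Jordan decompositions and densities\<close>

text \<open>The convolution, the product of M[0,1) and both derivations are given by definite
  descriptions, and integrals against a complex measure by four Jordan parts. To compute with them,
  every measure is written as the image of a weight on a sigma-finite space. Sharp constants are
  given up for this: the recurring factor 4 stands for real and imaginary, positive and negative
  part.

  All estimates take place in M[0,1). L^1[0,1) enters as the set of measures vanishing on Lebesgue
  null sets, and compactness is carried along this embedding in both directions. Weak limits are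
  tested by the functionals m \<mapsto> m(A) with A a Borel set; cluster points are identified on
  the intervals [0,b).

  The obstacle is that \<mu> may have infinite mass near 1. The factor t balances it in norm, but
  the mass of \<Phi>(t) then runs off towards 1 as t tends to 0. On every [0,b) with b < 1 it
  disappears, which forces the cluster point 0; only a Borel set accumulating at 1 can detect what
  is lost, hence a gliding hump built from windows that approach 1.\<close>

definition borel01_ring :: "real set set \<Rightarrow> bool" where
  "borel01_ring R \<longleftrightarrow> R = borel01 \<or> R = lc_borel01"

text \<open>The real counterpart of \<open>cmeasure_on\<close>. With the domain R as a parameter,
  finite and locally finite measures share one Jordan decomposition.\<close>

definition signed_on :: "real set set \<Rightarrow> (real set \<Rightarrow> real) \<Rightarrow> bool" where
  "signed_on R r \<longleftrightarrow> (\<forall>A. A \<notin> R \<longrightarrow> r A = 0) \<and>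
     (\<forall>A. range A \<subseteq> R \<longrightarrow> disjoint_family A \<longrightarrow> (\<Union>i. A i) \<in> R \<longrightarrow>
        (\<lambda>i::nat. r (A i)) sums r (\<Union>i. A i))"

text \<open>The bare set function from which \<open>upper_variation\<close> builds a measure. Borel
  subsets outside the domain of r compete with the value 0.\<close>

definition pos_var :: "(real set \<Rightarrow> real) \<Rightarrow> real set \<Rightarrow> ennreal" where
  "pos_var r A = (SUP B\<in>{B \<in> sets borel. B \<subseteq> A}. ennreal (r B))"

lemma borel01_ring_sub:
  assumes "borel01_ring R" "A \<in> R" "B \<in> sets borel" "B \<subseteq> A" shows "B \<in> R"
  using assms by (auto simp: borel01_ring_def borel01_def lc_borel01_def)

lemma borel01_ring_Un:
  assumes "borel01_ring R" "A \<in> R" "B \<in> R" shows "A \<union> B \<in> R"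
proof (cases "R = borel01")
  case False
  then have R: "R = lc_borel01" using assms by (auto simp: borel01_ring_def)
  then obtain a b where "a < 1" "b < 1" "A \<subseteq> {0..a}" "B \<subseteq> {0..b}"
    using assms by (auto simp: lc_borel01_def)
  then have "max a b < 1" "A \<union> B \<subseteq> {0..max a b}" by (auto simp: le_max_iff_disj dest: subsetD)
  then show ?thesis using assms R unfolding lc_borel01_def by blast
qed (use assms in \<open>auto simp: borel01_def\<close>)

lemma borel01_ring_sets: "borel01_ring R \<Longrightarrow> A \<in> R \<Longrightarrow> A \<in> sets borel \<and> A \<subseteq> {0..<1}"
  by (force simp: borel01_ring_def borel01_def lc_borel01_def)

lemma borel01_ring_empty: "borel01_ring R \<Longrightarrow> {} \<in> R"
  by (auto simp: borel01_ring_def borel01_def lc_borel01_def intro!: exI[of _ 0])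

lemma lc_borel01_subset_ring: "borel01_ring R \<Longrightarrow> lc_borel01 \<subseteq> R"
  by (force simp: borel01_ring_def borel01_def lc_borel01_def)

text \<open>The constant sequence of empty sets is disjoint, and a constant series converges only if
  its term is 0.\<close>

lemma signed_on_empty:
  assumes "borel01_ring R" "signed_on R r" shows "r {} = 0"
proof -
  have "(\<lambda>i::nat. r {}) sums r (\<Union>i::nat. {})"
    using assms borel01_ring_empty[OF assms(1)] unfolding signed_on_def
    by (auto simp: disjoint_family_on_def dest!: spec[of _ "\<lambda>_. {}"])
  then show ?thesis by (simp add: sums_iff summable_const_iff)
qed

lemma signed_on_Un:
  assumes R: "borel01_ring R" and r: "signed_on R r" and A: "A \<in> R" "B \<in> R" "A \<inter> B = {}"
  shows "r (A \<union> B) = r A + r B"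
proof -
  have "(\<lambda>i. r (binaryset A B i)) sums r (\<Union>i. binaryset A B i)"
  proof -
    have "range (binaryset A B) \<subseteq> R"
      using A borel01_ring_empty[OF R] by (auto simp: range_binaryset_eq)
    moreover have "disjoint_family (binaryset A B)"
      using A by (auto simp: disjoint_family_on_def binaryset_def)
    moreover have "(\<Union>i. binaryset A B i) \<in> R"
      using borel01_ring_Un[OF R] A by (simp add: UN_binaryset_eq)
    ultimately show ?thesis using r unfolding signed_on_def by blast
  qed
  moreover have "(\<lambda>i. r (binaryset A B i)) sums (r A + r B)"
    using binaryset_sums[of r] signed_on_empty[OF R r] by blast
  ultimately show ?thesis by (simp add: UN_binaryset_eq sums_unique2)
qed

lemma signed_on_uminus: "signed_on R r \<Longrightarrow> signed_on R (\<lambda>A. - r A)"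
  unfolding signed_on_def by (auto intro!: sums_minus)

lemma pos_var_superadd:
  assumes R: "borel01_ring R" and r: "signed_on R r" and "A \<inter> B = {}"
  shows "pos_var r A + pos_var r B \<le> pos_var r (A \<union> B)"
proof -
  have ne: "{B \<in> sets borel. B \<subseteq> A} \<noteq> {}" for A :: "real set" by auto
  have "ennreal (r C) + ennreal (r D) \<le> pos_var r (A \<union> B)"
    if CD: "C \<in> sets borel" "C \<subseteq> A" "D \<in> sets borel" "D \<subseteq> B" for C D
  proof -
    \<comment> \<open>\<open>ennreal\<close> turns negative values into 0, so additivity of r
      matters only when both values are positive. They are then nonzero, which puts both sets into
      R.\<close>
    consider "r C \<le> 0" | "r D \<le> 0" | "r C > 0" "r D > 0" by linarith
    then show ?thesis
    proof cases
      case 1 then show ?thesis using CD unfolding pos_var_def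
        by (auto simp: ennreal_neg intro!: SUP_upper)
    next
      case 2 then show ?thesis using CD unfolding pos_var_def
        by (auto simp: ennreal_neg intro!: SUP_upper)
    next
      case 3
      then have "C \<in> R" "D \<in> R" using r unfolding signed_on_def by force+
      then have "r (C \<union> D) = r C + r D" using CD assms by (intro signed_on_Un[OF R r]) auto
      then have "ennreal (r C) + ennreal (r D) = ennreal (r (C \<union> D))" using 3 by (simp flip: ennreal_plus)
      then show ?thesis using CD unfolding pos_var_def by (auto intro!: SUP_upper)
    qed
  qed
  then have "ennreal (r C) + pos_var r B \<le> pos_var r (A \<union> B)" if "C \<in> sets borel" "C \<subseteq> A" for C
    unfolding pos_var_def[of r B] using that
    by (subst ennreal_SUP_add_right[OF ne], intro SUP_least) auto
  then show ?thesis
    unfolding pos_var_def[of r A]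
    by (subst ennreal_SUP_add_left[symmetric, OF ne], intro SUP_least) auto
qed

text \<open>For \<le>, superadditivity passes from finite unions to the limit. For \<ge>, a
  competing subset B of the union is cut along the \<open>A i\<close>; outside R it competes with
  the value 0. In this way a set function known only on \<open>lc_borel01\<close> yields a measure
  on all of \<open>borel01\<close>, possibly with infinite values.\<close>

lemma pos_var_measure_space:
  assumes R: "borel01_ring R" and r: "signed_on R r"
  shows "measure_space {0..<1} borel01 (pos_var r)"
  unfolding measure_space_def
proof (intro conjI)
  have eq: "borel01 = sets (restrict_space borel {0..<1::real})"
    by (auto simp: borel01_def sets_restrict_space)
  show "sigma_algebra {0..<1} borel01"
    unfolding eq using sets.sigma_algebra_axioms[of "restrict_space borel {0..<1::real}"]
    by (simp add: space_restrict_space)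
  have 0: "r {} = 0" by (rule signed_on_empty[OF R r])
  show "positive borel01 (pos_var r)" by (auto simp: positive_def pos_var_def 0 subset_empty[THEN iffD1] intro!: SUP_eqI)
  show "countably_additive borel01 (pos_var r)"
    unfolding countably_additive_def
  proof (intro allI impI)
    fix A :: "nat \<Rightarrow> real set" assume A: "range A \<subseteq> borel01" "disjoint_family A" "(\<Union>i. A i) \<in> borel01"
    have Ab: "A i \<in> sets borel" for i using A(1) by (auto simp: borel01_def)
    show "(\<Sum>i. pos_var r (A i)) = pos_var r (\<Union>i. A i)"
    proof (rule antisym)
      have "(\<Sum>i<n. pos_var r (A i)) \<le> pos_var r (\<Union>i<n. A i)" for n
      proof (induction n)
        case (Suc n)
        have "(\<Sum>i<Suc n. pos_var r (A i)) \<le> pos_var r (\<Union>i<n. A i) + pos_var r (A n)"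
          using Suc by (simp add: add_mono)
        also have "\<dots> \<le> pos_var r ((\<Union>i<n. A i) \<union> A n)"
          using A(2) by (intro pos_var_superadd[OF R r]) (auto simp: disjoint_family_on_def, metis disjoint_iff less_irrefl)
        also have "(\<Union>i<n. A i) \<union> A n = (\<Union>i<Suc n. A i)" by (auto simp: less_Suc_eq)
        finally show ?case .
      qed simp
      also have "pos_var r (\<Union>i<n. A i) \<le> pos_var r (\<Union>i. A i)" for n
        unfolding pos_var_def by (intro SUP_subset_mono) auto
      finally show "(\<Sum>i. pos_var r (A i)) \<le> pos_var r (\<Union>i. A i)"
        by (intro suminf_le_const) auto
    next
      show "pos_var r (\<Union>i. A i) \<le> (\<Sum>i. pos_var r (A i))"
        unfolding pos_var_def[of r "\<Union>i. A i"]
      proof (rule SUP_least)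
        fix B assume B: "B \<in> {B \<in> sets borel. B \<subseteq> (\<Union>i. A i)}"
        show "ennreal (r B) \<le> (\<Sum>i. pos_var r (A i))"
        proof (cases "B \<in> R")
          case True
          have sub: "B \<inter> A i \<in> R" for i
            by (rule borel01_ring_sub[OF R True]) (use B Ab in auto)
          have U: "(\<Union>i. B \<inter> A i) = B" using B by auto
          have "(\<lambda>i. r (B \<inter> A i)) sums r (\<Union>i. B \<inter> A i)"
          proof -
            have "range (\<lambda>i. B \<inter> A i) \<subseteq> R" "(\<Union>i. B \<inter> A i) \<in> R" using sub True U by auto
            moreover have "disjoint_family (\<lambda>i. B \<inter> A i)" using A(2) unfolding disjoint_family_on_def by blast
            ultimately show ?thesis using r unfolding signed_on_def by blast
          qed
          then have s: "(\<lambda>n. \<Sum>i<n. r (B \<inter> A i)) \<longlonglongrightarrow> r B" by (simp only: U sums_def)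
          have "ennreal (\<Sum>i<n. r (B \<inter> A i)) \<le> (\<Sum>i. pos_var r (A i))" for n
          proof -
            have "ennreal (\<Sum>i<n. r (B \<inter> A i)) \<le> ennreal (\<Sum>i<n. max 0 (r (B \<inter> A i)))"
              by (intro ennreal_leI sum_mono) auto
            also have "\<dots> = (\<Sum>i<n. ennreal (max 0 (r (B \<inter> A i))))" by (rule sum_ennreal[symmetric]) auto
            also have "\<dots> = (\<Sum>i<n. ennreal (r (B \<inter> A i)))"
              by (intro sum.cong) (auto simp: max_def ennreal_neg)
            also have "\<dots> \<le> (\<Sum>i<n. pos_var r (A i))"
              unfolding pos_var_def by (intro sum_mono SUP_upper) (use B Ab in auto)
            also have "\<dots> \<le> (\<Sum>i. pos_var r (A i))" by (intro sum_le_suminf) auto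
            finally show ?thesis .
          qed
          then show ?thesis
            by (intro tendsto_upperbound[OF tendsto_ennrealI[OF s]]) auto
        qed (use r in \<open>auto simp: signed_on_def\<close>)
      qed
    qed
  qed
qed

lemma upper_variation_facts:
  assumes R: "borel01_ring R" and r: "signed_on R r"
  shows sets_upper_variation: "sets (upper_variation r) = borel01"
    and space_upper_variation: "space (upper_variation r) = {0..<1}"
    and emeasure_upper_variation: "A \<in> borel01 \<Longrightarrow> emeasure (upper_variation r) A = pos_var r A"
proof -
  have *: "upper_variation r = measure_of {0..<1} borel01 (pos_var r)"
    unfolding upper_variation_def pos_var_def[abs_def] ..
  note ms = pos_var_measure_space[OF R r, unfolded measure_space_def]
  then interpret sigma_algebra "{0..<1}" borel01 by auto
  show "sets (upper_variation r) = borel01" unfolding * by simp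
  show "space (upper_variation r) = {0..<1}" unfolding * by (simp add: space_measure_of_conv)
  show "A \<in> borel01 \<Longrightarrow> emeasure (upper_variation r) A = pos_var r A"
    unfolding * using ms by (intro emeasure_measure_of_sigma) (auto intro: sigma_algebra_axioms)
qed

lemma pos_var_mono: "A \<subseteq> B \<Longrightarrow> pos_var r A \<le> pos_var r B"
  unfolding pos_var_def by (intro SUP_subset_mono) auto

text \<open>For B inside A, r B = r A - r (A - B), and - r (A - B) is at most the negative
  variation. The supremum over B gives one inequality, the same argument for - r the other.\<close>

lemma pos_var_jordan:
  assumes R: "borel01_ring R" and r: "signed_on R r" and A: "A \<in> R"
    and fin: "pos_var r A < \<infinity>" "pos_var (\<lambda>A. - r A) A < \<infinity>"
  shows "r A = enn2real (pos_var r A) - enn2real (pos_var (\<lambda>A. - r A) A)"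
proof -
  have *: "enn2real (pos_var r A) \<le> r A + enn2real (pos_var (\<lambda>A. - r A) A)"
    if r: "signed_on R r" and fin: "pos_var r A < \<infinity>" "pos_var (\<lambda>A. - r A) A < \<infinity>" for r
  proof -
    have le: "r B \<le> r A + enn2real (pos_var (\<lambda>A. - r A) A)" if B: "B \<in> sets borel" "B \<subseteq> A" for B
    proof -
      have sub: "B \<in> R" "A - B \<in> R" using B borel01_ring_sub[OF R A] borel01_ring_sets[OF R A] by auto
      then have "r (B \<union> (A - B)) = r B + r (A - B)" by (intro signed_on_Un[OF R r]) auto
      moreover have "r (B \<union> (A - B)) = r A" using B by (simp add: Un_absorb1)
      moreover have "ennreal (- r (A - B)) \<le> pos_var (\<lambda>A. - r A) A"
        unfolding pos_var_def using borel01_ring_sets[OF R sub(2)] by (intro SUP_upper) auto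
      then have "ennreal (- r (A - B)) \<le> ennreal (enn2real (pos_var (\<lambda>A. - r A) A))"
        using fin by simp
      then have "- r (A - B) \<le> enn2real (pos_var (\<lambda>A. - r A) A)"
        by (subst (asm) ennreal_le_iff) auto
      ultimately show ?thesis by linarith
    qed
    have "pos_var r A \<le> ennreal (r A + enn2real (pos_var (\<lambda>A. - r A) A))"
      unfolding pos_var_def[of r A] using le by (intro SUP_least ennreal_leI) auto
    moreover have "0 \<le> r A + enn2real (pos_var (\<lambda>A. - r A) A)"
      using le[of "{}"] signed_on_empty[OF R r] by simp
    ultimately show ?thesis by (metis enn2real_leI)
  qed
  show ?thesis using *[OF r fin] *[OF signed_on_uminus[OF r]] fin by simp
qed

text \<open>The measures live on the whole line, so the exhaustion of [0,1) by compact intervals is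
  completed by the null set outside.\<close>

lemma sigma_finite_borel01:
  assumes sN: "sets N = sets borel" and out: "emeasure N (- {0..<1}) = 0"
    and fin: "\<And>a::real. a < 1 \<Longrightarrow> emeasure N {0..a} < \<infinity>"
  shows "sigma_finite_measure N"
proof
  define S where "S = insert (- {0..<1}) (range (\<lambda>n::nat. {0..1 - 1 / real (Suc n)}))"
  have cover: "\<exists>X\<in>S. x \<in> X" for x :: real
  proof (cases "x \<in> {0..<1}")
    case True
    then obtain n where "inverse (real (Suc n)) < 1 - x" using reals_Archimedean[of "1 - x"] by auto
    then have "x \<in> {0..1 - 1 / real (Suc n)}" using True by (auto simp: field_simps)
    then show ?thesis unfolding S_def by blast
  qed (auto simp: S_def)
  have "emeasure N A \<noteq> \<infinity>" if "A \<in> S" for A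
    using that out fin[of "1 - 1 / real (Suc n)" for n] unfolding S_def by (auto simp: less_top)
  moreover have "countable S" "S \<subseteq> sets N" by (auto simp: S_def sN intro: borel_comp)
  moreover have "\<Union> S = space N" using cover sets_eq_imp_space_eq[OF sN] by auto
  ultimately show "\<exists>A. countable A \<and> A \<subseteq> sets N \<and> \<Union> A = space N \<and> (\<forall>a\<in>A. emeasure N a \<noteq> \<infinity>)" by blast
qed

text \<open>\<open>upper_variation r\<close> has only subsets of [0,1) as measurable sets and
  changes with r. A density turns integrals against it into integrals against one fixed \<Lambda> on
  the line, where the four Jordan parts can be added up.\<close>

definition upper_density :: "real measure \<Rightarrow> (real set \<Rightarrow> real) \<Rightarrow> (real \<Rightarrow> real) \<Rightarrow> bool" where
  "upper_density \<Lambda> r p \<longleftrightarrow> p \<in> borel_measurable borel \<and> (\<forall>x. 0 \<le> p x) \<and> (\<forall>x. x \<notin> {0..<1} \<longrightarrow> p x = 0) \<and>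
    (\<forall>A\<in>borel01. (\<integral>\<^sup>+x. ennreal (p x) * indicator A x \<partial>\<Lambda>) = pos_var r A) \<and>
    (\<forall>f::real \<Rightarrow> complex. f \<in> borel_measurable borel \<longrightarrow> (LINT x|upper_variation r. f x) = (LINT x|\<Lambda>. p x *\<^sub>R f x))"

lemma pos_var_density:
  assumes R: "borel01_ring R" and r: "signed_on R r"
    and fin: "\<And>a. a < 1 \<Longrightarrow> pos_var r {0..a} < \<infinity>"
    and L: "sigma_finite_measure \<Lambda>" "sets \<Lambda> = sets borel"
    and ac: "\<And>A. A \<in> R \<Longrightarrow> emeasure \<Lambda> A = 0 \<Longrightarrow> r A = 0"
  shows "\<exists>p. upper_density \<Lambda> r p"
proof -
  interpret L: sigma_finite_measure \<Lambda> by fact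
  note uv = upper_variation_facts[OF R r]
  have id_meas: "(\<lambda>x. x) \<in> measurable (upper_variation r) borel"
    by (auto simp: measurable_def uv borel01_def)
  \<comment> \<open>The image under the inclusion of [0,1) into the line, which can be compared with
    \<Lambda> by the Radon-Nikodym theorem.\<close>
  define N where "N = distr (upper_variation r) borel (\<lambda>x. x)"
  have sN[simp]: "sets N = sets borel" "space N = UNIV" by (auto simp: N_def)
  have eN: "emeasure N A = pos_var r (A \<inter> {0..<1})" if "A \<in> sets borel" for A
    unfolding N_def using that by (subst emeasure_distr[OF id_meas]) (auto simp: uv borel01_def)
  have pv0: "pos_var r {} = 0" unfolding pos_var_def
    by (auto simp: signed_on_empty[OF R r] subset_empty[THEN iffD1] intro!: SUP_eqI)
  have sfN: "sigma_finite_measure N"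
  proof (rule sigma_finite_borel01)
    show "emeasure N (- {0..<1}) = 0" by (subst eN) (auto simp: pv0)
    show "emeasure N {0..a} < \<infinity>" if "a < 1" for a
      using le_less_trans[OF pos_var_mono fin[OF that], of "{0..a} \<inter> {0..<1}"] by (subst eN) auto
  qed simp
  have acN: "absolutely_continuous \<Lambda> N"
    unfolding absolutely_continuous_def
  proof
    fix A assume A: "A \<in> null_sets \<Lambda>"
    then have Ab: "A \<in> sets borel" and A0: "emeasure \<Lambda> A = 0" using L by auto
    have "pos_var r (A \<inter> {0..<1}) \<le> 0"
      unfolding pos_var_def
    proof (rule SUP_least)
      fix B assume B: "B \<in> {B \<in> sets borel. B \<subseteq> A \<inter> {0..<1}}"
      then have "emeasure \<Lambda> B = 0"
        using A0 emeasure_mono[of B A \<Lambda>] Ab L by auto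
      then have "r B = 0" using ac r unfolding signed_on_def by blast
      then show "ennreal (r B) \<le> 0" by simp
    qed
    then show "A \<in> null_sets N" using Ab by (auto simp: eN null_sets_def)
  qed
  define d where "d = RN_deriv \<Lambda> N"
  have d[measurable]: "d \<in> borel_measurable borel"
    unfolding d_def using borel_measurable_RN_deriv[of \<Lambda> N] L by (simp cong: measurable_cong_sets)
  have dens: "density \<Lambda> d = N" unfolding d_def using acN L by (intro L.density_RN_deriv) auto
  have dfin: "AE x in \<Lambda>. d x \<noteq> \<infinity>"
    unfolding d_def by (rule L.RN_deriv_finite[OF sfN acN]) (use L in auto)
  \<comment> \<open>On a \<Lambda>-null set the derivative may be infinite, or nonzero outside
    [0,1); p is a real version that repairs both.\<close>
  define p where "p x = enn2real (d x) * indicator {0..<1} x" for x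
  have p[measurable]: "p \<in> borel_measurable borel" unfolding p_def by measurable
  have mL[measurable_cong]: "sets \<Lambda> = sets borel" by (rule L)
  have d0: "AE x in \<Lambda>. x \<notin> {0..<1} \<longrightarrow> d x = 0"
  proof -
    define Z where "Z = - {0..<1::real}"
    have Z[measurable]: "Z \<in> sets borel" unfolding Z_def by (rule borel_comp) auto
    have "emeasure N Z = 0"
      by (subst eN[OF Z]) (auto simp: Z_def pos_var_def signed_on_empty[OF R r] subset_empty[THEN iffD1] intro!: SUP_eqI)
    then have "(\<integral>\<^sup>+x. d x * indicator Z x \<partial>\<Lambda>) = 0"
      by (subst (asm) dens[symmetric], subst (asm) emeasure_density) (auto simp: L d_def)
    moreover have "(\<lambda>x. d x * indicator Z x) \<in> borel_measurable \<Lambda>" by measurable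
    ultimately have "AE x in \<Lambda>. d x * indicator Z x = 0"
      using nn_integral_0_iff_AE by blast
    then show ?thesis by eventually_elim (auto simp: Z_def split: split_indicator_asm)
  qed
  have dp: "AE x in \<Lambda>. d x = ennreal (p x)"
    using dfin d0 by eventually_elim (auto simp: p_def ennreal_enn2real_if split: split_indicator)
  have dens': "density \<Lambda> (\<lambda>x. ennreal (p x)) = N"
    unfolding dens[symmetric] by (intro density_cong, measurable) (use dp in auto)
  show ?thesis
    unfolding upper_density_def
  proof (intro exI[of _ p] conjI allI ballI impI)
    show "p \<in> borel_measurable borel" by fact
    show "0 \<le> p x" for x by (auto simp: p_def)
    show "x \<notin> {0..<1} \<Longrightarrow> p x = 0" for x by (auto simp: p_def)
  next
    fix A assume A: "A \<in> borel01"
    then have "A \<in> sets borel" "A \<inter> {0..<1} = A" by (auto simp: borel01_def)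
    then show "(\<integral>\<^sup>+x. ennreal (p x) * indicator A x \<partial>\<Lambda>) = pos_var r A"
      using eN[of A] by (subst emeasure_density[symmetric]) (auto simp: dens' L)
  next
    fix f :: "real \<Rightarrow> complex" assume [measurable]: "f \<in> borel_measurable borel"
    have "(LINT x|upper_variation r. f x) = (LINT x|N. f x)"
      unfolding N_def by (subst integral_distr[OF id_meas]) auto
    also have "\<dots> = (LINT x|\<Lambda>. p x *\<^sub>R f x)"
      unfolding dens'[symmetric] by (subst integral_density) (auto simp: p_def)
    finally show "(LINT x|upper_variation r. f x) = (LINT x|\<Lambda>. p x *\<^sub>R f x)" .
  qed
qed

lemma pos_var_le_variation: "pos_var r A \<le> variation m A" if "\<And>B. r B \<le> cmod (m B)"
  unfolding pos_var_def
proof (rule SUP_least)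
  fix B assume B: "B \<in> {B \<in> sets borel. B \<subseteq> A}"
  have "ennreal (r B) \<le> ennreal (cmod (m B))" using that by (intro ennreal_leI)
  also have "\<dots> \<le> variation m B" using B by (intro variation_ge) auto
  also have "\<dots> \<le> variation m A" using B by (intro variation_mono) auto
  finally show "ennreal (r B) \<le> variation m A" .
qed

text \<open>The factor $4$ comes from the four positive parts of a complex measure; sharp constants are never needed.\<close>

lemma cmeasure_density:
  assumes R: "borel01_ring R" and m: "cmeasure_on R m"
    and fin: "\<And>a. a < 1 \<Longrightarrow> variation m {0..a} < \<infinity>"
    and L: "sigma_finite_measure \<Lambda>" "sets \<Lambda> = sets borel"
    and ac: "\<And>A. A \<in> R \<Longrightarrow> emeasure \<Lambda> A = 0 \<Longrightarrow> m A = 0"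
  obtains u :: "real \<Rightarrow> complex" where "u \<in> borel_measurable borel" "\<And>x. x \<notin> {0..<1} \<Longrightarrow> u x = 0"
    "\<And>A. A \<in> borel01 \<Longrightarrow> (\<integral>\<^sup>+x. ennreal (cmod (u x)) * indicator A x \<partial>\<Lambda>) \<le> 4 * variation m A"
    "\<And>f C A. f \<in> borel_measurable borel \<Longrightarrow> A \<in> borel01 \<Longrightarrow> variation m A < \<infinity> \<Longrightarrow>
       (\<And>x. x \<in> {0..<1} \<Longrightarrow> cmod (f x) \<le> C * indicator A x) \<Longrightarrow>
       integrable \<Lambda> (\<lambda>x. f x * u x) \<and> cintegral m f = (LINT x|\<Lambda>. f x * u x)"
    "\<And>A. A \<in> R \<Longrightarrow> variation m A < \<infinity> \<Longrightarrow> m A = (LINT x|\<Lambda>. indicator A x * u x)"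
proof -
  have sg: "signed_on R (\<lambda>A. Re (m A))" "signed_on R (\<lambda>A. Im (m A))"
    using m unfolding signed_on_def cmeasure_on_def by (auto intro: sums_Re sums_Im)
  note sg = sg sg[THEN signed_on_uminus]
  note le = abs_Re_le_cmod abs_Im_le_cmod
  have pv: "pos_var (\<lambda>A. Re (m A)) A \<le> variation m A" "pos_var (\<lambda>A. Im (m A)) A \<le> variation m A"
    "pos_var (\<lambda>A. - Re (m A)) A \<le> variation m A" "pos_var (\<lambda>A. - Im (m A)) A \<le> variation m A" for A
    using le by (auto intro!: pos_var_le_variation intro: abs_le_D1 abs_le_D2)
  have *: "\<exists>p. upper_density \<Lambda> r p"
    if "signed_on R r" "\<And>A. pos_var r A \<le> variation m A" "\<And>A. A \<in> R \<Longrightarrow> emeasure \<Lambda> A = 0 \<Longrightarrow> r A = 0" for r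
    using that(2) fin by (intro pos_var_density[OF R that(1) _ L that(3)]) (auto intro: le_less_trans)
  obtain p1 where "upper_density \<Lambda> (\<lambda>A. Re (m A)) p1" using *[OF sg(1) pv(1)] ac by auto
  then have p1[measurable]: "p1 \<in> borel_measurable borel" and p1': "\<And>x. 0 \<le> p1 x" "\<And>x. x \<notin> {0..<1} \<Longrightarrow> p1 x = 0"
    "\<And>A. A \<in> borel01 \<Longrightarrow> (\<integral>\<^sup>+x. ennreal (p1 x) * indicator A x \<partial>\<Lambda>) = pos_var (\<lambda>A. Re (m A)) A"
    "\<And>f::real \<Rightarrow> complex. f \<in> borel_measurable borel \<Longrightarrow> (LINT x|upper_variation (\<lambda>A. Re (m A)). f x) = (LINT x|\<Lambda>. p1 x *\<^sub>R f x)"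
    by (auto simp: upper_density_def)
  obtain p2 where "upper_density \<Lambda> (\<lambda>A. Im (m A)) p2" using *[OF sg(2) pv(2)] ac by auto
  then have p2[measurable]: "p2 \<in> borel_measurable borel" and p2': "\<And>x. 0 \<le> p2 x" "\<And>x. x \<notin> {0..<1} \<Longrightarrow> p2 x = 0"
    "\<And>A. A \<in> borel01 \<Longrightarrow> (\<integral>\<^sup>+x. ennreal (p2 x) * indicator A x \<partial>\<Lambda>) = pos_var (\<lambda>A. Im (m A)) A"
    "\<And>f::real \<Rightarrow> complex. f \<in> borel_measurable borel \<Longrightarrow> (LINT x|upper_variation (\<lambda>A. Im (m A)). f x) = (LINT x|\<Lambda>. p2 x *\<^sub>R f x)"
    by (auto simp: upper_density_def)
  obtain p3 where "upper_density \<Lambda> (\<lambda>A. - Re (m A)) p3" using *[OF sg(3) pv(3)] ac by auto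
  then have p3[measurable]: "p3 \<in> borel_measurable borel" and p3': "\<And>x. 0 \<le> p3 x" "\<And>x. x \<notin> {0..<1} \<Longrightarrow> p3 x = 0"
    "\<And>A. A \<in> borel01 \<Longrightarrow> (\<integral>\<^sup>+x. ennreal (p3 x) * indicator A x \<partial>\<Lambda>) = pos_var (\<lambda>A. - Re (m A)) A"
    "\<And>f::real \<Rightarrow> complex. f \<in> borel_measurable borel \<Longrightarrow> (LINT x|upper_variation (\<lambda>A. - Re (m A)). f x) = (LINT x|\<Lambda>. p3 x *\<^sub>R f x)"
    by (auto simp: upper_density_def)
  obtain p4 where "upper_density \<Lambda> (\<lambda>A. - Im (m A)) p4" using *[OF sg(4) pv(4)] ac by auto
  then have p4[measurable]: "p4 \<in> borel_measurable borel" and p4': "\<And>x. 0 \<le> p4 x" "\<And>x. x \<notin> {0..<1} \<Longrightarrow> p4 x = 0"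
    "\<And>A. A \<in> borel01 \<Longrightarrow> (\<integral>\<^sup>+x. ennreal (p4 x) * indicator A x \<partial>\<Lambda>) = pos_var (\<lambda>A. - Im (m A)) A"
    "\<And>f::real \<Rightarrow> complex. f \<in> borel_measurable borel \<Longrightarrow> (LINT x|upper_variation (\<lambda>A. - Im (m A)). f x) = (LINT x|\<Lambda>. p4 x *\<^sub>R f x)"
    by (auto simp: upper_density_def)
  note [measurable_cong] = L(2)
  define u where "u x = Complex (p1 x - p3 x) (p2 x - p4 x)" for x
  have u_alt: "u x = of_real (p1 x) - of_real (p3 x) + \<i> * (of_real (p2 x) - of_real (p4 x))" for x
    by (auto simp: u_def complex_eq_iff)
  have u[measurable]: "u \<in> borel_measurable borel" unfolding u_alt[abs_def] by measurable
  have ule: "cmod (u x) \<le> p1 x + p2 x + p3 x + p4 x" for x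
    using cmod_le[of "u x"] p1'(1)[of x] p2'(1)[of x] p3'(1)[of x] p4'(1)[of x] by (auto simp: u_def)
  have nn: "(\<integral>\<^sup>+x. ennreal (p1 x + p2 x + p3 x + p4 x) * indicator A x \<partial>\<Lambda>) \<le> 4 * variation m A" if A: "A \<in> borel01" for A
  proof -
    have [measurable]: "A \<in> sets borel" using A by (auto simp: borel01_def)
    have "(\<integral>\<^sup>+x. ennreal (p1 x + p2 x + p3 x + p4 x) * indicator A x \<partial>\<Lambda>)
      = (\<integral>\<^sup>+x. ennreal (p1 x) * indicator A x + ennreal (p2 x) * indicator A x + ennreal (p3 x) * indicator A x + ennreal (p4 x) * indicator A x \<partial>\<Lambda>)"
      using p1'(1) p2'(1) p3'(1) p4'(1) by (intro nn_integral_cong) (auto simp: distrib_right)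
    also have "\<dots> = pos_var (\<lambda>A. Re (m A)) A + pos_var (\<lambda>A. Im (m A)) A + pos_var (\<lambda>A. - Re (m A)) A + pos_var (\<lambda>A. - Im (m A)) A"
      using A by (simp add: nn_integral_add p1' p2' p3' p4')
    also have "\<dots> \<le> variation m A + variation m A + variation m A + variation m A"
      by (intro add_mono pv)
    also have "\<dots> = (1 + 1 + 1 + 1) * variation m A" by (simp only: distrib_right mult_1)
    also have "\<dots> = 4 * variation m A" by simp
    finally show ?thesis .
  qed
  have 3: "(\<integral>\<^sup>+x. ennreal (cmod (u x)) * indicator A x \<partial>\<Lambda>) \<le> 4 * variation m A" if A: "A \<in> borel01" for A
    using ule by (intro order_trans[OF nn_integral_mono nn[OF A]] mult_right_mono) (auto intro: ennreal_leI)
  have 4: "integrable \<Lambda> (\<lambda>x. f x * u x) \<and> cintegral m f = (LINT x|\<Lambda>. f x * u x)"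
    if f[measurable]: "f \<in> borel_measurable borel" and A: "A \<in> borel01" "variation m A < \<infinity>"
      and fC: "\<And>x. x \<in> {0..<1} \<Longrightarrow> cmod (f x) \<le> C * indicator A x" for f C A
  proof -
    have [measurable]: "A \<in> sets borel" using A by (auto simp: borel01_def)
    let ?p = "\<lambda>x. p1 x + p2 x + p3 x + p4 x"
    have p0: "?p x \<ge> 0" for x using p1'(1)[of x] p2'(1)[of x] p3'(1)[of x] p4'(1)[of x] by simp
    \<comment> \<open>The sum of the four parts dominates each of them, and its integral over A is
      at most four times the variation of m on A.\<close>
    have dom: "integrable \<Lambda> (\<lambda>x. \<bar>C\<bar> * (?p x * indicator A x))"
    proof (rule integrable_mult_right, rule integrableI_nonneg)
      have "(\<integral>\<^sup>+x. ennreal (?p x * indicator A x) \<partial>\<Lambda>) = (\<integral>\<^sup>+x. ennreal (?p x) * indicator A x \<partial>\<Lambda>)"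
        by (intro nn_integral_cong) (auto split: split_indicator)
      also have "\<dots> < \<infinity>" using nn[OF A(1)] A(2) by (auto simp: ennreal_mult_less_top intro: le_less_trans)
      finally show "(\<integral>\<^sup>+x. ennreal (?p x * indicator A x) \<partial>\<Lambda>) < \<infinity>" .
    qed (auto simp: p0)
    have int: "integrable \<Lambda> (\<lambda>x. p x *\<^sub>R f x)"
      if [measurable]: "p \<in> borel_measurable borel" and p: "\<And>x. 0 \<le> p x" "\<And>x. p x \<le> ?p x" "\<And>x. x \<notin> {0..<1} \<Longrightarrow> p x = 0" for p
    proof (rule Bochner_Integration.integrable_bound[OF dom])
      have "p x * cmod (f x) \<le> \<bar>C\<bar> * (?p x * indicator A x)" for x
      proof (cases "x \<in> {0..<1}")
        case True
        then have "p x * cmod (f x) \<le> ?p x * (\<bar>C\<bar> * indicator A x)"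
          using fC[OF True] p(1,2)[of x] by (intro mult_mono) (auto split: split_indicator_asm split_indicator)
        then show ?thesis by (simp add: mult_ac)
      qed (use p(3) p0 in auto)
      then show "AE x in \<Lambda>. norm (p x *\<^sub>R f x) \<le> norm (\<bar>C\<bar> * (?p x * indicator A x))"
        using p(1) p0 by (auto intro!: AE_I2 simp: abs_mult)
    qed measurable
    have i: "integrable \<Lambda> (\<lambda>x. p1 x *\<^sub>R f x)" "integrable \<Lambda> (\<lambda>x. p2 x *\<^sub>R f x)"
        "integrable \<Lambda> (\<lambda>x. p3 x *\<^sub>R f x)" "integrable \<Lambda> (\<lambda>x. p4 x *\<^sub>R f x)"
      by (intro int; simp add: p1' p2' p3' p4' add_nonneg_nonneg)+
    have eq: "f x * u x = (p1 x *\<^sub>R f x - p3 x *\<^sub>R f x) + \<i> * (p2 x *\<^sub>R f x - p4 x *\<^sub>R f x)" for x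
      unfolding u_alt by (simp add: scaleR_conv_of_real algebra_simps)
    show ?thesis unfolding eq cintegral_def p1'(4)[OF f] p2'(4)[OF f] p3'(4)[OF f] p4'(4)[OF f]
      using i by simp
  qed
  have 5: "m A = (LINT x|\<Lambda>. indicator A x * u x)" if A: "A \<in> R" "variation m A < \<infinity>" for A
  proof -
    have Ab: "A \<in> borel01" "A \<in> sets borel" "A \<subseteq> {0..<1}" using borel01_ring_sets[OF R A(1)] by (auto simp: borel01_def)
    have "cintegral m (indicator A) = (LINT x|\<Lambda>. indicator A x * u x)"
      using 4[of "indicator A" A 1] Ab A by (auto split: split_indicator)
    \<comment> \<open>On an indicator the four integrals are the four positive parts at A, all
      finite, and the Jordan decomposition reassembles m A.\<close>
    moreover have "cintegral m (indicator A) = m A"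
    proof -
      have *: "(LINT x|upper_variation r. indicator A x) = complex_of_real (enn2real (pos_var r A))" if "signed_on R r" for r
      proof -
        have "(LINT x|upper_variation r. indicator A x :: complex) = of_real (LINT x|upper_variation r. indicator A x)"
          by (subst integral_complex_of_real[symmetric]) (simp add: of_real_indicator)
        also have "(LINT x|upper_variation r. indicator A x) = measure (upper_variation r) A"
          using Ab upper_variation_facts[OF R that] by (simp add: Int_absorb2)
        finally show ?thesis using upper_variation_facts[OF R that] Ab by (simp add: measure_def)
      qed
      have f: "pos_var (\<lambda>A. Re (m A)) A < \<infinity>" "pos_var (\<lambda>A. Im (m A)) A < \<infinity>"
        "pos_var (\<lambda>A. - Re (m A)) A < \<infinity>" "pos_var (\<lambda>A. - Im (m A)) A < \<infinity>"
        using pv[of A] A by (auto intro: le_less_trans)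
      show ?thesis
        unfolding cintegral_def *[OF sg(1)] *[OF sg(2)] *[OF sg(3)] *[OF sg(4)]
        using pos_var_jordan[OF R sg(1) A(1)] pos_var_jordan[OF R sg(2) A(1)] f
        by (simp add: complex_eq_iff)
    qed
    ultimately show ?thesis by simp
  qed
  have "u x = 0" if "x \<notin> {0..<1}" for x using that p1' p2' p3' p4' by (simp add: u_alt)
  then show ?thesis using that[of u] u 3 4 5 by blast
qed

section \<open>A dominating measure, and uniqueness from initial intervals\<close>

lemma cmeasure_signed:
  assumes "cmeasure_on R m"
  shows "signed_on R (\<lambda>A. Re (m A))" "signed_on R (\<lambda>A. Im (m A))"
    "signed_on R (\<lambda>A. - Re (m A))" "signed_on R (\<lambda>A. - Im (m A))"
proof -
  show *: "signed_on R (\<lambda>A. Re (m A))" "signed_on R (\<lambda>A. Im (m A))"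
    using assms unfolding signed_on_def cmeasure_on_def by (auto intro: sums_Re sums_Im)
  show "signed_on R (\<lambda>A. - Re (m A))" "signed_on R (\<lambda>A. - Im (m A))"
    using *[THEN signed_on_uminus] .
qed

text \<open>The sum of the four positive parts takes the place of |m| as a reference measure: where
  it vanishes, Re m, - Re m, Im m and - Im m are all at most 0.\<close>

lemma dominating_measure:
  assumes R: "borel01_ring R" and m: "cmeasure_on R m"
    and fin: "\<And>a. a < 1 \<Longrightarrow> variation m {0..a} < \<infinity>"
  obtains \<Lambda> where "sigma_finite_measure \<Lambda>" "sets \<Lambda> = sets borel"
    "\<And>A. A \<in> R \<Longrightarrow> emeasure \<Lambda> A = 0 \<Longrightarrow> m A = 0"
proof -
  define N where "N r = distr (upper_variation r) borel (\<lambda>x::real. x)" for r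
  have eN: "emeasure (N r) A = pos_var r (A \<inter> {0..<1})" if "signed_on R r" "A \<in> sets borel" for A r
  proof -
    have "(\<lambda>x. x) \<in> measurable (upper_variation r) borel"
      using upper_variation_facts[OF R that(1)] by (auto simp: measurable_def borel01_def)
    then show ?thesis unfolding N_def
      using that upper_variation_facts[OF R that(1)] by (subst emeasure_distr) (auto simp: borel01_def)
  qed
  define r where "r = (\<lambda>i::nat. [\<lambda>A. Re (m A), \<lambda>A. Im (m A), \<lambda>A. - Re (m A), \<lambda>A. - Im (m A)] ! i)"
  have sg: "signed_on R (r i)" if "i < 4" for i
    using that cmeasure_signed[OF m] by (auto simp: r_def less_Suc_eq numeral_eq_Suc)
  have rv: "pos_var (r i) A \<le> variation m A" if "i < 4" for i A
    using that abs_Re_le_cmod abs_Im_le_cmod by (auto simp: r_def less_Suc_eq numeral_eq_Suc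
       intro!: pos_var_le_variation intro: abs_le_D1 abs_le_D2)
  define \<Lambda> where "\<Lambda> = measure_of UNIV (sets borel) (\<lambda>A. \<Sum>i<4. emeasure (N (r i)) A)"
  have sL: "sets \<Lambda> = sets borel" unfolding \<Lambda>_def
    using sets.sets_measure_of_eq[of "borel :: real measure"] by simp
  have eL: "emeasure \<Lambda> A = (\<Sum>i<4. emeasure (N (r i)) A)" if "A \<in> sets borel" for A
  proof (rule emeasure_measure_of[OF \<Lambda>_def])
    show "positive (sets \<Lambda>) (\<lambda>A. \<Sum>i<4. emeasure (N (r i)) A)" by (auto simp: positive_def)
    show "countably_additive (sets \<Lambda>) (\<lambda>A. \<Sum>i<4. emeasure (N (r i)) A)"
      unfolding countably_additive_def
    proof (intro allI impI)
      fix A :: "nat \<Rightarrow> real set" assume "range A \<subseteq> sets \<Lambda>" "disjoint_family A" "\<Union> (range A) \<in> sets \<Lambda>"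
      then show "(\<Sum>j. \<Sum>i<4. emeasure (N (r i)) (A j)) = (\<Sum>i<4. emeasure (N (r i)) (\<Union> (range A)))"
        by (subst suminf_sum) (auto intro!: sum.cong suminf_emeasure simp: sL N_def)
    qed
  qed (use that sL in auto)
  have pv0: "pos_var (r i) {} = 0" if "i < 4" for i unfolding pos_var_def
    by (auto simp: signed_on_empty[OF R sg[OF that]] subset_empty[THEN iffD1] intro!: SUP_eqI)
  have sf: "sigma_finite_measure \<Lambda>"
  proof (rule sigma_finite_borel01[OF sL])
    show "emeasure \<Lambda> (- {0..<1}) = 0" by (subst eL) (auto simp: eN[OF sg] pv0)
    show "emeasure \<Lambda> {0..a} < \<infinity>" if "a < 1" for a
    proof -
      have "pos_var (r i) ({0..a} \<inter> {0..<1}) < \<infinity>" if "i < 4" for i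
        using that \<open>a < 1\<close> by (intro le_less_trans[OF rv le_less_trans[OF variation_mono fin[of a]]]) auto
      then show ?thesis by (subst eL) (auto simp: eN[OF sg])
    qed
  qed
  show ?thesis
  proof (rule that[OF sf sL])
    fix A assume A: "A \<in> R" and 0: "emeasure \<Lambda> A = 0"
    have Ab: "A \<in> sets borel" "A \<inter> {0..<1} = A" using borel01_ring_sets[OF R A] by auto
    have z: "pos_var (r i) A = 0" if "i < 4" for i
      using 0 that Ab by (auto simp: eL eN[OF sg])
    have "ennreal (r i A) \<le> pos_var (r i) A" for i using Ab unfolding pos_var_def by (auto intro!: SUP_upper)
    then have "r i A \<le> 0" if "i < 4" for i using z[OF that] by (metis ennreal_eq_0_iff le_zero_eq)
    from this[of 0] this[of 1] this[of 2] this[of 3] show "m A = 0" by (simp add: r_def complex_eq_iff numeral_eq_Suc)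
  qed
qed

lemma borel01_ring_lc_borel01: "borel01_ring lc_borel01" and borel01_ring_borel01: "borel01_ring borel01"
  by (auto simp: borel01_ring_def)

text \<open>Dynkin's argument on the half-lines \<open>{..<b}\<close>. All sets are cut with one
  interval [0,c), c between a and 1, since complements would otherwise leave the ring; [0,c) itself
  is covered by the hypothesis.\<close>

lemma signed_on_lc_eqI:
  assumes R: "borel01_ring R" and r: "signed_on R r" "signed_on R s"
    and eq: "\<And>b. 0 < b \<Longrightarrow> b < 1 \<Longrightarrow> r {0..<b} = s {0..<b}"
    and A: "A \<in> lc_borel01"
  shows "r A = s A"
proof -
  obtain a where a: "a < 1" "A \<subseteq> {0..a}" "A \<in> sets borel" using A by (auto simp: lc_borel01_def)
  define c where "c = (max a 0 + 1) / 2"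
  have c: "a < c" "0 < c" "c < 1" using a by (auto simp: c_def max_def)
  have cR: "B \<inter> {0..<c} \<in> R" if "B \<in> sets borel" for B
  proof -
    have "B \<inter> {0..<c} \<subseteq> {0..c}" by auto
    then have "B \<inter> {0..<c} \<in> lc_borel01" using that c(3) by (auto simp: lc_borel01_def)
    then show ?thesis using lc_borel01_subset_ring[OF R] by auto
  qed
  have borel: "sets (borel :: real measure) = sigma_sets UNIV (range lessThan)"
    by (subst borel_Iio) (simp add: sets_measure_of_conv)
  have stable: "Int_stable (range (lessThan :: real \<Rightarrow> _))"
  proof (rule Int_stableI_image)
    fix x y :: real
    show "\<exists>z\<in>UNIV. {..<x} \<inter> {..<y} = {..<z}" by (intro bexI[of _ "min x y"]) auto
  qed
  have sub: "range (lessThan :: real \<Rightarrow> _) \<subseteq> Pow UNIV" by auto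
  have "r (B \<inter> {0..<c}) = s (B \<inter> {0..<c})" if "B \<in> sigma_sets UNIV (range lessThan)" for B :: "real set"
    using stable sub that
  proof (induction rule: sigma_sets_induct_disjoint)
    case (basic B)
    then obtain b where b: "B = {..<b}" by auto
    have e: "B \<inter> {0..<c} = {0..<min b c}" using b by auto
    show ?case
    proof (cases "b > 0")
      case True then show ?thesis unfolding e using c by (intro eq) auto
    next
      case False
      then have "{0..<min b c} = {}" by auto
      then show ?thesis unfolding e using signed_on_empty[OF R] r by metis
    qed
  next
    case (compl B)
    then have B: "B \<in> sets borel" by (simp add: borel)
    have d: "t ({0..<c}) = t (B \<inter> {0..<c}) + t ((UNIV - B) \<inter> {0..<c})" if "signed_on R t" for t
    proof -
      have "t ((B \<inter> {0..<c}) \<union> ((UNIV - B) \<inter> {0..<c})) = t (B \<inter> {0..<c}) + t ((UNIV - B) \<inter> {0..<c})"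
        using B by (intro signed_on_Un[OF R that] cR) auto
      moreover have "(B \<inter> {0..<c}) \<union> ((UNIV - B) \<inter> {0..<c}) = {0..<c}" by auto
      ultimately show ?thesis by simp
    qed
    show ?case using d[OF r(1)] d[OF r(2)] compl eq[of c] c by simp
  next
    case (union F)
    have d: "(\<lambda>i. t (F i \<inter> {0..<c})) sums t (\<Union> (range F) \<inter> {0..<c})" if "signed_on R t" for t
    proof -
      have F: "F i \<in> sets borel" for i using union(2) by (auto simp: borel)
      have "range (\<lambda>i. F i \<inter> {0..<c}) \<subseteq> R" using cR F by auto
      moreover have "disjoint_family (\<lambda>i. F i \<inter> {0..<c})" using union(1) unfolding disjoint_family_on_def by blast
      moreover have U: "(\<Union>i. F i \<inter> {0..<c}) = \<Union> (range F) \<inter> {0..<c}" by auto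
      moreover have "\<Union> (range F) \<inter> {0..<c} \<in> R" using F by (intro cR) auto
      ultimately show ?thesis using that unfolding signed_on_def by metis
    qed
    show ?case using d[OF r(1)] d[OF r(2)] union by (simp add: sums_iff)
  qed (use signed_on_empty[OF R r(1)] signed_on_empty[OF R r(2)] in simp)
  from this[of A] have "r (A \<inter> {0..<c}) = s (A \<inter> {0..<c})" using a by (simp add: borel)
  moreover have "A \<inter> {0..<c} = A" using a c by force
  ultimately show ?thesis by simp
qed

text \<open>Countable additivity over the layers [1 - 1/(i+1), 1 - 1/(i+2)), which meet A in sets of
  \<open>lc_borel01\<close>. Hence a finite measure is determined by its locally finite restriction,
  and \<open>lf_of_M\<close> is injective.\<close>

lemma signed_on_eqI:
  assumes r: "signed_on borel01 r" "signed_on borel01 s"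
    and eq: "\<And>A. A \<in> lc_borel01 \<Longrightarrow> r A = s A"
  shows "r A = s A"
proof (cases "A \<in> borel01")
  case True
  define D where "D i = {1 - 1 / real (Suc i) ..< 1 - 1 / real (Suc (Suc i))}" for i
  have Dlc: "A \<inter> D i \<in> lc_borel01" for i
  proof -
    have "A \<inter> D i \<subseteq> {0..1 - 1 / real (Suc (Suc i))}" using True by (auto simp: D_def borel01_def)
    moreover have "A \<inter> D i \<in> sets borel" using True by (auto simp: D_def borel01_def)
    moreover have "1 - 1 / real (Suc (Suc i)) < 1" by simp
    ultimately show ?thesis unfolding lc_borel01_def by blast
  qed
  have mono: "1 - 1 / real (Suc i) \<le> 1 - 1 / real (Suc j)" if "i \<le> j" for i j
    using that by (simp add: field_simps)
  have dis: "disjoint_family (\<lambda>i. A \<inter> D i)"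
    unfolding disjoint_family_on_def
  proof (intro ballI impI)
    fix i j :: nat assume "i \<noteq> j"
    then have "Suc i \<le> j \<or> Suc j \<le> i" by auto
    then show "(A \<inter> D i) \<inter> (A \<inter> D j) = {}"
      using mono[of "Suc i" j] mono[of "Suc j" i] unfolding D_def by force
  qed
  have U: "(\<Union>i. A \<inter> D i) = A"
  proof -
    have "\<exists>i. x \<in> D i" if x: "x \<in> {0..<1}" for x
    proof -
      obtain n where n: "inverse (real (Suc n)) < 1 - x" using reals_Archimedean[of "1 - x"] x by auto
      define k where "k = (LEAST k. x < 1 - 1 / real (Suc k))"
      have k: "x < 1 - 1 / real (Suc k)" unfolding k_def
        by (rule LeastI[of _ n]) (use n in \<open>simp add: field_simps\<close>)
      \<comment> \<open>For k = 0 the bound 1 - 1/1 is 0, and x is not below it.\<close>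
      have "k \<noteq> 0" using k x by (intro notI) auto
      then obtain j where j: "k = Suc j" by (cases k) auto
      have "\<not> x < 1 - 1 / real (Suc j)" using j k_def by (metis lessI not_less_Least)
      then have "x \<in> D j" using k j by (auto simp: D_def)
      then show ?thesis ..
    qed
    then show ?thesis using True by (auto simp: borel01_def)
  qed
  have d: "(\<lambda>i. t (A \<inter> D i)) sums t A" if "signed_on borel01 t" for t
  proof -
    have "range (\<lambda>i. A \<inter> D i) \<subseteq> borel01" using Dlc lc_borel01_subset_ring[OF borel01_ring_borel01] by auto
    then show ?thesis using that dis True U unfolding signed_on_def by metis
  qed
  show ?thesis using d[OF r(1)] d[OF r(2)] eq[OF Dlc] by (simp add: sums_iff)
qed (use r in \<open>auto simp: signed_on_def\<close>)

lemma cmeasure_lc_eqI: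
  assumes R: "borel01_ring R" and "cmeasure_on R m" "cmeasure_on R n"
    and "\<And>b. 0 < b \<Longrightarrow> b < 1 \<Longrightarrow> m {0..<b} = n {0..<b}" "A \<in> lc_borel01"
  shows "m A = n A"
  using signed_on_lc_eqI[OF R cmeasure_signed(1)[OF assms(2)] cmeasure_signed(1)[OF assms(3)] _ assms(5)]
    signed_on_lc_eqI[OF R cmeasure_signed(2)[OF assms(2)] cmeasure_signed(2)[OF assms(3)] _ assms(5)]
    assms(4) by (auto simp: complex_eq_iff)

lemma cmeasure_eqI:
  assumes "cmeasure_on borel01 m" "cmeasure_on borel01 n"
    and "\<And>A. A \<in> lc_borel01 \<Longrightarrow> m A = n A"
  shows "m A = n A"
  using signed_on_eqI[OF cmeasure_signed(1)[OF assms(1)] cmeasure_signed(1)[OF assms(2)]]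
    signed_on_eqI[OF cmeasure_signed(2)[OF assms(1)] cmeasure_signed(2)[OF assms(2)]]
    assms(3) by (auto simp: complex_eq_iff)

lemma cintegral_cong:
  assumes R: "borel01_ring R" and m: "cmeasure_on R m" and fg: "\<And>t. t \<in> {0..<1} \<Longrightarrow> f t = g t"
  shows "cintegral m f = cintegral m g"
  unfolding cintegral_def
  using fg space_upper_variation[OF R] cmeasure_signed[OF m]
  by (intro arg_cong2[where f="(+)"] arg_cong2[where f="(-)"] arg_cong2[where f="(*)"] refl
      Bochner_Integration.integral_cong) auto

section \<open>Test functions\<close>

definition bdd_supp :: "(real \<Rightarrow> complex) \<Rightarrow> real \<Rightarrow> real \<Rightarrow> bool" where
  "bdd_supp h C a \<longleftrightarrow> a < 1 \<and> 0 \<le> C \<and> (\<forall>x. cmod (h x) \<le> C * indicator {0..a} x)"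

text \<open>A class that contains the indicators from \<open>lc_borel01\<close> as well as the
  functions of \<open>Cc01\<close> set to 0 outside [0,1). It mediates between values on sets and
  integrals of continuous functions.\<close>

definition test_fun :: "(real \<Rightarrow> complex) \<Rightarrow> bool" where
  "test_fun h \<longleftrightarrow> h \<in> borel_measurable borel \<and> (\<exists>C a. bdd_supp h C a)"

lemma bdd_supp_mono:
  assumes "bdd_supp h C a" "C \<le> C'" "a \<le> a'" "a' < 1" shows "bdd_supp h C' a'"
  unfolding bdd_supp_def
proof (intro conjI allI)
  fix x
  have "cmod (h x) \<le> C * indicator {0..a} x" using assms by (auto simp: bdd_supp_def)
  also have "\<dots> \<le> C' * indicator {0..a'} x" using assms
    by (intro mult_mono) (auto simp: bdd_supp_def split: split_indicator)
  finally show "cmod (h x) \<le> C' * indicator {0..a'} x" .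
qed (use assms in \<open>auto simp: bdd_supp_def\<close>)

lemma test_fun_indicator:
  assumes "A \<in> lc_borel01" shows "test_fun (\<lambda>x. indicator A x * c)"
proof -
  obtain a where "a < 1" "A \<subseteq> {0..a}" using assms by (auto simp: lc_borel01_def)
  then have "bdd_supp (\<lambda>x. indicator A x * c) (cmod c) a"
    by (auto simp: bdd_supp_def norm_mult indicator_def)
  moreover have [measurable]: "A \<in> sets borel" using assms by (auto simp: lc_borel01_def)
  ultimately show ?thesis unfolding test_fun_def by auto
qed

lemma test_fun_add: assumes "test_fun f" "test_fun g" shows "test_fun (\<lambda>x. f x + g x)"
proof -
  obtain C a D b where "bdd_supp f C a" "bdd_supp g D b" using assms by (auto simp: test_fun_def)
  then have *: "bdd_supp f C (max a b)" "bdd_supp g D (max a b)"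
    using bdd_supp_mono[of f C a C "max a b"] bdd_supp_mono[of g D b D "max a b"] by (auto simp: bdd_supp_def)
  have "bdd_supp (\<lambda>x. f x + g x) (C + D) (max a b)"
    unfolding bdd_supp_def
  proof (intro conjI allI)
    fix x
    have "cmod (f x + g x) \<le> cmod (f x) + cmod (g x)" by (rule norm_triangle_ineq)
    also have "\<dots> \<le> C * indicator {0..max a b} x + D * indicator {0..max a b} x"
      using * by (intro add_mono) (auto simp: bdd_supp_def)
    finally show "cmod (f x + g x) \<le> (C + D) * indicator {0..max a b} x" by (simp add: distrib_right)
  qed (use * in \<open>auto simp: bdd_supp_def\<close>)
  then show ?thesis using assms unfolding test_fun_def by auto
qed

text \<open>Approximation by simple functions. The approximants share one bound and one support, as
  dominated convergence for locally finite measures demands.\<close>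

lemma test_fun_induct [consumes 1, case_names mult add lim]:
  assumes h: "test_fun h"
    and mult: "\<And>A c. A \<in> lc_borel01 \<Longrightarrow> P (\<lambda>x. indicator A x * c)"
    and add: "\<And>f g. test_fun f \<Longrightarrow> test_fun g \<Longrightarrow> P f \<Longrightarrow> P g \<Longrightarrow> P (\<lambda>x. f x + g x)"
    and lim: "\<And>s f C a. (\<And>i. test_fun (s i)) \<Longrightarrow> (\<And>i. P (s i)) \<Longrightarrow> (\<And>i. bdd_supp (s i) C a) \<Longrightarrow>
       test_fun f \<Longrightarrow> bdd_supp f C a \<Longrightarrow> (\<And>x. (\<lambda>i. s i x) \<longlonglongrightarrow> f x) \<Longrightarrow> P f"
  shows "P h"
proof -
  obtain C a where hb: "bdd_supp h C a" and hm: "h \<in> borel_measurable borel" using h by (auto simp: test_fun_def)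
  \<comment> \<open>Base point 0 keeps the approximants within 2 |h|, so that they vanish where h
    does.\<close>
  obtain s where s: "\<And>i. simple_function borel (s i)" "\<And>x. (\<lambda>i. s i x) \<longlonglongrightarrow> h x"
    "\<And>i x. cmod (s i x) \<le> 2 * cmod (h x)"
    using borel_measurable_implies_sequence_metric[OF hm, of 0] by auto
  have sb: "bdd_supp (s i) (2 * C) a" for i
    unfolding bdd_supp_def
  proof (intro conjI allI)
    fix x
    have "cmod (s i x) \<le> 2 * cmod (h x)" by (rule s)
    also have "\<dots> \<le> 2 * (C * indicator {0..a} x)" using hb by (auto simp: bdd_supp_def)
    finally show "cmod (s i x) \<le> 2 * C * indicator {0..a} x" by simp
  qed (use hb in \<open>auto simp: bdd_supp_def\<close>)
  have step: "test_fun t \<and> P t" if t: "simple_function borel t" "bdd_supp t C a" for t C a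
  proof -
    have a: "a < 1" and tb: "\<And>x. cmod (t x) \<le> C * indicator {0..a} x" using t by (auto simp: bdd_supp_def)
    have fin: "finite (range t)" using t(1) by (auto simp: simple_function_def)
    \<comment> \<open>Only a nonzero value has its level set inside [0,a]; the value 0 contributes
      the zero function, which is treated apart.\<close>
    have lc: "t -` {y} \<in> lc_borel01" if "y \<noteq> 0" for y
    proof -
      have "t -` {y} \<subseteq> {0..a}" using tb that by (force split: split_indicator_asm)
      moreover have "t -` {y} \<in> sets borel" using simple_functionD(2)[OF t(1), of "{y}"] by simp
      ultimately show ?thesis using a by (auto simp: lc_borel01_def)
    qed
    have z: "test_fun (\<lambda>x. 0) \<and> P (\<lambda>x. 0)"
      using test_fun_indicator[of "{}" 0] mult[of "{}" 0] borel01_ring_empty[OF borel01_ring_lc_borel01] by simp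
    have sums: "test_fun (\<lambda>x. \<Sum>y\<in>Y. indicator (t -` {y}) x * y) \<and> P (\<lambda>x. \<Sum>y\<in>Y. indicator (t -` {y}) x * y)" if "finite Y" for Y
      using that
    proof (induction Y)
      case (insert y Y)
      have "(\<lambda>x. \<Sum>y\<in>insert y Y. indicator (t -` {y}) x * y) = (\<lambda>x. indicator (t -` {y}) x * y + (\<Sum>y\<in>Y. indicator (t -` {y}) x * y))"
        using insert by (intro ext) (simp add: sum.insert del: sum_indicator_mult sum_indicator_eq_card mult_indicator_subset)
      moreover have "test_fun (\<lambda>x. indicator (t -` {y}) x * y) \<and> P (\<lambda>x. indicator (t -` {y}) x * y)"
      proof (cases "y = 0")
        case False then show ?thesis using test_fun_indicator[OF lc] mult[OF lc] by blast
      qed (use z in simp)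
      ultimately show ?case using insert.IH test_fun_add add by presburger
    qed (use z in simp)
    have "(\<Sum>y\<in>range t. indicator (t -` {y}) x * y) = t x" for x
    proof -
      have "(\<Sum>y\<in>range t. indicator (t -` {y}) x * y) = (\<Sum>y\<in>range t. if y = t x then y else 0)"
        by (intro sum.cong) (auto split: split_indicator)
      then show ?thesis using fin by simp
    qed
    then show ?thesis using sums[OF fin] by simp
  qed
  show ?thesis
  proof (rule lim[OF _ _ sb h _ s(2)])
    show "bdd_supp h (2 * C) a" using hb by (rule bdd_supp_mono) (use hb in \<open>auto simp: bdd_supp_def\<close>)
  qed (use step[OF s(1) sb] in auto)
qed

section \<open>Measures as weighted images\<close>

text \<open>
  \<open>lrep N p w m\<close> says that \<open>m\<close> is the image under \<open>p\<close> of the complex measure \<open>w dN\<close>. A convolution is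
  such an image of a product measure, so identities between convolutions become instances of Fubini's theorem.
  As \<open>p \<ge> 0\<close> where \<open>w \<noteq> 0\<close>, the sum of two values of \<open>p\<close> lies in $[0,a]$ only if both do.
\<close>

definition lweight :: "'a measure \<Rightarrow> ('a \<Rightarrow> real) \<Rightarrow> ('a \<Rightarrow> complex) \<Rightarrow> bool" where
  "lweight N p w \<longleftrightarrow> sigma_finite_measure N \<and> p \<in> borel_measurable N \<and> w \<in> borel_measurable N \<and>
     (\<forall>x\<in>space N. w x \<noteq> 0 \<longrightarrow> 0 \<le> p x) \<and> (\<forall>a<1. integrable N (\<lambda>x. indicator {0..a} (p x) * w x))"

definition lrep :: "'a measure \<Rightarrow> ('a \<Rightarrow> real) \<Rightarrow> ('a \<Rightarrow> complex) \<Rightarrow> lfmeas \<Rightarrow> bool" where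
  "lrep N p w m \<longleftrightarrow> lweight N p w \<and>
     (\<forall>A\<in>lc_borel01. Rep_lfmeas m A = (LINT x|N. indicator A (p x) * w x))"

lemma lrep_lweight: "lrep N p w m \<Longrightarrow> lweight N p w" by (simp add: lrep_def)

lemma bdd_supp_bound:
  assumes "bdd_supp h C a" shows "cmod (h y * z) \<le> C * cmod (indicator {0..a} y * z)"
proof -
  have "cmod (h y) * cmod z \<le> (C * indicator {0..a} y) * cmod z"
    using assms by (intro mult_right_mono) (auto simp: bdd_supp_def)
  then show ?thesis by (cases "y \<in> {0..a}") (auto simp: norm_mult)
qed

lemma lweight_integrable:
  assumes w: "lweight N p w" and h: "test_fun h"
  shows "integrable N (\<lambda>x. h (p x) * w x)"
proof -
  obtain C a where hb: "bdd_supp h C a" and [measurable]: "h \<in> borel_measurable borel" using h by (auto simp: test_fun_def)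
  have [measurable]: "p \<in> borel_measurable N" "w \<in> borel_measurable N" using w by (auto simp: lweight_def)
  have "integrable N (\<lambda>x. indicator {0..a} (p x) * w x)" using w hb by (auto simp: lweight_def bdd_supp_def)
  then have "integrable N (\<lambda>x. C * cmod (indicator {0..a} (p x) * w x))" by simp
  then show ?thesis
  proof (rule Bochner_Integration.integrable_bound)
    show "AE x in N. cmod (h (p x) * w x) \<le> norm (C * cmod (indicator {0..a} (p x) * w x))"
      by (intro AE_I2 order_trans[OF bdd_supp_bound[OF hb]]) simp
  qed measurable
qed

lemma lweight_lim:
  assumes w: "lweight N p w" and s: "\<And>i. test_fun (s i)" "\<And>i. bdd_supp (s i) C a" and f: "test_fun f"
    and lim: "\<And>x. (\<lambda>i. s i x) \<longlonglongrightarrow> f x"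
  shows "(\<lambda>i. LINT x|N. s i (p x) * w x) \<longlonglongrightarrow> (LINT x|N. f (p x) * w x)"
proof (rule integral_dominated_convergence)
  have "integrable N (\<lambda>x. indicator {0..a} (p x) * w x)" using w s(2) by (auto simp: lweight_def bdd_supp_def)
  then show "integrable N (\<lambda>x. C * cmod (indicator {0..a} (p x) * w x))" by simp
  show "AE x in N. cmod (s i (p x) * w x) \<le> C * cmod (indicator {0..a} (p x) * w x)" for i
    by (intro AE_I2 bdd_supp_bound[OF s(2)])
  show "AE x in N. (\<lambda>i. s i (p x) * w x) \<longlonglongrightarrow> f (p x) * w x"
    by (intro AE_I2 tendsto_intros lim)
qed (use lweight_integrable[OF w] s f in \<open>auto dest: borel_measurable_integrable\<close>)

text \<open>The sides agree on indicators by \<open>lrep\<close>, and dominated convergence does the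
  rest. Hence each computation may use whichever representing space is convenient.\<close>

lemma lrep_integral_unique:
  assumes r: "lrep N p w m" "lrep N' p' w' m" and h: "test_fun h"
  shows "(LINT x|N. h (p x) * w x) = (LINT x|N'. h (p' x) * w' x)"
  using h
proof (induction rule: test_fun_induct)
  case (mult A c)
  have "(LINT x|N. indicator A (p x) * c * w x) = c * (LINT x|N. indicator A (p x) * w x)"
    by (simp add: mult_ac flip: integral_mult_right_zero)
  moreover have "(LINT x|N'. indicator A (p' x) * c * w' x) = c * (LINT x|N'. indicator A (p' x) * w' x)"
    by (simp add: mult_ac flip: integral_mult_right_zero)
  ultimately show ?case using r mult by (auto simp: lrep_def)
next
  case (add f g)
  then show ?case
    using lweight_integrable[OF lrep_lweight[OF r(1)]] lweight_integrable[OF lrep_lweight[OF r(2)]]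
    by (simp add: distrib_right)
next
  case (lim s f C a)
  show ?case
    using lweight_lim[OF lrep_lweight[OF r(1)] lim(1) lim(2) lim(3) lim(5)]
      lweight_lim[OF lrep_lweight[OF r(2)] lim(1) lim(2) lim(3) lim(5)] lim(6)
    by (simp add: LIMSEQ_unique)
qed

section \<open>Representations of locally finite measures\<close>

lemma lfmeas_facts:
  "cmeasure_on lc_borel01 (Rep_lfmeas m)" "a < 1 \<Longrightarrow> variation (Rep_lfmeas m) {0..a} < \<infinity>"
  using Rep_lfmeas[of m] by auto

text \<open>Applied with a dominating measure for arbitrary m, and with Lebesgue measure for
  absolutely continuous m.\<close>

lemma lrep_of_density:
  assumes L: "sigma_finite_measure \<Lambda>" "sets \<Lambda> = sets borel"
    and ac: "\<And>A. A \<in> lc_borel01 \<Longrightarrow> emeasure \<Lambda> A = 0 \<Longrightarrow> Rep_lfmeas m A = 0"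
  obtains u where "lrep \<Lambda> (\<lambda>x. x) u m" "u \<in> borel_measurable borel" "\<And>x. x \<notin> {0..<1} \<Longrightarrow> u x = 0"
    "\<And>A. A \<in> borel01 \<Longrightarrow> (\<integral>\<^sup>+x. ennreal (cmod (u x)) * indicator A x \<partial>\<Lambda>) \<le> 4 * variation (Rep_lfmeas m) A"
    "\<And>h. test_fun h \<Longrightarrow> lf_integral m h = (LINT x|\<Lambda>. h x * u x)"
proof -
  obtain u where u: "u \<in> borel_measurable borel" "\<And>x. x \<notin> {0..<1} \<Longrightarrow> u x = 0"
    "\<And>A. A \<in> borel01 \<Longrightarrow> (\<integral>\<^sup>+x. ennreal (cmod (u x)) * indicator A x \<partial>\<Lambda>) \<le> 4 * variation (Rep_lfmeas m) A"
    and int: "\<And>f C A. f \<in> borel_measurable borel \<Longrightarrow> A \<in> borel01 \<Longrightarrow> variation (Rep_lfmeas m) A < \<infinity> \<Longrightarrow>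
       (\<And>x. x \<in> {0..<1} \<Longrightarrow> cmod (f x) \<le> C * indicator A x) \<Longrightarrow>
       integrable \<Lambda> (\<lambda>x. f x * u x) \<and> cintegral (Rep_lfmeas m) f = (LINT x|\<Lambda>. f x * u x)"
    and eq: "\<And>A. A \<in> lc_borel01 \<Longrightarrow> variation (Rep_lfmeas m) A < \<infinity> \<Longrightarrow> Rep_lfmeas m A = (LINT x|\<Lambda>. indicator A x * u x)"
    using cmeasure_density[OF borel01_ring_lc_borel01 lfmeas_facts L ac] by blast
  have fin: "variation (Rep_lfmeas m) A < \<infinity>" if "A \<in> lc_borel01" for A
  proof -
    obtain a where "a < 1" "A \<subseteq> {0..a}" using \<open>A \<in> lc_borel01\<close> by (auto simp: lc_borel01_def)
    then show ?thesis using lfmeas_facts(2)[of a m] variation_mono[of A "{0..a}" "Rep_lfmeas m"] by (auto intro: le_less_trans)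
  qed
  have b: "{0..a} \<in> lc_borel01" "{0..a} \<in> borel01" if "a < 1" for a :: real using that by (auto simp: lc_borel01_def borel01_def)
  have "lweight \<Lambda> (\<lambda>x. x) u"
    unfolding lweight_def
  proof (intro conjI allI impI ballI)
    show "integrable \<Lambda> (\<lambda>x. indicator {0..a} x * u x)" if "a < 1" for a
      using int[of "indicator {0..a}" "{0..a}" 1] b[OF that] fin[OF b(1)[OF that]] by (auto split: split_indicator)
    show "0 \<le> x" if "u x \<noteq> 0" for x using u(2)[of x] that by (cases "x \<in> {0..<1}") auto
  qed (use L u(1) in \<open>auto cong: measurable_cong_sets\<close>)
  then have rep: "lrep \<Lambda> (\<lambda>x. x) u m" using eq fin by (auto simp: lrep_def)
  have "lf_integral m h = (LINT x|\<Lambda>. h x * u x)" if "test_fun h" for h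
  proof -
    obtain C a where "bdd_supp h C a" "h \<in> borel_measurable borel" using \<open>test_fun h\<close> by (auto simp: test_fun_def)
    then show ?thesis unfolding lf_integral.rep_eq using int[of h "{0..a}" C] b[of a] fin[OF b(1)[of a]] by (auto simp: bdd_supp_def)
  qed
  then show ?thesis using that rep u by blast
qed

lemma lrep_canonical:
  obtains \<Lambda> u where "sets \<Lambda> = sets borel" "lrep \<Lambda> (\<lambda>x. x) u m" "u \<in> borel_measurable borel" "\<And>x. x \<notin> {0..<1} \<Longrightarrow> u x = 0"
    "\<And>A. A \<in> borel01 \<Longrightarrow> (\<integral>\<^sup>+x. ennreal (cmod (u x)) * indicator A x \<partial>\<Lambda>) \<le> 4 * variation (Rep_lfmeas m) A"
    "\<And>h. test_fun h \<Longrightarrow> lf_integral m h = (LINT x|\<Lambda>. h x * u x)"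
proof -
  obtain \<Lambda> where L: "sigma_finite_measure \<Lambda>" "sets \<Lambda> = sets borel"
    "\<And>A. A \<in> lc_borel01 \<Longrightarrow> emeasure \<Lambda> A = 0 \<Longrightarrow> Rep_lfmeas m A = 0"
    using dominating_measure[OF borel01_ring_lc_borel01 lfmeas_facts] by blast
  show ?thesis by (rule lrep_of_density[OF L], assumption, assumption, rule that[OF L(2)], assumption+)
qed

text \<open>Frees \<open>lf_integral\<close> from its definition by Jordan parts: the canonical
  density computes it, and every other representation agrees with that one on test
  functions.\<close>

lemma lrep_integral:
  assumes r: "lrep N p w m" and h: "test_fun h"
  shows "lf_integral m h = (LINT x|N. h (p x) * w x)"
proof -
  obtain \<Lambda> :: "real measure" and u where "lrep \<Lambda> (\<lambda>x. x) u m"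
    "\<And>h. test_fun h \<Longrightarrow> lf_integral m h = (LINT x|\<Lambda>. h x * u x)"
    using lrep_canonical by metis
  then show ?thesis using lrep_integral_unique[OF _ r h] h by auto
qed

definition weighted_image :: "real set set \<Rightarrow> 'a measure \<Rightarrow> ('a \<Rightarrow> real) \<Rightarrow> ('a \<Rightarrow> complex) \<Rightarrow> real set \<Rightarrow> complex" where
  "weighted_image R N p w A = (if A \<in> R then LINT x|N. indicator A (p x) * w x else 0)"

lemma cmeasure_weighted_image:
  assumes R: "borel01_ring R" and [measurable]: "p \<in> borel_measurable N" "w \<in> borel_measurable N"
    and int: "\<And>A. A \<in> R \<Longrightarrow> integrable N (\<lambda>x. indicator A (p x) * w x)"
  shows "cmeasure_on R (weighted_image R N p w)"
  unfolding cmeasure_on_def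
proof (intro conjI allI impI)
  fix A :: "nat \<Rightarrow> real set"
  assume A: "range A \<subseteq> R" "disjoint_family A" "(\<Union>i. A i) \<in> R"
  have AR: "A i \<in> R" for i using A by auto
  have [measurable]: "A i \<in> sets borel" for i using borel01_ring_sets[OF R AR] by auto
  have [measurable]: "(\<Union>i. A i) \<in> sets borel" "(\<Union>i<n. A i) \<in> sets borel" for n by auto
  have eq: "(\<Sum>i<n. weighted_image R N p w (A i)) = (LINT x|N. indicator (\<Union>i<n. A i) (p x) * w x)" for n
  proof -
    have "(LINT x|N. indicator (\<Union>i<n. A i) (p x) * w x) = (LINT x|N. (\<Sum>i<n. indicator (A i) (p x) * w x))"
    proof (intro Bochner_Integration.integral_cong refl)
      fix x
      have "indicator (\<Union>i<n. A i) (p x) = (\<Sum>i<n. indicator (A i) (p x) :: complex)"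
        using A(2) by (intro indicator_UN_disjoint) (auto simp: disjoint_family_on_def)
      then show "indicator (\<Union>i<n. A i) (p x) * w x = (\<Sum>i<n. indicator (A i) (p x) * w x)"
        by (simp add: sum_distrib_right)
    qed
    also have "\<dots> = (\<Sum>i<n. LINT x|N. indicator (A i) (p x) * w x)"
      by (intro Bochner_Integration.integral_sum int AR)
    finally show ?thesis using AR by (simp add: weighted_image_def)
  qed
  have "(\<lambda>n. LINT x|N. indicator (\<Union>i<n. A i) (p x) * w x) \<longlonglongrightarrow> (LINT x|N. indicator (\<Union>i. A i) (p x) * w x)"
  proof (rule integral_dominated_convergence)
    show "integrable N (\<lambda>x. cmod (indicator (\<Union>i. A i) (p x) * w x))" using int[OF A(3)] by simp
    show "AE x in N. cmod (indicator (\<Union>i<n. A i) (p x) * w x) \<le> cmod (indicator (\<Union>i. A i) (p x) * w x)" for n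
      by (intro AE_I2) (auto simp: norm_mult split: split_indicator)
    show "AE x in N. (\<lambda>n. indicator (\<Union>i<n. A i) (p x) * w x) \<longlonglongrightarrow> indicator (\<Union>i. A i) (p x) * w x"
      by (intro AE_I2 tendsto_intros LIMSEQ_indicator_UN)
  qed measurable
  then show "(\<lambda>i. weighted_image R N p w (A i)) sums weighted_image R N p w (\<Union>i. A i)"
    using A(3) by (simp add: sums_def eq) (simp add: weighted_image_def)
qed (simp add: weighted_image_def)

lemma variation_weighted_image:
  assumes R: "borel01_ring R" and [measurable]: "p \<in> borel_measurable N" "w \<in> borel_measurable N"
    and int: "\<And>A. A \<in> R \<Longrightarrow> integrable N (\<lambda>x. indicator A (p x) * w x)"
    and [measurable]: "S \<in> sets borel"
  shows "variation (weighted_image R N p w) S \<le> (\<integral>\<^sup>+x. indicator S (p x) * ennreal (cmod (w x)) \<partial>N)"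
  unfolding variation_def
proof (rule SUP_least)
  fix P assume P: "P \<in> {P. finite P \<and> disjoint P \<and> P \<subseteq> sets borel \<and> \<Union> P \<subseteq> S}"
  have [measurable]: "B \<in> P \<Longrightarrow> B \<in> sets borel" for B using P by auto
  have le: "ennreal (cmod (weighted_image R N p w B)) \<le> (\<integral>\<^sup>+x. indicator B (p x) * ennreal (cmod (w x)) \<partial>N)" for B
  proof (cases "B \<in> R")
    case True
    have "ennreal (cmod (weighted_image R N p w B)) \<le> (\<integral>\<^sup>+x. ennreal (cmod (indicator B (p x) * w x)) \<partial>N)"
      using True by (simp add: weighted_image_def) (intro integral_norm_bound_ennreal int)
    also have "\<dots> = (\<integral>\<^sup>+x. indicator B (p x) * ennreal (cmod (w x)) \<partial>N)"
      by (intro nn_integral_cong) (auto simp: norm_mult split: split_indicator)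
    finally show ?thesis .
  qed (simp add: weighted_image_def)
  have "(\<Sum>B\<in>P. ennreal (cmod (weighted_image R N p w B))) \<le> (\<Sum>B\<in>P. \<integral>\<^sup>+x. indicator B (p x) * ennreal (cmod (w x)) \<partial>N)"
    by (intro sum_mono le)
  also have "\<dots> = (\<integral>\<^sup>+x. (\<Sum>B\<in>P. indicator B (p x) * ennreal (cmod (w x))) \<partial>N)"
    by (subst nn_integral_sum) auto
  also have "\<dots> \<le> (\<integral>\<^sup>+x. indicator S (p x) * ennreal (cmod (w x)) \<partial>N)"
  proof (intro nn_integral_mono)
    fix x
    have "(\<Sum>B\<in>P. indicator B (p x)) = (indicator (\<Union>B\<in>P. B) (p x) :: ennreal)"
      using P by (intro indicator_UN_disjoint[symmetric]) (auto simp: disjoint_family_on_def disjoint_def)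
    also have "\<dots> \<le> indicator S (p x)" using P by (auto split: split_indicator)
    finally show "(\<Sum>B\<in>P. indicator B (p x) * ennreal (cmod (w x))) \<le> indicator S (p x) * ennreal (cmod (w x))"
      by (simp add: mult_right_mono flip: sum_distrib_right)
  qed
  finally show "(\<Sum>B\<in>P. ennreal (cmod (weighted_image R N p w B))) \<le> (\<integral>\<^sup>+x. indicator S (p x) * ennreal (cmod (w x)) \<partial>N)" .
qed

lemma lrep_exists:
  assumes w: "lweight N p w" shows "\<exists>m. lrep N p w m"
proof -
  have m[measurable]: "p \<in> borel_measurable N" "w \<in> borel_measurable N" using w by (auto simp: lweight_def)
  have int: "integrable N (\<lambda>x. indicator A (p x) * w x)" if "A \<in> lc_borel01" for A
    using lweight_integrable[OF w test_fun_indicator[OF that, of 1]] by simp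
  note c = cmeasure_weighted_image[OF borel01_ring_lc_borel01 m int]
  have "variation (weighted_image lc_borel01 N p w) {0..a} < \<infinity>" if "a < 1" for a
  proof -
    have "variation (weighted_image lc_borel01 N p w) {0..a} \<le> (\<integral>\<^sup>+x. indicator {0..a} (p x) * ennreal (cmod (w x)) \<partial>N)"
      by (rule variation_weighted_image[OF borel01_ring_lc_borel01 m int]) auto
    also have "\<dots> = (\<integral>\<^sup>+x. ennreal (cmod (indicator {0..a} (p x) * w x)) \<partial>N)"
      by (intro nn_integral_cong) (auto simp: norm_mult split: split_indicator)
    also have "\<dots> < \<infinity>" using w that by (auto simp: lweight_def integrable_iff_bounded)
    finally show ?thesis .
  qed
  then have "lrep N p w (Abs_lfmeas (weighted_image lc_borel01 N p w))"
    using c w by (auto simp: lrep_def Abs_lfmeas_inverse weighted_image_def)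
  then show ?thesis ..
qed

lemma lfmeas_eqI:
  assumes "\<And>b. 0 < b \<Longrightarrow> b < 1 \<Longrightarrow> Rep_lfmeas m {0..<b} = Rep_lfmeas n {0..<b}"
  shows "m = n"
proof -
  have "Rep_lfmeas m A = Rep_lfmeas n A" for A
    using cmeasure_lc_eqI[OF borel01_ring_lc_borel01 lfmeas_facts(1) lfmeas_facts(1) assms] lfmeas_facts(1)[of m] lfmeas_facts(1)[of n]
    by (cases "A \<in> lc_borel01") (auto simp: cmeasure_on_def)
  then show ?thesis by (simp add: Rep_lfmeas_inject[symmetric] ext)
qed

lemma lc_borel01_Ico: "b < 1 \<Longrightarrow> {0..<b} \<in> lc_borel01"
  unfolding lc_borel01_def by (auto intro!: exI[of _ b])

lemma lrep_unique: "lrep N p w m \<Longrightarrow> lrep N p w n \<Longrightarrow> m = n"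
  by (rule lfmeas_eqI) (simp add: lrep_def lc_borel01_Ico)

text \<open>Makes the definite description in \<open>lf_conv_def\<close> unambiguous. Indicators of
  [0,b) are bounded limits of functions in \<open>Cc01\<close>, and these intervals determine the
  measure.\<close>

lemma lfmeas_Cc01_eqI:
  assumes eq: "\<And>h. h \<in> Cc01 \<Longrightarrow> lf_integral m h = lf_integral n h"
  shows "m = n"
proof (rule lfmeas_eqI)
  fix b :: real assume b: "0 < b" "b < 1"
  \<comment> \<open>A ramp, for i > 0 equal to 1 up to b - 1/i and then linear down to 0 at b. The
    cut at 0 gives it bounded support and leaves it continuous on [0,1).\<close>
  define h where "h i x = complex_of_real (max 0 (min 1 (real i * (b - x))) * indicator {0..} x)" for i :: nat and x
  have hm[measurable]: "h i \<in> borel_measurable borel" for i unfolding h_def by measurable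
  have hb: "bdd_supp (h i) 1 b" for i
    unfolding bdd_supp_def
  proof (intro conjI allI)
    fix x
    consider "x < 0" | "x \<in> {0..b}" | "b < x" by fastforce
    then show "cmod (h i x) \<le> 1 * indicator {0..b} x"
    proof cases
      case 3
      then have "real i * (b - x) \<le> 0" by (simp add: mult_nonneg_nonpos)
      then show ?thesis by (simp add: h_def)
    qed (auto simp: h_def)
  qed (use b in auto)
  then have ht: "test_fun (h i)" for i using hm by (auto simp: test_fun_def)
  have it: "test_fun (indicator {0..<b})"
    using test_fun_indicator[OF lc_borel01_Ico, of b 1] b by simp
  have lim: "(\<lambda>i. h i x) \<longlonglongrightarrow> indicator {0..<b} x" for x
  proof (cases "x \<in> {0..<b}")
    case True
    then have "eventually (\<lambda>i. 1 \<le> real i * (b - x)) sequentially"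
      by (intro eventually_sequentiallyI[of "nat \<lceil>1 / (b - x)\<rceil>"]) (simp add: nat_ceiling_le_eq divide_le_eq)
    then have "eventually (\<lambda>i. h i x = 1) sequentially"
      by (rule eventually_mono) (use True in \<open>auto simp: h_def\<close>)
    then show ?thesis using True by (simp add: tendsto_eventually)
  next
    case False
    have "h i x = 0" for i
    proof (cases "x < 0")
      case False
      then have "real i * (b - x) \<le> 0" using \<open>x \<notin> {0..<b}\<close> by (simp add: mult_nonneg_nonpos)
      then show ?thesis by (simp add: h_def)
    qed (simp add: h_def)
    then show ?thesis using False by simp
  qed
  have "h i \<in> Cc01" for i
  proof -
    have "continuous_on {0..<1} (h i) = continuous_on {0..<1} (\<lambda>x. complex_of_real (max 0 (min 1 (real i * (b - x)))))"
      by (intro continuous_on_cong) (auto simp: h_def)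
    moreover have "continuous_on {0..<1} (\<lambda>x. complex_of_real (max 0 (min 1 (real i * (b - x)))))"
      by (intro continuous_intros)
    ultimately have "continuous_on {0..<1} (h i)" by blast
    moreover have "h i t = 0" if "b < t" for t using hb[of i] that by (auto simp: bdd_supp_def dest!: spec[of _ t])
    ultimately show ?thesis using b by (auto simp: Cc01_def)
  qed
  note hC = eq[OF this]
  have l: "(\<lambda>i. lf_integral k (h i)) \<longlonglongrightarrow> Rep_lfmeas k {0..<b}" for k
  proof -
    obtain \<Lambda> :: "real measure" and u where r: "lrep \<Lambda> (\<lambda>x. x) u k" using lrep_canonical by metis
    have "Rep_lfmeas k {0..<b} = (LINT x|\<Lambda>. indicator {0..<b} x * u x)" using r b by (simp add: lrep_def lc_borel01_Ico)
    then show ?thesis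
      using lweight_lim[OF lrep_lweight[OF r] ht hb it lim] by (simp add: lrep_integral[OF r ht])
  qed
  show "Rep_lfmeas m {0..<b} = Rep_lfmeas n {0..<b}" using l[of m] l[of n] hC by (simp add: LIMSEQ_unique)
qed

section \<open>Convolution\<close>

lemma (in pair_sigma_finite) integrable_times:
  fixes f g :: "_ \<Rightarrow> complex"
  assumes f: "integrable M1 f" and g: "integrable M2 g"
  shows "integrable (M1 \<Otimes>\<^sub>M M2) (\<lambda>(x, y). f x * g y)"
proof (rule Fubini_integrable)
  have [measurable]: "f \<in> borel_measurable M1" "g \<in> borel_measurable M2" using f g by auto
  show "(\<lambda>(x, y). f x * g y) \<in> borel_measurable (M1 \<Otimes>\<^sub>M M2)" by measurable
  show "integrable M1 (\<lambda>x. LINT y|M2. norm (case (x, y) of (x, y) \<Rightarrow> f x * g y))"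
    using f by (simp add: norm_mult)
  show "AE x in M1. integrable M2 (\<lambda>y. case (x, y) of (x, y) \<Rightarrow> f x * g y)" using g by simp
qed

lemma lweight_pair:
  assumes w: "lweight N p w" "lweight N' p' w'"
  shows "lweight (N \<Otimes>\<^sub>M N') (\<lambda>(x, y). p x + p' y) (\<lambda>(x, y). w x * w' y)"
proof -
  have [measurable]: "p \<in> borel_measurable N" "w \<in> borel_measurable N" "p' \<in> borel_measurable N'" "w' \<in> borel_measurable N'"
    and sf: "sigma_finite_measure N" "sigma_finite_measure N'" using w by (auto simp: lweight_def)
  interpret N: sigma_finite_measure N by fact
  interpret N': sigma_finite_measure N' by fact
  interpret NN: pair_sigma_finite N N' ..
  show ?thesis
    unfolding lweight_def
  proof (intro conjI allI impI ballI)
    show "sigma_finite_measure (N \<Otimes>\<^sub>M N')" by (rule sigma_finite_pair_measure[OF sf])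
    show "(\<lambda>(x, y). p x + p' y) \<in> borel_measurable (N \<Otimes>\<^sub>M N')" by measurable
    show "(\<lambda>(x, y). w x * w' y) \<in> borel_measurable (N \<Otimes>\<^sub>M N')" by measurable
    show "0 \<le> (case x of (x, y) \<Rightarrow> p x + p' y)"
      if "x \<in> space (N \<Otimes>\<^sub>M N')" "(case x of (x, y) \<Rightarrow> w x * w' y) \<noteq> 0" for x
      using that w by (auto simp: lweight_def space_pair_measure)
    fix a :: real assume a: "a < 1"
    have "integrable (N \<Otimes>\<^sub>M N') (\<lambda>(x, y). (indicator {0..a} (p x) * w x) * (indicator {0..a} (p' y) * w' y))"
      using w a by (intro NN.integrable_times) (auto simp: lweight_def)
    then show "integrable (N \<Otimes>\<^sub>M N') (\<lambda>x. indicator {0..a} (case x of (x, y) \<Rightarrow> p x + p' y) * (case x of (x, y) \<Rightarrow> w x * w' y))"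
    proof (rule Bochner_Integration.integrable_bound)
      show "AE x in N \<Otimes>\<^sub>M N'. norm (indicator {0..a} (case x of (x, y) \<Rightarrow> p x + p' y) * (case x of (x, y) \<Rightarrow> w x * w' y))
         \<le> norm (case x of (x, y) \<Rightarrow> (indicator {0..a} (p x) * w x) * (indicator {0..a} (p' y) * w' y))"
      proof (rule AE_I2, clarify)
        fix x y assume "(x, y) \<in> space (N \<Otimes>\<^sub>M N')"
        then have "w x \<noteq> 0 \<longrightarrow> 0 \<le> p x" "w' y \<noteq> 0 \<longrightarrow> 0 \<le> p' y" using w by (auto simp: lweight_def space_pair_measure)
        then show "norm (indicator {0..a} (p x + p' y) * (w x * w' y))
         \<le> norm ((indicator {0..a} (p x) * w x) * (indicator {0..a} (p' y) * w' y))"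
          by (cases "w x = 0"; cases "w' y = 0") (auto simp: norm_mult split: split_indicator)
      qed
    qed measurable
  qed
qed

lemma lf_integral_cong: "(\<And>t. t \<in> {0..<1} \<Longrightarrow> f t = g t) \<Longrightarrow> lf_integral m f = lf_integral m g"
  unfolding lf_integral.rep_eq by (intro cintegral_cong[OF borel01_ring_lc_borel01 lfmeas_facts(1)])

lemma test_fun_Cc01:
  assumes "h \<in> Cc01"
  shows "test_fun (\<lambda>x. indicator {0..<1} x * h x)"
proof -
  obtain a where c: "continuous_on {0..<1} h" and a: "a < 1" "\<And>t. t \<in> {0..<1} \<Longrightarrow> a < t \<Longrightarrow> h t = 0"
    using assms by (auto simp: Cc01_def)
  have "compact (h ` {0..a})"
    using a by (intro compact_continuous_image continuous_on_subset[OF c]) auto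
  then have "bounded (h ` {0..a})" by (rule compact_imp_bounded)
  then obtain C where C: "\<And>t. t \<in> {0..a} \<Longrightarrow> cmod (h t) \<le> C" unfolding bounded_iff by blast
  have "bdd_supp (\<lambda>x. indicator {0..<1} x * h x) (max C 0) a"
    unfolding bdd_supp_def
  proof (intro conjI allI)
    fix x
    show "cmod (indicator {0..<1} x * h x) \<le> max C 0 * indicator {0..a} x"
      using a(2)[of x] C[of x] a(1) by (cases "x \<in> {0..<1}"; cases "x \<le> a") auto
  qed (use a in auto)
  moreover have "(\<lambda>x. indicator {0..<1} x *\<^sub>R h x) \<in> borel_measurable borel"
    by (rule borel_measurable_continuous_on_indicator[OF _ c]) simp
  then have "(\<lambda>x. indicator {0..<1} x * h x) \<in> borel_measurable borel"
    by (simp add: scaleR_conv_of_real of_real_indicator)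
  ultimately show ?thesis by (auto simp: test_fun_def)
qed

text \<open>The inner integral is itself a test function of t, so both integrals can be computed in
  the given representations. Fubini's theorem merges them, and \<open>lfmeas_Cc01_eqI\<close>
  identifies the image of the product with \<open>lf_conv\<close>.\<close>

lemma lf_conv_lrep:
  assumes r: "lrep N p w \<nu>" "lrep N' p' w' \<mu>"
  shows "lrep (N \<Otimes>\<^sub>M N') (\<lambda>(x, y). p x + p' y) (\<lambda>(x, y). w x * w' y) (lf_conv \<nu> \<mu>)"
proof -
  note w = r[THEN lrep_lweight]
  have [measurable]: "p \<in> borel_measurable N" "w \<in> borel_measurable N" "p' \<in> borel_measurable N'" "w' \<in> borel_measurable N'"
    and sf: "sigma_finite_measure N" "sigma_finite_measure N'" using w by (auto simp: lweight_def)
  interpret N: sigma_finite_measure N by fact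
  interpret N': sigma_finite_measure N' by fact
  interpret NN: pair_sigma_finite N N' ..
  note wp = lweight_pair[OF w]
  obtain \<kappa> where \<kappa>: "lrep (N \<Otimes>\<^sub>M N') (\<lambda>(x, y). p x + p' y) (\<lambda>(x, y). w x * w' y) \<kappa>" using lrep_exists[OF wp] by auto
  have eq: "lf_integral \<kappa> h = lf_integral \<nu> (\<lambda>t. lf_integral \<mu> (\<lambda>s. indicator {0..<1 - t} s * h (t + s)))"
    if h: "h \<in> Cc01" for h
  proof -
    define h' where "h' x = indicator {0..<1} x * h x" for x
    have th': "test_fun h'" unfolding h'_def by (rule test_fun_Cc01[OF h])
    then obtain C a where [measurable]: "h' \<in> borel_measurable borel" and hb: "bdd_supp h' C a" by (auto simp: test_fun_def)
    \<comment> \<open>For negative t the shift could reach values of \<open>p' y\<close> near or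
      beyond 1, where the mass need not be finite. The cut is harmless, since \<open>p x\<close> is
      nonnegative wherever \<open>w x\<close> is nonzero.\<close>
    define G where "G t = indicator {0..} t * (LINT y|N'. h' (t + p' y) * w' y)" for t
    have "lf_integral \<mu> (\<lambda>s. indicator {0..<1 - t} s * h (t + s)) = G t" if t: "t \<in> {0..<1}" for t
    proof -
      \<comment> \<open>\<open>lf_integral\<close> sees only [0,1). The factor
        \<open>indicator {0..} s\<close> keeps the integrand supported in [0,a]: for s < 0 the point
        t + s can still lie there.\<close>
      have "lf_integral \<mu> (\<lambda>s. indicator {0..<1 - t} s * h (t + s)) = lf_integral \<mu> (\<lambda>s. indicator {0..} s * h' (t + s))"
        using t by (intro lf_integral_cong) (auto simp: h'_def split: split_indicator)
      also have "\<dots> = (LINT y|N'. indicator {0..} (p' y) * h' (t + p' y) * w' y)"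
      proof (rule lrep_integral[OF r(2)])
        have "bdd_supp (\<lambda>s. indicator {0..} s * h' (t + s)) C a"
          unfolding bdd_supp_def
        proof (intro conjI allI)
          fix s show "cmod (indicator {0..} s * h' (t + s)) \<le> C * indicator {0..a} s"
          proof -
            have "cmod (h' (t + s)) \<le> C * indicator {0..a} (t + s)" "0 \<le> C" using hb by (auto simp: bdd_supp_def)
            then show ?thesis using t by (auto split: split_indicator split_indicator_asm)
          qed
        qed (use hb in \<open>auto simp: bdd_supp_def\<close>)
        then show "test_fun (\<lambda>s. indicator {0..} s * h' (t + s))" unfolding test_fun_def by auto
      qed
      also have "\<dots> = (LINT y|N'. h' (t + p' y) * w' y)"
        using w(2) by (intro Bochner_Integration.integral_cong) (auto simp: lweight_def split: split_indicator)
      finally show ?thesis using t by (simp add: G_def)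
    qed
    then have "lf_integral \<nu> (\<lambda>t. lf_integral \<mu> (\<lambda>s. indicator {0..<1 - t} s * h (t + s))) = lf_integral \<nu> G"
      by (rule lf_integral_cong)
    also have "\<dots> = (LINT x|N. G (p x) * w x)"
    proof (rule lrep_integral[OF r(1)])
      have [measurable]: "G \<in> borel_measurable borel" unfolding G_def by measurable
      have int: "integrable N' (\<lambda>y. C * cmod (indicator {0..a} (p' y) * w' y))"
        using w(2) hb by (auto simp: lweight_def bdd_supp_def)
      have z: "G t = 0" if "t \<notin> {0..a}" for t
      proof (cases "t < 0")
        case False
        then have "h' (t + p' y) * w' y = 0" if "y \<in> space N'" for y
          using hb w(2) \<open>t \<notin> _\<close> that unfolding bdd_supp_def lweight_def by (cases "w' y = 0") (auto dest!: spec[of _ "t + p' y"])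
        then have "(LINT y|N'. h' (t + p' y) * w' y) = (LINT y|N'. 0)" by (intro Bochner_Integration.integral_cong) auto
        then show ?thesis by (simp add: G_def)
      qed (simp add: G_def)
      have "cmod (G t) \<le> (LINT y|N'. C * cmod (indicator {0..a} (p' y) * w' y))" if "t \<in> {0..a}" for t
      proof -
        have "cmod (G t) \<le> (LINT y|N'. cmod (h' (t + p' y) * w' y))" using that by (simp add: G_def)
        also have "\<dots> \<le> (LINT y|N'. C * cmod (indicator {0..a} (p' y) * w' y))"
        proof (rule integral_mono')
          fix y assume y: "y \<in> space N'"
          show "cmod (h' (t + p' y) * w' y) \<le> C * cmod (indicator {0..a} (p' y) * w' y)"
          proof (cases "w' y = 0")
            case False
            then have "0 \<le> p' y" using w(2) y by (auto simp: lweight_def)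
            then have "C * cmod (indicator {0..a} (t + p' y) * w' y) \<le> C * cmod (indicator {0..a} (p' y) * w' y)"
              using that hb by (intro mult_left_mono) (auto simp: bdd_supp_def norm_mult split: split_indicator)
            then show ?thesis using bdd_supp_bound[OF hb, of "t + p' y" "w' y"] by linarith
          qed (use hb in \<open>auto simp: bdd_supp_def\<close>)
        qed (use int hb in \<open>auto simp: bdd_supp_def\<close>)
        finally show ?thesis .
      qed
      then have "bdd_supp G (LINT y|N'. C * cmod (indicator {0..a} (p' y) * w' y)) a"
        unfolding bdd_supp_def using z hb by (auto simp: bdd_supp_def split: split_indicator intro!: integral_nonneg_AE)
      then show "test_fun G" by (auto simp: test_fun_def)
    qed
    also have "\<dots> = (LINT x|N. LINT y|N'. h' (p x + p' y) * (w x * w' y))"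
    proof (intro Bochner_Integration.integral_cong refl)
      fix x assume "x \<in> space N"
      then have "G (p x) * w x = (LINT y|N'. h' (p x + p' y) * w' y) * w x"
        using w(1) by (auto simp: G_def lweight_def split: split_indicator)
      also have "\<dots> = (LINT y|N'. h' (p x + p' y) * (w x * w' y))"
        by (simp add: mult_ac flip: integral_mult_left_zero)
      finally show "G (p x) * w x = (LINT y|N'. h' (p x + p' y) * (w x * w' y))" .
    qed
    also have "\<dots> = (LINT z|(N \<Otimes>\<^sub>M N'). h' (case z of (x, y) \<Rightarrow> p x + p' y) * (case z of (x, y) \<Rightarrow> w x * w' y))"
      using NN.integral_fst'[OF lweight_integrable[OF wp th']] by simp
    also have "\<dots> = lf_integral \<kappa> h'" by (rule lrep_integral[OF \<kappa> th', symmetric])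
    also have "\<dots> = lf_integral \<kappa> h" by (rule lf_integral_cong) (simp add: h'_def)
    finally show ?thesis ..
  qed
  have "lf_conv \<nu> \<mu> = \<kappa>"
    unfolding lf_conv_def
  proof (rule the_equality)
    fix \<kappa>' assume "\<forall>h\<in>Cc01. lf_integral \<kappa>' h = lf_integral \<nu> (\<lambda>t. lf_integral \<mu> (\<lambda>s. indicator {0..<1 - t} s * h (t + s)))"
    then show "\<kappa>' = \<kappa>" by (intro lfmeas_Cc01_eqI) (simp add: eq)
  qed (use eq in auto)
  then show ?thesis using \<kappa> by simp
qed

section \<open>The measure algebra\<close>

lemma M01_facts: "cmeasure_on borel01 (Rep_M01 m)" "variation (Rep_M01 m) {0..<1} < \<infinity>"
  using Rep_M01[of m] by auto

lemma variation_M01_finite: "A \<in> borel01 \<Longrightarrow> variation (Rep_M01 m) A < \<infinity>"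
  using M01_facts(2)[of m] variation_mono[of A "{0..<1}" "Rep_M01 m"] by (auto simp: borel01_def intro: le_less_trans)

lemma M01_eqI_lc: assumes "\<And>A. A \<in> lc_borel01 \<Longrightarrow> Rep_M01 m A = Rep_M01 n A" shows "m = n"
  using cmeasure_eqI[OF M01_facts(1) M01_facts(1) assms] by (simp add: Rep_M01_inject[symmetric] ext)

lemma M01_eqI: assumes "\<And>b. 0 < b \<Longrightarrow> b < 1 \<Longrightarrow> Rep_M01 m {0..<b} = Rep_M01 n {0..<b}" shows "m = n"
  using cmeasure_lc_eqI[OF borel01_ring_borel01 M01_facts(1) M01_facts(1) assms] by (intro M01_eqI_lc)

lemma Rep_lf_of_M: "Rep_lfmeas (lf_of_M m) A = (if A \<in> lc_borel01 then Rep_M01 m A else 0)"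
  by (simp add: lf_of_M.rep_eq)

lemma lf_of_M_inj: "lf_of_M m = lf_of_M n \<Longrightarrow> m = n"
  by (rule M01_eqI_lc) (metis Rep_lf_of_M)

lemma lc_borel01_subset: "A \<in> lc_borel01 \<Longrightarrow> A \<in> borel01" by (force simp: lc_borel01_def borel01_def)

text \<open>Values \<open>p x\<close> at or beyond 1 belong to no set of \<open>borel01\<close>, so
  their mass is dropped: this is the truncation of the convolution to [0,1). The integrability
  condition makes the image finite.\<close>

definition mrep :: "'a measure \<Rightarrow> ('a \<Rightarrow> real) \<Rightarrow> ('a \<Rightarrow> complex) \<Rightarrow> M01 \<Rightarrow> bool" where
  "mrep N p w m \<longleftrightarrow> lweight N p w \<and> integrable N (\<lambda>x. indicator {0..<1} (p x) * w x) \<and>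
     (\<forall>A\<in>borel01. Rep_M01 m A = (LINT x|N. indicator A (p x) * w x))"

lemma mrepD:
  assumes "mrep N p w m"
  shows "lweight N p w" "integrable N (\<lambda>x. indicator {0..<1} (p x) * w x)"
    "A \<in> borel01 \<Longrightarrow> Rep_M01 m A = (LINT x|N. indicator A (p x) * w x)"
    "sigma_finite_measure N" "p \<in> borel_measurable N" "w \<in> borel_measurable N"
    "x \<in> space N \<Longrightarrow> w x \<noteq> 0 \<Longrightarrow> 0 \<le> p x"
  using assms by (auto simp: mrep_def lweight_def)

lemma integrable_borel01:
  assumes w: "lweight N p w" and i: "integrable N (\<lambda>x. indicator {0..<1} (p x) * w x)" and A: "A \<in> borel01"
  shows "integrable N (\<lambda>x. indicator A (p x) * w x)"
proof (rule Bochner_Integration.integrable_bound[OF i])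
  have [measurable]: "A \<in> sets borel" "p \<in> borel_measurable N" "w \<in> borel_measurable N" using w A by (auto simp: lweight_def borel01_def)
  show "(\<lambda>x. indicator A (p x) * w x) \<in> borel_measurable N" by measurable
  show "AE x in N. norm (indicator A (p x) * w x) \<le> norm (indicator {0..<1} (p x) * w x)"
    using A by (intro AE_I2) (auto simp: borel01_def norm_mult split: split_indicator)
qed

lemma mrep_exists:
  assumes w: "lweight N p w" and i: "integrable N (\<lambda>x. indicator {0..<1} (p x) * w x)"
  shows "\<exists>m. mrep N p w m"
proof -
  have m[measurable]: "p \<in> borel_measurable N" "w \<in> borel_measurable N" using w by (auto simp: lweight_def)
  note int = integrable_borel01[OF w i]
  note c = cmeasure_weighted_image[OF borel01_ring_borel01 m int]
  have "variation (weighted_image borel01 N p w) {0..<1} \<le> (\<integral>\<^sup>+x. indicator {0..<1} (p x) * ennreal (cmod (w x)) \<partial>N)"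
    by (rule variation_weighted_image[OF borel01_ring_borel01 m int]) auto
  also have "\<dots> = (\<integral>\<^sup>+x. ennreal (cmod (indicator {0..<1} (p x) * w x)) \<partial>N)"
    by (intro nn_integral_cong) (auto simp: norm_mult split: split_indicator)
  also have "\<dots> < \<infinity>" using i by (auto simp: integrable_iff_bounded)
  finally have "mrep N p w (Abs_M01 (weighted_image borel01 N p w))"
    using c w i by (auto simp: mrep_def Abs_M01_inverse weighted_image_def)
  then show ?thesis ..
qed

lemma mrep_lrep: "mrep N p w m \<Longrightarrow> lrep N p w (lf_of_M m)"
  by (auto simp: mrep_def lrep_def Rep_lf_of_M lc_borel01_subset)

text \<open>The finite image built from the same data has the same locally finite restriction as m,
  so it is m by injectivity of \<open>lf_of_M\<close>.\<close>

lemma lrep_mrep: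
  assumes r: "lrep N p w (lf_of_M m)" and i: "integrable N (\<lambda>x. indicator {0..<1} (p x) * w x)"
  shows "mrep N p w m"
proof -
  obtain n where n: "mrep N p w n" using mrep_exists[OF lrep_lweight[OF r] i] by auto
  then have "lf_of_M m = lf_of_M n" using lrep_unique[OF r mrep_lrep[OF n]] by simp
  then show ?thesis using n lf_of_M_inj by auto
qed

lemma mrep_unique: "mrep N p w m \<Longrightarrow> mrep N p w n \<Longrightarrow> m = n"
  using lrep_unique[OF mrep_lrep mrep_lrep] lf_of_M_inj by blast

lemma norm_mrep:
  assumes r: "mrep N p w m"
  shows "ennreal (norm m) \<le> (\<integral>\<^sup>+x. indicator {0..<1} (p x) * ennreal (cmod (w x)) \<partial>N)"
proof -
  note m = mrepD(5,6)[OF r]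
  note int = integrable_borel01[OF mrepD(1,2)[OF r]]
  have "variation (Rep_M01 m) {0..<1} \<le> variation (weighted_image borel01 N p w) {0..<1}"
    using M01_facts(1)[of m] mrepD(3)[OF r] by (intro variation_cong_le) (auto simp: weighted_image_def cmeasure_on_def)
  also have "\<dots> \<le> (\<integral>\<^sup>+x. indicator {0..<1} (p x) * ennreal (cmod (w x)) \<partial>N)"
    by (rule variation_weighted_image[OF borel01_ring_borel01 m int]) auto
  finally show ?thesis using M01_facts(2)[of m] by (simp add: norm_M01.rep_eq)
qed

lemma integrable_X_weight:
  fixes w :: "'a \<Rightarrow> complex"
  assumes [measurable]: "p \<in> borel_measurable N" "w \<in> borel_measurable N"
    and i: "integrable N (\<lambda>x. indicator A (p x) * w x)" and A: "A \<subseteq> {0..1}" "A \<in> sets borel"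
  shows "integrable N (\<lambda>x. indicator A (p x) * (of_real (p x) * w x))"
proof (rule Bochner_Integration.integrable_bound[OF i])
  note A(2)[measurable]
  show "(\<lambda>x. indicator A (p x) * (of_real (p x) * w x)) \<in> borel_measurable N" by measurable
  show "AE x in N. norm (indicator A (p x) * (of_real (p x) * w x)) \<le> norm (indicator A (p x) * w x)"
    using A by (intro AE_I2) (auto simp: norm_mult mult_left_le_one_le split: split_indicator)
qed

lemma lweight_X:
  assumes w: "lweight N p w" shows "lweight N p (\<lambda>x. of_real (p x) * w x)"
proof -
  have [measurable]: "p \<in> borel_measurable N" "w \<in> borel_measurable N" using w by (auto simp: lweight_def)
  show ?thesis using w unfolding lweight_def by (auto intro!: integrable_X_weight)
qed

text \<open>\<open>X_M m\<close> is \<open>Abs_M01\<close> of a set function given by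
  \<open>cintegral\<close>, so it is accessible only once that function is recognised as a measure;
  the weight x u(x) does this.\<close>

lemma mrep_canonical_density:
  assumes L: "sigma_finite_measure \<Lambda>" "sets \<Lambda> = sets borel"
    and ac: "\<And>A. A \<in> borel01 \<Longrightarrow> emeasure \<Lambda> A = 0 \<Longrightarrow> Rep_M01 m A = 0"
  obtains u where "mrep \<Lambda> (\<lambda>x. x) u m" "u \<in> borel_measurable borel" "\<And>x. x \<notin> {0..<1} \<Longrightarrow> u x = 0"
    "(\<integral>\<^sup>+x. ennreal (cmod (u x)) \<partial>\<Lambda>) \<le> 4 * ennreal (norm m)" "integrable \<Lambda> u"
    "mrep \<Lambda> (\<lambda>x. x) (\<lambda>x. of_real x * u x) (X_M m)"
proof -
  note [measurable_cong] = L(2)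
  have f: "variation (Rep_M01 m) {0..a} < \<infinity>" if "a < 1" for a
    using that by (intro variation_M01_finite) (auto simp: borel01_def)
  obtain u where u: "u \<in> borel_measurable borel" "\<And>x. x \<notin> {0..<1} \<Longrightarrow> u x = 0"
    "\<And>A. A \<in> borel01 \<Longrightarrow> (\<integral>\<^sup>+x. ennreal (cmod (u x)) * indicator A x \<partial>\<Lambda>) \<le> 4 * variation (Rep_M01 m) A"
    and int: "\<And>f C A. f \<in> borel_measurable borel \<Longrightarrow> A \<in> borel01 \<Longrightarrow> variation (Rep_M01 m) A < \<infinity> \<Longrightarrow>
       (\<And>x. x \<in> {0..<1} \<Longrightarrow> cmod (f x) \<le> C * indicator A x) \<Longrightarrow>
       integrable \<Lambda> (\<lambda>x. f x * u x) \<and> cintegral (Rep_M01 m) f = (LINT x|\<Lambda>. f x * u x)"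
    and eq: "\<And>A. A \<in> borel01 \<Longrightarrow> variation (Rep_M01 m) A < \<infinity> \<Longrightarrow> Rep_M01 m A = (LINT x|\<Lambda>. indicator A x * u x)"
    using cmeasure_density[OF borel01_ring_borel01 M01_facts(1) f L ac] by blast
  note [measurable] = u(1)
  have b1: "{0..<1::real} \<in> borel01" by (auto simp: borel01_def)
  have e: "(\<integral>\<^sup>+x. ennreal (cmod (u x)) * indicator {0..<1} x \<partial>\<Lambda>) = (\<integral>\<^sup>+x. ennreal (cmod (u x)) \<partial>\<Lambda>)"
    using u(2) by (intro nn_integral_cong) (auto split: split_indicator)
  have le: "(\<integral>\<^sup>+x. ennreal (cmod (u x)) \<partial>\<Lambda>) \<le> 4 * ennreal (norm m)"
    using u(3)[OF b1] M01_facts(2)[of m] by (simp add: e norm_M01.rep_eq)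
  have ui: "integrable \<Lambda> u"
  proof (rule integrableI_bounded)
    show "u \<in> borel_measurable \<Lambda>" by measurable
    show "(\<integral>\<^sup>+x. ennreal (cmod (u x)) \<partial>\<Lambda>) < \<infinity>" using le by (rule le_less_trans) (auto simp: ennreal_mult_less_top)
  qed
  have ind: "integrable \<Lambda> (\<lambda>x. indicator A x * u x)" if "A \<in> sets borel" for A
  proof (rule Bochner_Integration.integrable_bound[OF ui])
    note that[measurable]
    show "(\<lambda>x. indicator A x * u x) \<in> borel_measurable \<Lambda>" by measurable
  qed (auto simp: norm_mult split: split_indicator)
  have uL: "u \<in> borel_measurable \<Lambda>" "(\<lambda>x. x) \<in> borel_measurable \<Lambda>" by measurable
  have lw: "lweight \<Lambda> (\<lambda>x. x) u"
    unfolding lweight_def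
  proof (intro conjI allI impI ballI)
    show "0 \<le> x" if "u x \<noteq> 0" for x using u(2)[of x] that by (cases "x \<in> {0..<1}") auto
  qed (use L uL ind in auto)
  have r: "mrep \<Lambda> (\<lambda>x. x) u m"
    unfolding mrep_def using lw ind eq variation_M01_finite by auto
  have lwX: "lweight \<Lambda> (\<lambda>x. x) (\<lambda>x. of_real x * u x)" by (rule lweight_X[OF lw])
  have iX: "integrable \<Lambda> (\<lambda>x. indicator {0..<1} x * (of_real x * u x))"
    by (rule integrable_X_weight[OF uL(2) uL(1) ind]) auto
  obtain n where n: "mrep \<Lambda> (\<lambda>x. x) (\<lambda>x. of_real x * u x) n" using mrep_exists[OF lwX iX] by auto
  have "X_M m = n"
  proof -
    have "(if A \<in> borel01 then cintegral (Rep_M01 m) (\<lambda>t. indicator A t * complex_of_real t) else 0) = Rep_M01 n A" for A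
    proof (cases "A \<in> borel01")
      case True
      then have [measurable]: "A \<in> sets borel" by (auto simp: borel01_def)
      have "cintegral (Rep_M01 m) (\<lambda>t. indicator A t * complex_of_real t) = (LINT x|\<Lambda>. indicator A x * of_real x * u x)"
        using int[of "\<lambda>t. indicator A t * complex_of_real t" A 1] True variation_M01_finite[OF True]
        by (auto simp: norm_mult borel01_def split: split_indicator)
      then show ?thesis using True mrepD(3)[OF n True] by (simp add: mult.assoc)
    qed (use M01_facts(1)[of n] in \<open>auto simp: cmeasure_on_def\<close>)
    then show ?thesis unfolding X_M_def by (simp add: Rep_M01_inverse)
  qed
  then show ?thesis using that r u(1,2) le ui n by blast
qed

lemma mrep_canonical:
  obtains \<Lambda> u where "sets \<Lambda> = sets borel" "mrep \<Lambda> (\<lambda>x. x) u m" "u \<in> borel_measurable borel" "\<And>x. x \<notin> {0..<1} \<Longrightarrow> u x = 0"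
    "(\<integral>\<^sup>+x. ennreal (cmod (u x)) \<partial>\<Lambda>) \<le> 4 * ennreal (norm m)" "integrable \<Lambda> u"
    "mrep \<Lambda> (\<lambda>x. x) (\<lambda>x. of_real x * u x) (X_M m)"
proof -
  have f: "variation (Rep_M01 m) {0..a} < \<infinity>" if "a < 1" for a
    using that by (intro variation_M01_finite) (auto simp: borel01_def)
  obtain \<Lambda> where L: "sigma_finite_measure \<Lambda>" "sets \<Lambda> = sets borel"
    "\<And>A. A \<in> borel01 \<Longrightarrow> emeasure \<Lambda> A = 0 \<Longrightarrow> Rep_M01 m A = 0"
    using dominating_measure[OF borel01_ring_borel01 M01_facts(1) f] by blast
  show ?thesis by (rule mrep_canonical_density[OF L], assumption, assumption, rule that[OF L(2)], assumption+)
qed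

text \<open>The canonical representation gives access to \<open>X_M m\<close>. Testing with the
  function that is x on A and 0 elsewhere carries this over to any other representation.\<close>

lemma mrep_X:
  assumes r: "mrep N p w m" shows "mrep N p (\<lambda>x. of_real (p x) * w x) (X_M m)"
proof (rule lrep_mrep)
  note w = lweight_X[OF mrepD(1)[OF r]]
  obtain \<Lambda> :: "real measure" and u where c: "mrep \<Lambda> (\<lambda>x. x) u m" "mrep \<Lambda> (\<lambda>x. x) (\<lambda>x. of_real x * u x) (X_M m)"
    using mrep_canonical by metis
  show "lrep N p (\<lambda>x. of_real (p x) * w x) (lf_of_M (X_M m))"
    unfolding lrep_def
  proof (intro conjI w ballI)
    fix A assume A: "A \<in> lc_borel01"
    then have [measurable]: "A \<in> sets borel" by (auto simp: lc_borel01_def)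
    obtain a where a: "a < 1" "A \<subseteq> {0..a}" using A by (auto simp: lc_borel01_def)
    have "bdd_supp (\<lambda>x. indicator A x * of_real x) 1 a"
      using a unfolding bdd_supp_def by (force simp: norm_mult split: split_indicator)
    then have t: "test_fun (\<lambda>x. indicator A x * of_real x)" unfolding test_fun_def by auto
    have "Rep_lfmeas (lf_of_M (X_M m)) A = (LINT x|\<Lambda>. indicator A x * (of_real x * u x))"
      using A mrep_lrep[OF c(2)] by (simp add: lrep_def)
    also have "\<dots> = (LINT x|\<Lambda>. indicator A x * of_real x * u x)" by (simp add: mult.assoc)
    also have "\<dots> = (LINT x|N. indicator A (p x) * of_real (p x) * w x)"
      by (rule lrep_integral_unique[OF mrep_lrep[OF c(1)] mrep_lrep[OF r] t])
    finally show "Rep_lfmeas (lf_of_M (X_M m)) A = (LINT x|N. indicator A (p x) * (of_real (p x) * w x))"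
      by (simp add: mult.assoc)
  qed
  show "integrable N (\<lambda>x. indicator {0..<1} (p x) * (of_real (p x) * w x))"
    by (rule integrable_X_weight[OF mrepD(5,6)[OF r] mrepD(2)[OF r]]) auto
qed

text \<open>Resolves the definite descriptions in \<open>times_M01\<close> and \<open>D_M\<close>
  alike: integrability gives existence, injectivity of \<open>lf_of_M\<close> uniqueness.\<close>

lemma mrep_The:
  assumes "lrep N p w \<kappa>" "integrable N (\<lambda>x. indicator {0..<1} (p x) * w x)"
  shows "mrep N p w (THE m. lf_of_M m = \<kappa>)"
proof -
  obtain m where m: "mrep N p w m" using mrep_exists[OF lrep_lweight] assms by blast
  then have "lf_of_M m = \<kappa>" using lrep_unique mrep_lrep assms by blast
  then have "(THE m. lf_of_M m = \<kappa>) = m" using lf_of_M_inj by blast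
  then show ?thesis using m by simp
qed

lemma mrep_times:
  assumes r: "mrep N p w a" "mrep N' p' w' b"
  shows "mrep (N \<Otimes>\<^sub>M N') (\<lambda>(x, y). p x + p' y) (\<lambda>(x, y). w x * w' y) (a * b)"
  unfolding times_M01_def
proof (rule mrep_The)
  show l: "lrep (N \<Otimes>\<^sub>M N') (\<lambda>(x, y). p x + p' y) (\<lambda>(x, y). w x * w' y) (lf_conv (lf_of_M a) (lf_of_M b))"
    by (rule lf_conv_lrep[OF mrep_lrep[OF r(1)] mrep_lrep[OF r(2)]])
  note [measurable] = mrepD(5,6)[OF r(1)] mrepD(5,6)[OF r(2)]
  interpret NN: pair_sigma_finite N N' using mrepD(4)[OF r(1)] mrepD(4)[OF r(2)] by (rule pair_sigma_finite.intro)
  have "integrable (N \<Otimes>\<^sub>M N') (\<lambda>(x, y). (indicator {0..<1} (p x) * w x) * (indicator {0..<1} (p' y) * w' y))"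
    using mrepD(2)[OF r(1)] mrepD(2)[OF r(2)] by (rule NN.integrable_times)
  then show "integrable (N \<Otimes>\<^sub>M N') (\<lambda>x. indicator {0..<1} (case x of (x, y) \<Rightarrow> p x + p' y) * (case x of (x, y) \<Rightarrow> w x * w' y))"
  proof (rule Bochner_Integration.integrable_bound)
    show "AE x in N \<Otimes>\<^sub>M N'. norm (indicator {0..<1} (case x of (x, y) \<Rightarrow> p x + p' y) * (case x of (x, y) \<Rightarrow> w x * w' y))
       \<le> norm (case x of (x, y) \<Rightarrow> (indicator {0..<1} (p x) * w x) * (indicator {0..<1} (p' y) * w' y))"
    proof (rule AE_I2, clarify)
      fix x y assume "(x, y) \<in> space (N \<Otimes>\<^sub>M N')"
      then have "w x \<noteq> 0 \<longrightarrow> 0 \<le> p x" "w' y \<noteq> 0 \<longrightarrow> 0 \<le> p' y" using mrepD(7)[OF r(1)] mrepD(7)[OF r(2)] by (auto simp: space_pair_measure)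
      then show "norm (indicator {0..<1} (p x + p' y) * (w x * w' y))
       \<le> norm ((indicator {0..<1} (p x) * w x) * (indicator {0..<1} (p' y) * w' y))"
        by (cases "w x = 0"; cases "w' y = 0") (auto simp: norm_mult split: split_indicator)
    qed
  qed measurable
qed

text \<open>The condition that \<open>t|\<mu>|([0,1-t))\<close> is bounded, stated for the density \<open>u\<close> of a measure \<open>\<mu>\<close>.\<close>

definition growth_bound :: "real measure \<Rightarrow> (real \<Rightarrow> complex) \<Rightarrow> real \<Rightarrow> bool" where
  "growth_bound \<Lambda> u C \<longleftrightarrow> 0 \<le> C \<and>
     (\<forall>t\<in>{0..<1}. ennreal t * (\<integral>\<^sup>+s. indicator {0..<1} (t + s) * ennreal (cmod (u s)) \<partial>\<Lambda>) \<le> ennreal C)"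

text \<open>The growth condition enters here. For fixed x the integral of p(x) |u(s)| over p(x) + s
  < 1 is at most C, because the factor p(x) coming from X balances the mass of \<mu> near 1.
  Tonelli's theorem then bounds the whole by C times the integral of |w| over p(x) < 1.\<close>

lemma mrep_D_M:
  assumes r: "mrep N p w \<nu>" and m: "lrep \<Lambda> (\<lambda>x. x) u \<mu>" and g: "growth_bound \<Lambda> u C"
  shows "mrep (N \<Otimes>\<^sub>M \<Lambda>) (\<lambda>(x, s). p x + s) (\<lambda>(x, s). of_real (p x) * w x * u s) (D_M \<mu> \<nu>)"
  unfolding D_M_def
proof (rule mrep_The)
  show l: "lrep (N \<Otimes>\<^sub>M \<Lambda>) (\<lambda>(x, s). p x + s) (\<lambda>(x, s). of_real (p x) * w x * u s) (lf_conv (lf_of_M (X_M \<nu>)) \<mu>)"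
    by (rule lf_conv_lrep[OF mrep_lrep[OF mrep_X[OF r]] m])
  note mw = lrep_lweight[OF m]
  have [measurable]: "p \<in> borel_measurable N" "w \<in> borel_measurable N" "u \<in> borel_measurable \<Lambda>" "(\<lambda>x. x) \<in> borel_measurable \<Lambda>"
    and sf: "sigma_finite_measure N" "sigma_finite_measure \<Lambda>" using mrepD(4,5,6)[OF r] mw by (auto simp: lweight_def)
  interpret L: sigma_finite_measure \<Lambda> by fact
  show "integrable (N \<Otimes>\<^sub>M \<Lambda>) (\<lambda>x. indicator {0..<1} (case x of (x, s) \<Rightarrow> p x + s) * (case x of (x, s) \<Rightarrow> of_real (p x) * w x * u s))"
  proof (rule integrableI_bounded)
    have "(\<integral>\<^sup>+z. ennreal (norm (indicator {0..<1} (case z of (x, s) \<Rightarrow> p x + s) * (case z of (x, s) \<Rightarrow> of_real (p x) * w x * u s))) \<partial>(N \<Otimes>\<^sub>M \<Lambda>))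
      = (\<integral>\<^sup>+x. \<integral>\<^sup>+s. ennreal (norm (indicator {0..<1} (p x + s) * (of_real (p x) * w x * u s))) \<partial>\<Lambda> \<partial>N)"
      by (subst L.nn_integral_fst[symmetric]) auto
    also have "\<dots> \<le> (\<integral>\<^sup>+x. ennreal C * ennreal (norm (indicator {0..<1} (p x) * w x)) \<partial>N)"
    proof (rule nn_integral_mono)
      fix x assume x: "x \<in> space N"
      show "(\<integral>\<^sup>+s. ennreal (norm (indicator {0..<1} (p x + s) * (of_real (p x) * w x * u s))) \<partial>\<Lambda>) \<le> ennreal C * ennreal (norm (indicator {0..<1} (p x) * w x))"
      proof (cases "w x = 0")
        case False
        then have px: "0 \<le> p x" using mrepD(7)[OF r x] by auto
        have pos: "u s \<noteq> 0 \<longrightarrow> 0 \<le> s" if "s \<in> space \<Lambda>" for s using mw that by (auto simp: lweight_def)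
        show ?thesis
        proof (cases "p x < 1")
          case True
          have "(\<integral>\<^sup>+s. ennreal (norm (indicator {0..<1} (p x + s) * (of_real (p x) * w x * u s))) \<partial>\<Lambda>)
            = (\<integral>\<^sup>+s. ennreal (cmod (w x)) * (ennreal (p x) * (indicator {0..<1} (p x + s) * ennreal (cmod (u s)))) \<partial>\<Lambda>)"
            using px by (intro nn_integral_cong) (auto simp: norm_mult ennreal_mult mult_ac split: split_indicator)
          also have "\<dots> = ennreal (cmod (w x)) * (ennreal (p x) * (\<integral>\<^sup>+s. indicator {0..<1} (p x + s) * ennreal (cmod (u s)) \<partial>\<Lambda>))"
            by (simp add: nn_integral_cmult)
          also have "\<dots> \<le> ennreal (cmod (w x)) * ennreal C"
            using g px True by (intro mult_left_mono) (auto simp: growth_bound_def)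
          finally show ?thesis using px True by (simp add: mult.commute)
        next
          case False
          have "(\<integral>\<^sup>+s. ennreal (norm (indicator {0..<1} (p x + s) * (of_real (p x) * w x * u s))) \<partial>\<Lambda>) = (\<integral>\<^sup>+s. 0 \<partial>\<Lambda>)"
            using False pos by (intro nn_integral_cong) (force split: split_indicator)
          then show ?thesis by simp
        qed
      qed simp
    qed
    also have "\<dots> = ennreal C * (\<integral>\<^sup>+x. ennreal (norm (indicator {0..<1} (p x) * w x)) \<partial>N)"
      by (simp add: nn_integral_cmult)
    also have "\<dots> < \<infinity>"
      using mrepD(2)[OF r] unfolding integrable_iff_bounded by (auto simp: ennreal_mult_less_top)
    finally show "(\<integral>\<^sup>+z. ennreal (norm (indicator {0..<1} (case z of (x, s) \<Rightarrow> p x + s) * (case z of (x, s) \<Rightarrow> of_real (p x) * w x * u s))) \<partial>(N \<Otimes>\<^sub>M \<Lambda>)) < \<infinity>" .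
  qed measurable
qed

section \<open>Reordering triple products\<close>

lemma integral_distr_self:
  fixes g :: "'b \<Rightarrow> complex"
  assumes "distr M N f = N" "f \<in> measurable M N" "integrable N g"
  shows "integrable M (\<lambda>x. g (f x))" "(LINT y|N. g y) = (LINT x|M. g (f x))"
  using integrable_distr[of f M N g] integral_distr[of f M N g] assms by auto

lemma distr_pair_assoc:
  assumes "sigma_finite_measure A" "sigma_finite_measure B" "sigma_finite_measure C"
  shows "distr ((A \<Otimes>\<^sub>M B) \<Otimes>\<^sub>M C) (A \<Otimes>\<^sub>M (B \<Otimes>\<^sub>M C)) (\<lambda>((x, y), z). (x, (y, z))) = A \<Otimes>\<^sub>M (B \<Otimes>\<^sub>M C)"
proof (rule measure_eqI)
  interpret B: sigma_finite_measure B by fact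
  interpret C: sigma_finite_measure C by fact
  interpret BC: sigma_finite_measure "B \<Otimes>\<^sub>M C" by (rule sigma_finite_pair_measure) fact+
  fix S assume "S \<in> sets (distr ((A \<Otimes>\<^sub>M B) \<Otimes>\<^sub>M C) (A \<Otimes>\<^sub>M (B \<Otimes>\<^sub>M C)) (\<lambda>((x, y), z). (x, (y, z))))"
  then have S[measurable]: "S \<in> sets (A \<Otimes>\<^sub>M (B \<Otimes>\<^sub>M C))" by simp
  have "emeasure (distr ((A \<Otimes>\<^sub>M B) \<Otimes>\<^sub>M C) (A \<Otimes>\<^sub>M (B \<Otimes>\<^sub>M C)) (\<lambda>((x, y), z). (x, (y, z)))) S
     = (\<integral>\<^sup>+q. indicator S q \<partial>distr ((A \<Otimes>\<^sub>M B) \<Otimes>\<^sub>M C) (A \<Otimes>\<^sub>M (B \<Otimes>\<^sub>M C)) (\<lambda>((x, y), z). (x, (y, z))))"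
    by simp
  also have "\<dots> = (\<integral>\<^sup>+q. indicator S (case q of ((x, y), z) \<Rightarrow> (x, (y, z))) \<partial>((A \<Otimes>\<^sub>M B) \<Otimes>\<^sub>M C))"
    by (subst nn_integral_distr) (auto simp: split_beta')
  also have "\<dots> = (\<integral>\<^sup>+xy. \<integral>\<^sup>+z. indicator S (case xy of (x, y) \<Rightarrow> (x, (y, z))) \<partial>C \<partial>(A \<Otimes>\<^sub>M B))"
    by (subst C.nn_integral_fst[symmetric]) (auto simp: split_beta')
  also have "\<dots> = (\<integral>\<^sup>+x. \<integral>\<^sup>+y. \<integral>\<^sup>+z. indicator S (x, (y, z)) \<partial>C \<partial>B \<partial>A)"
    by (subst B.nn_integral_fst[symmetric]) (auto simp: split_beta')
  also have "\<dots> = (\<integral>\<^sup>+x. \<integral>\<^sup>+yz. indicator S (x, yz) \<partial>(B \<Otimes>\<^sub>M C) \<partial>A)"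
    by (intro nn_integral_cong, subst C.nn_integral_fst[symmetric]) auto
  also have "\<dots> = (\<integral>\<^sup>+q. indicator S q \<partial>(A \<Otimes>\<^sub>M (B \<Otimes>\<^sub>M C)))"
    by (subst BC.nn_integral_fst[symmetric]) auto
  finally show "emeasure (distr ((A \<Otimes>\<^sub>M B) \<Otimes>\<^sub>M C) (A \<Otimes>\<^sub>M (B \<Otimes>\<^sub>M C)) (\<lambda>((x, y), z). (x, (y, z)))) S = emeasure (A \<Otimes>\<^sub>M (B \<Otimes>\<^sub>M C)) S"
    by simp
qed simp

text \<open>\<open>D_M \<mu> a * b\<close> is represented over (A \<times> \<Lambda>) \<times> B,
  but \<open>D_M \<mu> (a * b)\<close> over (A \<times> B) \<times> \<Lambda>, so the last two
  factors have to change places.\<close>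

lemma distr_pair_swap23:
  assumes "sigma_finite_measure A" "sigma_finite_measure B" "sigma_finite_measure C"
  shows "distr ((A \<Otimes>\<^sub>M B) \<Otimes>\<^sub>M C) ((A \<Otimes>\<^sub>M C) \<Otimes>\<^sub>M B) (\<lambda>((x, y), z). ((x, z), y)) = (A \<Otimes>\<^sub>M C) \<Otimes>\<^sub>M B"
proof (rule measure_eqI)
  interpret B: sigma_finite_measure B by fact
  interpret C: sigma_finite_measure C by fact
  interpret BC: pair_sigma_finite B C ..
  fix S assume "S \<in> sets (distr ((A \<Otimes>\<^sub>M B) \<Otimes>\<^sub>M C) ((A \<Otimes>\<^sub>M C) \<Otimes>\<^sub>M B) (\<lambda>((x, y), z). ((x, z), y)))"
  then have S[measurable]: "S \<in> sets ((A \<Otimes>\<^sub>M C) \<Otimes>\<^sub>M B)" by simp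
  have "emeasure (distr ((A \<Otimes>\<^sub>M B) \<Otimes>\<^sub>M C) ((A \<Otimes>\<^sub>M C) \<Otimes>\<^sub>M B) (\<lambda>((x, y), z). ((x, z), y))) S
     = (\<integral>\<^sup>+q. indicator S q \<partial>distr ((A \<Otimes>\<^sub>M B) \<Otimes>\<^sub>M C) ((A \<Otimes>\<^sub>M C) \<Otimes>\<^sub>M B) (\<lambda>((x, y), z). ((x, z), y)))"
    by simp
  also have "\<dots> = (\<integral>\<^sup>+q. indicator S (case q of ((x, y), z) \<Rightarrow> ((x, z), y)) \<partial>((A \<Otimes>\<^sub>M B) \<Otimes>\<^sub>M C))"
    by (subst nn_integral_distr) (auto simp: split_beta')
  also have "\<dots> = (\<integral>\<^sup>+xy. \<integral>\<^sup>+z. indicator S (case xy of (x, y) \<Rightarrow> ((x, z), y)) \<partial>C \<partial>(A \<Otimes>\<^sub>M B))"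
    by (subst C.nn_integral_fst[symmetric]) (auto simp: split_beta')
  also have "\<dots> = (\<integral>\<^sup>+x. \<integral>\<^sup>+y. \<integral>\<^sup>+z. indicator S ((x, z), y) \<partial>C \<partial>B \<partial>A)"
    by (subst B.nn_integral_fst[symmetric]) (auto simp: split_beta')
  also have "\<dots> = (\<integral>\<^sup>+x. \<integral>\<^sup>+z. \<integral>\<^sup>+y. indicator S ((x, z), y) \<partial>B \<partial>C \<partial>A)"
  proof (intro nn_integral_cong)
    fix x assume [measurable]: "x \<in> space A"
    have "(\<lambda>(y, z). indicator S ((x, z), y) :: ennreal) \<in> borel_measurable (B \<Otimes>\<^sub>M C)" by measurable
    then show "(\<integral>\<^sup>+y. \<integral>\<^sup>+z. indicator S ((x, z), y) \<partial>C \<partial>B) = (\<integral>\<^sup>+z. \<integral>\<^sup>+y. indicator S ((x, z), y) \<partial>B \<partial>C)"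
      by (rule BC.Fubini'[symmetric])
  qed
  also have "\<dots> = (\<integral>\<^sup>+xz. \<integral>\<^sup>+y. indicator S (xz, y) \<partial>B \<partial>(A \<Otimes>\<^sub>M C))"
    by (subst C.nn_integral_fst[symmetric]) auto
  also have "\<dots> = (\<integral>\<^sup>+q. indicator S q \<partial>((A \<Otimes>\<^sub>M C) \<Otimes>\<^sub>M B))"
    by (subst B.nn_integral_fst[symmetric]) auto
  finally show "emeasure (distr ((A \<Otimes>\<^sub>M B) \<Otimes>\<^sub>M C) ((A \<Otimes>\<^sub>M C) \<Otimes>\<^sub>M B) (\<lambda>((x, y), z). ((x, z), y))) S = emeasure ((A \<Otimes>\<^sub>M C) \<Otimes>\<^sub>M B) S"
    by simp
qed simp

section \<open>The derivation property on the measure algebra\<close>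

text \<open>The three measures come with unrelated dominating measures, so linearity in the measure
  is not linearity of a single integral. It holds on indicators by hypothesis and extends by
  \<open>test_fun_induct\<close>.\<close>

lemma lf_integral_linear:
  assumes eq: "\<And>A. A \<in> lc_borel01 \<Longrightarrow> Rep_lfmeas m A = Rep_lfmeas m1 A + c * Rep_lfmeas m2 A" and h: "test_fun h"
  shows "lf_integral m h = lf_integral m1 h + c * lf_integral m2 h"
proof -
  obtain L :: "real measure" and u where r: "lrep L (\<lambda>x. x) u m" using lrep_canonical by metis
  obtain L1 :: "real measure" and u1 where r1: "lrep L1 (\<lambda>x. x) u1 m1" using lrep_canonical by metis
  obtain L2 :: "real measure" and u2 where r2: "lrep L2 (\<lambda>x. x) u2 m2" using lrep_canonical by metis
  note w = r[THEN lrep_lweight] r1[THEN lrep_lweight] r2[THEN lrep_lweight]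
  have "(LINT x|L. h x * u x) = (LINT x|L1. h x * u1 x) + c * (LINT x|L2. h x * u2 x)"
    using h
  proof (induction rule: test_fun_induct)
    case (mult A d)
    have s: "(LINT x|M. indicator A x * d * v x) = d * (LINT x|M. indicator A x * v x)" for M and v :: "real \<Rightarrow> complex"
      by (simp add: mult_ac flip: integral_mult_right_zero)
    show ?case unfolding s using r r1 r2 mult eq[OF mult] by (simp add: lrep_def algebra_simps)
  next
    case (add f g)
    then show ?case
      using lweight_integrable[OF w(1)] lweight_integrable[OF w(2)] lweight_integrable[OF w(3)]
      by (simp add: distrib_right algebra_simps)
  next
    case (lim s f C a)
    note l = lim(1) lim(2) lim(3) lim(5)
    have "(\<lambda>i. (LINT x|L1. s i x * u1 x) + c * (LINT x|L2. s i x * u2 x)) \<longlonglongrightarrow> (LINT x|L1. f x * u1 x) + c * (LINT x|L2. f x * u2 x)"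
      by (intro tendsto_intros lweight_lim[OF w(2) l] lweight_lim[OF w(3) l])
    then show ?case using lweight_lim[OF w(1) l] unfolding lim(6) by (rule LIMSEQ_unique[symmetric])
  qed
  then show ?thesis using lrep_integral[OF r h] lrep_integral[OF r1 h] lrep_integral[OF r2 h] by simp
qed

lemma Rep_D_M:
  assumes r: "mrep N p w \<nu>" and m: "lrep \<Lambda> (\<lambda>x. x) u \<mu>" and g: "growth_bound \<Lambda> u C" and A: "A \<in> borel01"
  shows "Rep_M01 (D_M \<mu> \<nu>) A = (LINT x|N. (of_real (p x) * (LINT s|\<Lambda>. indicator A (p x + s) * u s)) * w x)"
proof -
  note d = mrep_D_M[OF r m g]
  interpret P: pair_sigma_finite N \<Lambda> using mrepD(4)[OF r] m by (intro pair_sigma_finite.intro) (auto simp: lrep_def lweight_def)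
  have "Rep_M01 (D_M \<mu> \<nu>) A = (LINT z|(N \<Otimes>\<^sub>M \<Lambda>). indicator A (case z of (x, s) \<Rightarrow> p x + s) * (case z of (x, s) \<Rightarrow> of_real (p x) * w x * u s))"
    by (rule mrepD(3)[OF d A])
  also have "\<dots> = (LINT x|N. LINT s|\<Lambda>. indicator A (p x + s) * (of_real (p x) * w x * u s))"
    using P.integral_fst'[OF integrable_borel01[OF mrepD(1,2)[OF d] A]] by simp
  also have "\<dots> = (LINT x|N. (of_real (p x) * (LINT s|\<Lambda>. indicator A (p x + s) * u s)) * w x)"
  proof (intro Bochner_Integration.integral_cong refl)
    fix x
    have e: "indicator A (p x + s) * (of_real (p x) * w x * u s) = (of_real (p x) * w x) * (indicator A (p x + s) * u s)" for s
      by (simp add: mult_ac)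
    show "(LINT s|\<Lambda>. indicator A (p x + s) * (of_real (p x) * w x * u s)) = (of_real (p x) * (LINT s|\<Lambda>. indicator A (p x + s) * u s)) * w x"
      unfolding e integral_mult_right_zero by (simp add: mult_ac)
  qed
  finally show ?thesis .
qed

text \<open>The function h does not depend on \<nu>, so linearity of \<open>D_M \<mu>\<close>
  becomes linearity of \<open>lf_integral\<close> in the measure. It vanishes beyond a because s
  \<ge> 0 wherever u is nonzero, and it is bounded by the growth constant.\<close>

lemma D_M_test_fun:
  assumes m: "lrep \<Lambda> (\<lambda>x. x) u \<mu>" and g: "growth_bound \<Lambda> u C" and A: "A \<in> lc_borel01"
  defines "h \<equiv> \<lambda>x. indicator {0..<1} x * (of_real x * (LINT s|\<Lambda>. indicator A (x + s) * u s))"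
  shows "test_fun h" "Rep_M01 (D_M \<mu> \<nu>) A = lf_integral (lf_of_M \<nu>) h"
proof -
  obtain a where a: "a < 1" "A \<subseteq> {0..a}" and [measurable]: "A \<in> sets borel" using A by (auto simp: lc_borel01_def)
  have mw: "u \<in> borel_measurable \<Lambda>" "(\<lambda>x. x) \<in> borel_measurable \<Lambda>" "sigma_finite_measure \<Lambda>"
    and pos: "\<And>s. s \<in> space \<Lambda> \<Longrightarrow> u s \<noteq> 0 \<Longrightarrow> 0 \<le> s" using m by (auto simp: lrep_def lweight_def)
  interpret L: sigma_finite_measure \<Lambda> by fact
  note [measurable] = mw(1,2)
  have hm[measurable]: "h \<in> borel_measurable borel" unfolding h_def by measurable
  have "bdd_supp h C a"
    unfolding bdd_supp_def
  proof (intro conjI allI)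
    fix x
    show "cmod (h x) \<le> C * indicator {0..a} x"
    proof (cases "x \<in> {0..a}")
      case True
      then have x: "x \<in> {0..<1}" using a by auto
      have "ennreal (cmod (h x)) \<le> ennreal x * ennreal (cmod (LINT s|\<Lambda>. indicator A (x + s) * u s))"
        using x by (simp add: h_def norm_mult ennreal_mult)
      also have "\<dots> \<le> ennreal x * (\<integral>\<^sup>+s. indicator {0..<1} (x + s) * ennreal (cmod (u s)) \<partial>\<Lambda>)"
      proof (rule mult_left_mono)
        show "ennreal (cmod (LINT s|\<Lambda>. indicator A (x + s) * u s)) \<le> (\<integral>\<^sup>+s. indicator {0..<1} (x + s) * ennreal (cmod (u s)) \<partial>\<Lambda>)"
        \<comment> \<open>Without integrability the integral is 0 by convention, and the bound is
          trivial.\<close>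
        proof (cases "integrable \<Lambda> (\<lambda>s. indicator A (x + s) * u s)")
          case True
          have "ennreal (cmod (LINT s|\<Lambda>. indicator A (x + s) * u s)) \<le> (\<integral>\<^sup>+s. ennreal (cmod (indicator A (x + s) * u s)) \<partial>\<Lambda>)"
            by (rule integral_norm_bound_ennreal[OF True])
          also have "\<dots> \<le> (\<integral>\<^sup>+s. indicator {0..<1} (x + s) * ennreal (cmod (u s)) \<partial>\<Lambda>)"
            using a by (intro nn_integral_mono) (force simp: norm_mult split: split_indicator)
          finally show ?thesis .
        qed (simp add: not_integrable_integral_eq)
      qed simp
      also have "\<dots> \<le> ennreal C" using g x by (auto simp: growth_bound_def)
      finally show ?thesis using True g by (simp add: growth_bound_def)
    next
      case False
      have "h x = 0"
      proof (cases "x \<in> {0..<1}")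
        case x: True
        have "(LINT s|\<Lambda>. indicator A (x + s) * u s) = (LINT s|\<Lambda>. 0)"
        proof (intro Bochner_Integration.integral_cong refl)
          fix s assume "s \<in> space \<Lambda>"
          then show "indicator A (x + s) * u s = 0" using pos[of s] x a False by (cases "u s = 0") (force split: split_indicator)+
        qed
        then show ?thesis by (simp add: h_def)
      qed (simp add: h_def)
      then show ?thesis using False by simp
    qed
  qed (use g a in \<open>auto simp: growth_bound_def\<close>)
  then show t: "test_fun h" using hm by (auto simp: test_fun_def)
  obtain N :: "real measure" and v where c: "mrep N (\<lambda>x. x) v \<nu>" "\<And>x. x \<notin> {0..<1} \<Longrightarrow> v x = 0"
    using mrep_canonical by metis
  have "Rep_M01 (D_M \<mu> \<nu>) A = (LINT x|N. (of_real x * (LINT s|\<Lambda>. indicator A (x + s) * u s)) * v x)"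
    by (rule Rep_D_M[OF c(1) m g lc_borel01_subset[OF A]])
  also have "\<dots> = (LINT x|N. h x * v x)"
    using c(2) by (intro Bochner_Integration.integral_cong) (auto simp: h_def split: split_indicator)
  also have "\<dots> = lf_integral (lf_of_M \<nu>) h" by (rule lrep_integral[OF mrep_lrep[OF c(1)] t, symmetric])
  finally show "Rep_M01 (D_M \<mu> \<nu>) A = lf_integral (lf_of_M \<nu>) h" .
qed

lemma Rep_M01_ops: "Rep_M01 0 A = 0" "Rep_M01 (m + n) A = Rep_M01 m A + Rep_M01 n A"
  "Rep_M01 (c *\<^sub>C m) A = c * Rep_M01 m A" "Rep_M01 (- m) A = - Rep_M01 m A" "Rep_M01 (m - n) A = Rep_M01 m A - Rep_M01 n A"
  "Rep_M01 (r *\<^sub>R m) A = of_real r * Rep_M01 m A"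
  by (auto simp: zero_M01.rep_eq plus_M01.rep_eq scaleC_M01.rep_eq uminus_M01_def minus_M01_def scaleR_M01_def)

lemma D_M_linear:
  assumes m: "lrep \<Lambda> (\<lambda>x. x) u \<mu>" and g: "growth_bound \<Lambda> u C"
  shows "D_M \<mu> (a + c *\<^sub>C b) = D_M \<mu> a + c *\<^sub>C D_M \<mu> b"
proof (rule M01_eqI_lc)
  fix A assume A: "A \<in> lc_borel01"
  note h = D_M_test_fun[OF m g A]
  show "Rep_M01 (D_M \<mu> (a + c *\<^sub>C b)) A = Rep_M01 (D_M \<mu> a + c *\<^sub>C D_M \<mu> b) A"
    unfolding Rep_M01_ops h(2)
    by (rule lf_integral_linear[OF _ h(1)]) (simp add: Rep_lf_of_M Rep_M01_ops)
qed

lemma clinear_D_M: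
  assumes m: "lrep \<Lambda> (\<lambda>x. x) u \<mu>" and g: "growth_bound \<Lambda> u C"
  shows "clinear (D_M \<mu>)"
proof -
  have one: "1 *\<^sub>C x = x" for x :: M01 using scaleC_of_real[of 1 x] by simp
  have add: "D_M \<mu> (x + y) = D_M \<mu> x + D_M \<mu> y" for x y using D_M_linear[OF m g, of x 1 y] by (simp add: one)
  have "D_M \<mu> 0 = 0" using add[of 0 0] by simp
  then show ?thesis unfolding clinear_def using add D_M_linear[OF m g, of 0] by simp
qed

text \<open>X multiplies by the coordinate, which on a product is x + y. The summand x belongs to
  \<open>D_M \<mu> a * b\<close>, the summand y to \<open>a * D_M \<mu> b\<close>; what remains is
  to reorder the three factors of the product space.\<close>

lemma D_M_times:
  assumes m: "lrep \<Lambda> (\<lambda>x. x) u \<mu>" and g: "growth_bound \<Lambda> u C"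
  shows "D_M \<mu> (a * b) = D_M \<mu> a * b + a * D_M \<mu> b"
proof (rule M01_eqI_lc)
  fix S assume "S \<in> lc_borel01"
  then have S: "S \<in> borel01" and [measurable]: "S \<in> sets borel" by (auto simp: lc_borel01_subset lc_borel01_def)
  obtain A :: "real measure" and v where a: "sets A = sets borel" "mrep A (\<lambda>x. x) v a" using mrep_canonical by metis
  obtain B :: "real measure" and w where b: "sets B = sets borel" "mrep B (\<lambda>x. x) w b" using mrep_canonical by metis
  note [measurable] = mrepD(5,6)[OF a(2)] mrepD(5,6)[OF b(2)]
  have mw[measurable]: "u \<in> borel_measurable \<Lambda>" "(\<lambda>x. x) \<in> borel_measurable \<Lambda>" "sigma_finite_measure \<Lambda>"
    using m by (auto simp: lrep_def lweight_def)
  note sf = mrepD(4)[OF a(2)] mrepD(4)[OF b(2)] mw(3)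
  note ab = mrep_D_M[OF mrep_times[OF a(2) b(2)] m g]
  note Dab = mrep_times[OF mrep_D_M[OF a(2) m g] b(2)]
  note aDb = mrep_times[OF a(2) mrep_D_M[OF b(2) m g]]
  define F where "F = (\<lambda>((x, y), z). indicator S (x + y + z) * (of_real x * v x * w y * u z) :: complex)"
  define G where "G = (\<lambda>((x, y), z). indicator S (x + y + z) * (of_real y * v x * w y * u z) :: complex)"
  \<comment> \<open>In the reordered coordinates F is the integrand that represents
    \<open>D_M \<mu> a * b\<close>, and G the one that represents
    \<open>a * D_M \<mu> b\<close>.\<close>
  have F': "(\<lambda>q. F (case q of ((x, z), y) \<Rightarrow> ((x, y), z))) = (\<lambda>q. indicator S (case q of (x, y) \<Rightarrow> (case x of (x, s) \<Rightarrow> x + s) + y) * (case q of (x, y) \<Rightarrow> (case x of (x, s) \<Rightarrow> of_real x * v x * u s) * w y))"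
    by (auto simp: F_def fun_eq_iff ac_simps)
  have G': "(\<lambda>q. G (case q of (x, (y, z)) \<Rightarrow> ((x, y), z))) = (\<lambda>q. indicator S (case q of (x, y) \<Rightarrow> x + (case y of (x, s) \<Rightarrow> x + s)) * (case q of (x, y) \<Rightarrow> v x * (case y of (x, s) \<Rightarrow> of_real x * w x * u s)))"
    by (auto simp: G_def fun_eq_iff ac_simps)
  have Fi: "integrable ((A \<Otimes>\<^sub>M \<Lambda>) \<Otimes>\<^sub>M B) (\<lambda>q. F (case q of ((x, z), y) \<Rightarrow> ((x, y), z)))"
    unfolding F' by (rule integrable_borel01[OF mrepD(1,2)[OF Dab] S])
  have Gi: "integrable (A \<Otimes>\<^sub>M (B \<Otimes>\<^sub>M \<Lambda>)) (\<lambda>q. G (case q of (x, (y, z)) \<Rightarrow> ((x, y), z)))"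
    unfolding G' by (rule integrable_borel01[OF mrepD(1,2)[OF aDb] S])
  have mm: "(\<lambda>((x, y), z). ((x, z), y)) \<in> measurable ((A \<Otimes>\<^sub>M B) \<Otimes>\<^sub>M \<Lambda>) ((A \<Otimes>\<^sub>M \<Lambda>) \<Otimes>\<^sub>M B)"
    "(\<lambda>((x, y), z). (x, (y, z))) \<in> measurable ((A \<Otimes>\<^sub>M B) \<Otimes>\<^sub>M \<Lambda>) (A \<Otimes>\<^sub>M (B \<Otimes>\<^sub>M \<Lambda>))"
    by (simp_all add: split_beta')
  have "F \<in> borel_measurable ((A \<Otimes>\<^sub>M B) \<Otimes>\<^sub>M \<Lambda>)" "G \<in> borel_measurable ((A \<Otimes>\<^sub>M B) \<Otimes>\<^sub>M \<Lambda>)"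
    unfolding F_def G_def split_beta' by measurable
  have FI: "integrable ((A \<Otimes>\<^sub>M B) \<Otimes>\<^sub>M \<Lambda>) F" and
    Feq: "(LINT q|((A \<Otimes>\<^sub>M \<Lambda>) \<Otimes>\<^sub>M B). F (case q of ((x, z), y) \<Rightarrow> ((x, y), z))) = (LINT q|((A \<Otimes>\<^sub>M B) \<Otimes>\<^sub>M \<Lambda>). F q)"
  proof -
    note d = integral_distr_self[OF distr_pair_swap23[OF sf] _ Fi]
    have e: "F (case (\<lambda>((x, y), z). ((x, z), y)) q of ((x, z), y) \<Rightarrow> ((x, y), z)) = F q" for q
      by (auto split: prod.split)
    show "integrable ((A \<Otimes>\<^sub>M B) \<Otimes>\<^sub>M \<Lambda>) F" using d(1)[OF mm(1)] unfolding e .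
    show "(LINT q|((A \<Otimes>\<^sub>M \<Lambda>) \<Otimes>\<^sub>M B). F (case q of ((x, z), y) \<Rightarrow> ((x, y), z))) = (LINT q|((A \<Otimes>\<^sub>M B) \<Otimes>\<^sub>M \<Lambda>). F q)"
      using d(2)[OF mm(1)] unfolding e .
  qed
  have GI: "integrable ((A \<Otimes>\<^sub>M B) \<Otimes>\<^sub>M \<Lambda>) G" and
    Geq: "(LINT q|(A \<Otimes>\<^sub>M (B \<Otimes>\<^sub>M \<Lambda>)). G (case q of (x, (y, z)) \<Rightarrow> ((x, y), z))) = (LINT q|((A \<Otimes>\<^sub>M B) \<Otimes>\<^sub>M \<Lambda>). G q)"
  proof -
    note d = integral_distr_self[OF distr_pair_assoc[OF sf] _ Gi]
    have e: "G (case (\<lambda>((x, y), z). (x, (y, z))) q of (x, (y, z)) \<Rightarrow> ((x, y), z)) = G q" for q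
      by (auto split: prod.split)
    show "integrable ((A \<Otimes>\<^sub>M B) \<Otimes>\<^sub>M \<Lambda>) G" using d(1)[OF mm(2)] unfolding e .
    show "(LINT q|(A \<Otimes>\<^sub>M (B \<Otimes>\<^sub>M \<Lambda>)). G (case q of (x, (y, z)) \<Rightarrow> ((x, y), z))) = (LINT q|((A \<Otimes>\<^sub>M B) \<Otimes>\<^sub>M \<Lambda>). G q)"
      using d(2)[OF mm(2)] unfolding e .
  qed
  have "Rep_M01 (D_M \<mu> (a * b)) S = (LINT q|((A \<Otimes>\<^sub>M B) \<Otimes>\<^sub>M \<Lambda>). F q + G q)"
    unfolding mrepD(3)[OF ab S]
    by (intro Bochner_Integration.integral_cong) (auto simp: F_def G_def algebra_simps)
  also have "\<dots> = (LINT q|((A \<Otimes>\<^sub>M B) \<Otimes>\<^sub>M \<Lambda>). F q) + (LINT q|((A \<Otimes>\<^sub>M B) \<Otimes>\<^sub>M \<Lambda>). G q)" using FI GI by simp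
  also have "(LINT q|((A \<Otimes>\<^sub>M B) \<Otimes>\<^sub>M \<Lambda>). F q) = Rep_M01 (D_M \<mu> a * b) S"
    unfolding Feq[symmetric] F' by (rule mrepD(3)[OF Dab S, symmetric])
  also have "(LINT q|((A \<Otimes>\<^sub>M B) \<Otimes>\<^sub>M \<Lambda>). G q) = Rep_M01 (a * D_M \<mu> b) S"
    unfolding Geq[symmetric] G' by (rule mrepD(3)[OF aDb S, symmetric])
  finally show "Rep_M01 (D_M \<mu> (a * b)) S = Rep_M01 (D_M \<mu> a * b + a * D_M \<mu> b) S" by (simp add: Rep_M01_ops)
qed

lemma derivation_D_M:
  assumes "lrep \<Lambda> (\<lambda>x. x) u \<mu>" "growth_bound \<Lambda> u C"
  shows "derivation (D_M \<mu>)"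
  unfolding derivation_def using clinear_D_M[OF assms] D_M_times[OF assms] by blast

section \<open>The Volterra algebra as an ideal of the measure algebra\<close>

text \<open>A representative extended by 0, so that integrals over [0,1) become integrals over the
  line, where translation is available.\<close>

definition L1_fun :: "L1_01 \<Rightarrow> real \<Rightarrow> complex" where
  "L1_fun f x = indicator {0..<1} x * rep_L1_01 f x"

lemma L1_rel_rep: "L1_rel (rep_L1_01 f) (rep_L1_01 f)"
  by (rule Quotient3_rep_reflp[OF Quotient3_L1_01])

lemma L1_rel_rep_abs: "integrable leb01 g \<Longrightarrow> L1_rel (rep_L1_01 (abs_L1_01 g)) g"
  by (rule Quotient3_rep_abs[OF Quotient3_L1_01]) (auto simp: L1_rel_def)

lemma scaleR_indicator: "indicator A x *\<^sub>R (z::complex) = indicator A x * z"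
  by (auto split: split_indicator)

lemma integrable_leb01: "integrable leb01 (f :: real \<Rightarrow> complex) \<longleftrightarrow> integrable lborel (\<lambda>x. indicator {0..<1} x * f x)"
  unfolding leb01_def by (subst integrable_restrict_space) (auto simp: scaleR_indicator)

lemma integral_leb01:
  fixes f :: "real \<Rightarrow> 'b::{banach, second_countable_topology}"
  shows "(LINT x|leb01. f x) = (LINT x|lborel. indicator {0..<1} x *\<^sub>R f x)"
  unfolding leb01_def by (subst integral_restrict_space) auto

lemma AE_leb01: "(AE x in leb01. P x) \<longleftrightarrow> (AE x in lborel. x \<in> {0..<1} \<longrightarrow> P x)"
  unfolding leb01_def by (subst AE_restrict_space_iff) auto

lemma L1_fun_integrable[simp]: "integrable lborel (L1_fun f)"
  using L1_rel_rep[of f] unfolding L1_fun_def[abs_def] L1_rel_def integrable_leb01 by simp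

lemma L1_fun_measurable[measurable]: "L1_fun f \<in> borel_measurable borel"
  using borel_measurable_integrable[OF L1_fun_integrable] by simp

lemma L1_fun_out: "x \<notin> {0..<1} \<Longrightarrow> L1_fun f x = 0" by (simp add: L1_fun_def)

lemma L1_fun_abs:
  assumes "integrable lborel g" "\<And>x. x \<notin> {0..<1} \<Longrightarrow> g x = 0"
  shows "AE x in lborel. L1_fun (abs_L1_01 g) x = g x"
proof -
  have "(\<lambda>x. indicator {0..<1} x * g x) = g" using assms(2) by (auto split: split_indicator)
  then have "integrable leb01 g" using assms(1) by (simp add: integrable_leb01)
  then have "AE x in leb01. rep_L1_01 (abs_L1_01 g) x = g x" using L1_rel_rep_abs by (auto simp: L1_rel_def)
  then show ?thesis unfolding AE_leb01 by eventually_elim (use assms(2) in \<open>auto simp: L1_fun_def split: split_indicator\<close>)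
qed

lemma L1_fun_abs':
  assumes "integrable leb01 g"
  shows "AE x in lborel. L1_fun (abs_L1_01 g) x = indicator {0..<1} x * g x"
proof -
  have "AE x in leb01. rep_L1_01 (abs_L1_01 g) x = g x" using L1_rel_rep_abs[OF assms] by (auto simp: L1_rel_def)
  then show ?thesis unfolding AE_leb01 by eventually_elim (auto simp: L1_fun_def split: split_indicator)
qed

lemma integrable_leb01_rep: "integrable leb01 (rep_L1_01 f)" using L1_rel_rep[of f] by (simp add: L1_rel_def)

lemma L1_fun_plus: "AE x in lborel. L1_fun (f + g) x = L1_fun f x + L1_fun g x"
proof -
  have "f + g = abs_L1_01 (\<lambda>t. rep_L1_01 f t + rep_L1_01 g t)" by (simp add: plus_L1_01_def)
  then have "AE x in lborel. L1_fun (f + g) x = indicator {0..<1} x * (rep_L1_01 f x + rep_L1_01 g x)"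
    using L1_fun_abs'[of "\<lambda>t. rep_L1_01 f t + rep_L1_01 g t"] integrable_leb01_rep by simp
  then show ?thesis by eventually_elim (simp add: L1_fun_def algebra_simps)
qed

lemma L1_fun_scaleC: "AE x in lborel. L1_fun (c *\<^sub>C f) x = c * L1_fun f x"
proof -
  have "c *\<^sub>C f = abs_L1_01 (\<lambda>t. c * rep_L1_01 f t)" by (simp add: scaleC_L1_01_def)
  then have "AE x in lborel. L1_fun (c *\<^sub>C f) x = indicator {0..<1} x * (c * rep_L1_01 f x)"
    using L1_fun_abs'[of "\<lambda>t. c * rep_L1_01 f t"] integrable_leb01_rep by simp
  then show ?thesis by eventually_elim (simp add: L1_fun_def algebra_simps)
qed

lemma L1_fun_X: "AE x in lborel. L1_fun (X_L1 f) x = of_real x * L1_fun f x"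
proof -
  have "X_L1 f = abs_L1_01 (\<lambda>t. of_real t * rep_L1_01 f t)" by (simp add: X_L1_def)
  moreover have "integrable leb01 (\<lambda>t. complex_of_real t * rep_L1_01 f t)"
    unfolding integrable_leb01
  proof (rule Bochner_Integration.integrable_bound[OF L1_fun_integrable[of f]])
    have "(\<lambda>x. of_real x * L1_fun f x) \<in> borel_measurable borel" by measurable
    then show "(\<lambda>x. indicator {0..<1} x * (complex_of_real x * rep_L1_01 f x)) \<in> borel_measurable lborel"
      by (simp add: L1_fun_def mult_ac)
    show "AE x in lborel. norm (indicator {0..<1} x * (complex_of_real x * rep_L1_01 f x)) \<le> norm (L1_fun f x)"
      by (intro AE_I2) (auto simp: L1_fun_def norm_mult mult_left_le_one_le split: split_indicator)
  qed
  ultimately have "AE x in lborel. L1_fun (X_L1 f) x = indicator {0..<1} x * (of_real x * rep_L1_01 f x)"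
    using L1_fun_abs' by metis
  then show ?thesis by eventually_elim (simp add: L1_fun_def)
qed

lemma norm_L1_fun: "norm f = (LINT x|lborel. cmod (L1_fun f x))"
proof -
  have "norm f = (LINT x|lborel. indicator {0..<1} x *\<^sub>R cmod (rep_L1_01 f x))"
    unfolding norm_L1_01_def map_fun_def by (simp add: integral_leb01)
  also have "\<dots> = (LINT x|lborel. cmod (L1_fun f x))"
    by (intro Bochner_Integration.integral_cong) (auto simp: L1_fun_def norm_mult split: split_indicator)
  finally show ?thesis .
qed

section \<open>The embedding of L^1[0,1) into M[0,1)\<close>

lemma lweight_lborel:
  assumes "integrable lborel v" "\<And>x. x \<notin> {0..<1} \<Longrightarrow> v x = 0"
  shows "lweight lborel (\<lambda>x. x) v" "integrable lborel (\<lambda>x. indicator {0..<1} x * v x)"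
proof -
  have "integrable lborel (\<lambda>x. indicator A x * v x)" if "A \<in> sets borel" for A
    using integrable_mult_indicator[of A lborel v] that assms by (simp add: scaleR_indicator)
  then show "integrable lborel (\<lambda>x. indicator {0..<1} x * v x)" "lweight lborel (\<lambda>x. x) v"
    unfolding lweight_def using assms lborel.sigma_finite_measure_axioms by force+
qed

lemma mrep_AE_cong:
  assumes "mrep lborel (\<lambda>x. x) u m" "AE x in lborel. u x = v x" "integrable lborel v" "\<And>x. x \<notin> {0..<1} \<Longrightarrow> v x = 0"
  shows "mrep lborel (\<lambda>x. x) v m"
  unfolding mrep_def
proof (intro conjI lweight_lborel ballI)
  have [measurable]: "v \<in> borel_measurable borel" "u \<in> borel_measurable borel"
    using borel_measurable_integrable[OF assms(3)] mrepD(6)[OF assms(1)] by auto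
  fix A assume A: "A \<in> borel01"
  then have [measurable]: "A \<in> sets borel" by (auto simp: borel01_def)
  show "Rep_M01 m A = (LINT x|lborel. indicator A x * v x)"
    unfolding mrepD(3)[OF assms(1) A] by (intro integral_cong_AE) (use assms(2) in auto)
qed (use assms in auto)

text \<open>The inclusion f \<mapsto> f(t) dt. Followed by \<open>lf_of_M\<close> it is
  \<open>lf_of_L1\<close>, as \<open>lf_of_M_L1_to_M\<close> confirms.\<close>

definition L1_to_M :: "L1_01 \<Rightarrow> M01" where "L1_to_M f = (SOME m. mrep lborel (\<lambda>x. x) (L1_fun f) m)"

lemma mrep_L1_to_M: "mrep lborel (\<lambda>x. x) (L1_fun f) (L1_to_M f)"
  unfolding L1_to_M_def by (rule someI_ex, rule mrep_exists) (auto intro: lweight_lborel L1_fun_out)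

lemma Rep_L1_to_M: "A \<in> borel01 \<Longrightarrow> Rep_M01 (L1_to_M f) A = (LINT x|lborel. indicator A x * L1_fun f x)"
  by (rule mrepD(3)[OF mrep_L1_to_M])

lemma L1_to_M_eqI: assumes "AE x in lborel. L1_fun f x = v x" "mrep lborel (\<lambda>x. x) v m" shows "L1_to_M f = m"
proof (rule mrep_unique)
  show "mrep lborel (\<lambda>x. x) (L1_fun f) (L1_to_M f)" by (rule mrep_L1_to_M)
  show "mrep lborel (\<lambda>x. x) (L1_fun f) m"
    by (rule mrep_AE_cong[OF assms(2)]) (use assms(1) L1_fun_out in auto)
qed

lemma borel01_sets: "A \<in> borel01 \<Longrightarrow> A \<in> sets borel" by (simp add: borel01_def)

lemma integrable_indicator_L1_fun: "A \<in> borel01 \<Longrightarrow> integrable lborel (\<lambda>x. indicator A x * L1_fun f x)"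
  using integrable_mult_indicator[of A lborel "L1_fun f"] borel01_sets by (simp add: scaleR_indicator)

lemma L1_to_M_add: "L1_to_M (f + g) = L1_to_M f + L1_to_M g"
proof (rule M01_eqI_lc)
  fix A assume "A \<in> lc_borel01"
  then have A: "A \<in> borel01" by (rule lc_borel01_subset)
  note [measurable] = borel01_sets[OF A]
  have "Rep_M01 (L1_to_M (f + g)) A = (LINT x|lborel. indicator A x * L1_fun f x + indicator A x * L1_fun g x)"
    unfolding Rep_L1_to_M[OF A]
  proof (rule integral_cong_AE)
    show "AE x in lborel. indicator A x * L1_fun (f + g) x = indicator A x * L1_fun f x + indicator A x * L1_fun g x"
      using L1_fun_plus[of f g] by eventually_elim (simp add: algebra_simps)
  qed measurable
  then show "Rep_M01 (L1_to_M (f + g)) A = Rep_M01 (L1_to_M f + L1_to_M g) A"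
    using A by (simp add: Rep_M01_ops Rep_L1_to_M integrable_indicator_L1_fun)
qed

lemma L1_to_M_scaleC: "L1_to_M (c *\<^sub>C f) = c *\<^sub>C L1_to_M f"
proof (rule M01_eqI_lc)
  fix A assume "A \<in> lc_borel01"
  then have A: "A \<in> borel01" by (rule lc_borel01_subset)
  note [measurable] = borel01_sets[OF A]
  have "Rep_M01 (L1_to_M (c *\<^sub>C f)) A = (LINT x|lborel. c * (indicator A x * L1_fun f x))"
    unfolding Rep_L1_to_M[OF A]
  proof (rule integral_cong_AE)
    show "AE x in lborel. indicator A x * L1_fun (c *\<^sub>C f) x = c * (indicator A x * L1_fun f x)"
      using L1_fun_scaleC[of c f] by eventually_elim simp
  qed measurable
  then show "Rep_M01 (L1_to_M (c *\<^sub>C f)) A = Rep_M01 (c *\<^sub>C L1_to_M f) A"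
    unfolding integral_mult_right_zero using A by (simp add: Rep_M01_ops Rep_L1_to_M)
qed

lemma L1_to_M_diff: "L1_to_M (f - g) = L1_to_M f - L1_to_M g"
  unfolding minus_L1_01_def uminus_L1_01_def minus_M01_def uminus_M01_def L1_to_M_add L1_to_M_scaleC ..

lemma norm_L1_to_M_le: "norm (L1_to_M f) \<le> norm f"
proof -
  have "ennreal (norm (L1_to_M f)) \<le> (\<integral>\<^sup>+x. indicator {0..<1} x * ennreal (cmod (L1_fun f x)) \<partial>lborel)"
    by (rule norm_mrep[OF mrep_L1_to_M])
  also have "\<dots> \<le> (\<integral>\<^sup>+x. ennreal (cmod (L1_fun f x)) \<partial>lborel)"
    by (intro nn_integral_mono) (auto split: split_indicator)
  also have "\<dots> = ennreal (norm f)" by (subst nn_integral_eq_integral) (auto simp: norm_L1_fun)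
  finally show ?thesis by simp
qed

lemma Rep_M01_le_norm: "cmod (Rep_M01 m A) \<le> norm m"
proof (cases "A \<in> borel01")
  case True
  have "ennreal (cmod (Rep_M01 m A)) \<le> variation (Rep_M01 m) {0..<1}"
    using True by (intro order_trans[OF variation_ge variation_mono]) (auto simp: borel01_def)
  also have "\<dots> = ennreal (norm m)" using M01_facts(2)[of m] by (simp add: norm_M01.rep_eq)
  finally show ?thesis by simp
qed (use M01_facts(1)[of m] in \<open>auto simp: cmeasure_on_def\<close>)

text \<open>The embedding is isometric, but equivalence of the norms suffices. Evaluating on the
  sets where the real or the imaginary part is nonnegative or negative bounds each of the four
  pieces by the norm of the measure.\<close>

lemma norm_le_L1_to_M: "norm f \<le> 4 * norm (L1_to_M f)"
proof -
  have part: "(LINT x|lborel. \<bar>r x\<bar>) \<le> 2 * norm (L1_to_M f)"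
    if r: "\<And>A. A \<in> borel01 \<Longrightarrow> \<bar>LINT x|lborel. indicator A x * r x\<bar> \<le> norm (L1_to_M f)"
      "integrable lborel r" "\<And>x. x \<notin> {0..<1} \<Longrightarrow> r x = 0" for r :: "real \<Rightarrow> real"
  proof -
    have [measurable]: "r \<in> borel_measurable borel" using r(2) by auto
    let ?P = "{x\<in>{0..<1}. 0 \<le> r x}" and ?Q = "{x\<in>{0..<1}. r x < 0}"
    have b: "?P \<in> borel01" "?Q \<in> borel01" by (auto simp: borel01_def)
    have i: "integrable lborel (\<lambda>x. indicator A x * r x)" if "A \<in> borel01" for A
      using integrable_mult_indicator[of A lborel r] r(2) borel01_sets[OF that] by simp
    have "(LINT x|lborel. \<bar>r x\<bar>) = (LINT x|lborel. indicator ?P x * r x - indicator ?Q x * r x)"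
      using r(3) by (intro Bochner_Integration.integral_cong) (auto split: split_indicator)
    also have "\<dots> = (LINT x|lborel. indicator ?P x * r x) - (LINT x|lborel. indicator ?Q x * r x)"
      using i[OF b(1)] i[OF b(2)] by simp
    also have "\<dots> \<le> norm (L1_to_M f) + norm (L1_to_M f)" using r(1)[OF b(1)] r(1)[OF b(2)] by linarith
    finally show ?thesis by simp
  qed
  have c: "cmod (LINT x|lborel. indicator A x * L1_fun f x) \<le> norm (L1_to_M f)" if "A \<in> borel01" for A
    using Rep_L1_to_M[OF that, of f] Rep_M01_le_norm[of "L1_to_M f" A] by simp
  have 1: "(LINT x|lborel. \<bar>Re (L1_fun f x)\<bar>) \<le> 2 * norm (L1_to_M f)"
  proof (rule part)
    fix A assume A: "A \<in> borel01"
    have "(LINT x|lborel. indicator A x * Re (L1_fun f x)) = Re (LINT x|lborel. indicator A x * L1_fun f x)"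
      by (subst integral_Re[OF integrable_indicator_L1_fun[OF A], symmetric]) (auto intro!: Bochner_Integration.integral_cong split: split_indicator)
    then show "\<bar>LINT x|lborel. indicator A x * Re (L1_fun f x)\<bar> \<le> norm (L1_to_M f)"
      using abs_Re_le_cmod[of "LINT x|lborel. indicator A x * L1_fun f x"] c[OF A] by linarith
  qed (auto simp: L1_fun_out)
  have 2: "(LINT x|lborel. \<bar>Im (L1_fun f x)\<bar>) \<le> 2 * norm (L1_to_M f)"
  proof (rule part)
    fix A assume A: "A \<in> borel01"
    have "(LINT x|lborel. indicator A x * Im (L1_fun f x)) = Im (LINT x|lborel. indicator A x * L1_fun f x)"
      by (subst integral_Im[OF integrable_indicator_L1_fun[OF A], symmetric]) (auto intro!: Bochner_Integration.integral_cong split: split_indicator)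
    then show "\<bar>LINT x|lborel. indicator A x * Im (L1_fun f x)\<bar> \<le> norm (L1_to_M f)"
      using abs_Im_le_cmod[of "LINT x|lborel. indicator A x * L1_fun f x"] c[OF A] by linarith
  qed (auto simp: L1_fun_out)
  have "norm f \<le> (LINT x|lborel. \<bar>Re (L1_fun f x)\<bar> + \<bar>Im (L1_fun f x)\<bar>)"
    unfolding norm_L1_fun by (intro integral_mono) (auto intro: cmod_le)
  also have "\<dots> = (LINT x|lborel. \<bar>Re (L1_fun f x)\<bar>) + (LINT x|lborel. \<bar>Im (L1_fun f x)\<bar>)" by simp
  finally show ?thesis using 1 2 by linarith
qed

lemma L1_to_M_inj: "L1_to_M f = L1_to_M g \<Longrightarrow> f = g"
  using norm_le_L1_to_M[of "f - g"] by (simp add: L1_to_M_diff)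

text \<open>The Radon-Nikodym theorem. Together with \<open>L1_to_M_null\<close> it describes the
  range by the vanishing of evaluations at Lebesgue null sets, a closed condition.\<close>

lemma L1_to_M_range:
  assumes "\<And>A. A \<in> borel01 \<Longrightarrow> emeasure lborel A = 0 \<Longrightarrow> Rep_M01 m A = 0"
  shows "\<exists>f. L1_to_M f = m"
proof -
  obtain u where u: "mrep lborel (\<lambda>x. x) u m" "\<And>x. x \<notin> {0..<1} \<Longrightarrow> u x = 0" "integrable lborel u"
    using mrep_canonical_density[OF lborel.sigma_finite_measure_axioms sets_lborel assms] by metis
  show ?thesis using L1_to_M_eqI[OF L1_fun_abs[OF u(3,2)] u(1)] by blast
qed

lemma L1_to_M_null:
  assumes "A \<in> borel01" "emeasure lborel A = 0" shows "Rep_M01 (L1_to_M f) A = 0"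
proof -
  note [measurable] = borel01_sets[OF assms(1)]
  have ae: "AE x in lborel. x \<notin> A" using assms by (intro AE_not_in) (auto simp: null_sets_def borel01_def)
  have "(LINT x|lborel. indicator A x * L1_fun f x) = (LINT x::real|lborel. 0)"
  proof (rule integral_cong_AE)
    show "AE x in lborel. indicator A x * L1_fun f x = 0" using ae by eventually_elim simp
  qed measurable
  then show ?thesis using Rep_L1_to_M[OF assms(1)] by simp
qed

lemma L1_to_M_X: "L1_to_M (X_L1 f) = X_M (L1_to_M f)"
  by (rule L1_to_M_eqI[OF L1_fun_X mrep_X[OF mrep_L1_to_M]])

lemma lf_of_M_L1_to_M: "lf_of_M (L1_to_M f) = lf_of_L1 f"
proof -
  have "Rep_lfmeas (lf_of_M (L1_to_M f)) A = Rep_lfmeas (lf_of_L1 f) A" for A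
  proof (cases "A \<in> lc_borel01")
    case True
    have "Rep_lfmeas (lf_of_L1 f) A = (LINT t:A|leb01. rep_L1_01 f t)"
      using True by (simp add: lf_of_L1.rep_eq)
    also have "\<dots> = (LINT x|lborel. indicator A x * L1_fun f x)"
      unfolding set_lebesgue_integral_def integral_leb01 L1_fun_def
      by (intro Bochner_Integration.integral_cong) (auto split: split_indicator)
    finally show ?thesis using True by (simp add: Rep_lf_of_M Rep_L1_to_M lc_borel01_subset)
  qed (auto simp: Rep_lf_of_M lfmeas_facts(1)[unfolded cmeasure_on_def])
  then show ?thesis by (simp add: Rep_lfmeas_inject[symmetric] ext)
qed

section \<open>Products in the Volterra algebra\<close>

declare lborel_prod [simp del]

text \<open>On each vertical line the shear is a translation. It turns the double integral in x and
  t = x + y behind f * g into the image of a product measure under addition.\<close>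

lemma distr_shear:
  "distr (lborel \<Otimes>\<^sub>M lborel) (lborel \<Otimes>\<^sub>M lborel) (\<lambda>(x, y). (x, x + y)) = (lborel \<Otimes>\<^sub>M lborel :: (real \<times> real) measure)"
proof -
  let ?L2 = "lborel \<Otimes>\<^sub>M lborel :: (real \<times> real) measure"
  have main: "emeasure (distr ?L2 ?L2 (\<lambda>(x, y). (x, x + y))) S = emeasure ?L2 S" if S[measurable]: "S \<in> sets ?L2" for S
  proof -
  have "emeasure (distr ?L2 ?L2 (\<lambda>(x, y). (x, x + y))) S
    = (\<integral>\<^sup>+q. indicator S q \<partial>distr ?L2 ?L2 (\<lambda>(x, y). (x, x + y)))"
    by (rule nn_integral_indicator[symmetric]) (use S in simp)
  also have "\<dots> = (\<integral>\<^sup>+q. indicator S (case q of (x, y) \<Rightarrow> (x, x + y)) \<partial>?L2)"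
    by (subst nn_integral_distr) auto
  also have "\<dots> = (\<integral>\<^sup>+x. \<integral>\<^sup>+y. indicator S (x, x + y) \<partial>lborel \<partial>lborel)"
    by (subst lborel.nn_integral_fst[symmetric]) auto
  also have "\<dots> = (\<integral>\<^sup>+x. \<integral>\<^sup>+y. indicator S (x, y) \<partial>lborel \<partial>lborel)"
  proof (rule nn_integral_cong)
    fix x :: real
    show "(\<integral>\<^sup>+y. indicator S (x, x + y) \<partial>lborel) = (\<integral>\<^sup>+y. indicator S (x, y) \<partial>lborel)"
      using nn_integral_real_affine[of "\<lambda>y. indicator S (x, y)" 1 x] by simp
  qed
  also have "\<dots> = (\<integral>\<^sup>+q. indicator S q \<partial>?L2)"
    by (subst lborel.nn_integral_fst[symmetric]) auto
  finally show ?thesis using S by simp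
  qed
  show ?thesis by (rule measure_eqI) (auto simp: main)
qed

lemma L1_to_M_times: "L1_to_M (f * g) = L1_to_M f * L1_to_M g"
proof -
  let ?L2 = "lborel \<Otimes>\<^sub>M lborel :: (real \<times> real) measure"
  define F where "F = (\<lambda>(x, t). L1_fun f x * L1_fun g (t - x))"
  define k where "k t = (LINT x|lborel. L1_fun f x * L1_fun g (t - x))" for t
  have [measurable]: "F \<in> borel_measurable ?L2" unfolding F_def by measurable
  have shear[measurable]: "(\<lambda>(x, y). (x, x + y)) \<in> measurable ?L2 ?L2" by measurable
  have comp: "F (case q of (x, y) \<Rightarrow> (x, x + y)) = (case q of (x, y) \<Rightarrow> L1_fun f x * L1_fun g y)" for q
    by (auto simp: F_def split: prod.split)
  have "integrable ?L2 (\<lambda>(x, y). L1_fun f x * L1_fun g y)" by (intro lborel_pair.integrable_times) auto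
  then have "integrable (distr ?L2 ?L2 (\<lambda>(x, y). (x, x + y))) F"
    by (subst integrable_distr_eq) (auto simp: comp)
  then have Fi: "integrable ?L2 F" by (simp add: distr_shear)
  have ki: "integrable lborel k"
    using lborel_pair.integrable_snd[of "\<lambda>x t. L1_fun f x * L1_fun g (t - x)"] Fi by (simp add: F_def k_def[abs_def])
  \<comment> \<open>\<open>L1_fun\<close> vanishes outside [0,1), so for t < 1 the integrand on the
    line is already confined to 0 \<le> s \<le> t.\<close>
  have k_eq: "(LINT s:{0..t}|lborel. rep_L1_01 f s * rep_L1_01 g (t - s)) = k t" if "t \<in> {0..<1}" for t
    unfolding k_def set_lebesgue_integral_def
    using that by (intro Bochner_Integration.integral_cong) (auto simp: L1_fun_def split: split_indicator)
  have k_ind: "integrable lborel (\<lambda>t. indicator {0..<1} t * k t)"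
    using integrable_mult_indicator[of "{0..<1}" lborel k] ki by (simp add: scaleR_indicator)
  define k' where "k' t = (LINT s:{0..t}|lborel. rep_L1_01 f s * rep_L1_01 g (t - s))" for t
  have e: "indicator {0..<1} t * k' t = indicator {0..<1} t * k t" for t
    using k_eq by (auto simp: k'_def split: split_indicator)
  have "integrable leb01 k'" unfolding integrable_leb01 e by (rule k_ind)
  then have ae: "AE x in lborel. L1_fun (f * g) x = indicator {0..<1} x * k x"
    unfolding times_L1_01_def k'_def[symmetric] e[symmetric] by (rule L1_fun_abs')
  show ?thesis
  proof (rule M01_eqI_lc)
    fix A assume "A \<in> lc_borel01"
    then have A: "A \<in> borel01" by (rule lc_borel01_subset)
    note [measurable] = borel01_sets[OF A]
    have [measurable]: "k \<in> borel_measurable borel" using borel_measurable_integrable[OF ki] by simp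
    have "Rep_M01 (L1_to_M (f * g)) A = (LINT t|lborel. indicator A t * k t)"
      unfolding Rep_L1_to_M[OF A]
    proof (rule integral_cong_AE)
      show "AE t in lborel. indicator A t * L1_fun (f * g) t = indicator A t * k t"
        using ae by eventually_elim (use A in \<open>auto simp: borel01_def split: split_indicator\<close>)
    qed measurable
    also have "\<dots> = (LINT t|lborel. LINT x|lborel. indicator A t * (L1_fun f x * L1_fun g (t - x)))"
      unfolding k_def by simp
    also have "\<dots> = (LINT q|?L2. (case q of (x, t) \<Rightarrow> indicator A t * (L1_fun f x * L1_fun g (t - x))))"
    proof (rule lborel_pair.integral_snd)
      show "integrable ?L2 (\<lambda>(x, t). indicator A t * (L1_fun f x * L1_fun g (t - x)))"
      proof (rule Bochner_Integration.integrable_bound[OF Fi])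
        show "(\<lambda>(x, t). indicator A t * (L1_fun f x * L1_fun g (t - x))) \<in> borel_measurable ?L2" by measurable
      qed (auto intro!: AE_I2 simp: F_def norm_mult split: split_indicator)
    qed
    also have "\<dots> = (LINT q|distr ?L2 ?L2 (\<lambda>(x, y). (x, x + y)). (case q of (x, t) \<Rightarrow> indicator A t * (L1_fun f x * L1_fun g (t - x))))"
      by (simp add: distr_shear)
    also have "\<dots> = (LINT q|?L2. indicator A (case q of (x, y) \<Rightarrow> x + y) * (case q of (x, y) \<Rightarrow> L1_fun f x * L1_fun g y))"
      by (subst integral_distr) (auto intro!: Bochner_Integration.integral_cong)
    also have "\<dots> = Rep_M01 (L1_to_M f * L1_to_M g) A"
      by (rule mrepD(3)[OF mrep_times[OF mrep_L1_to_M mrep_L1_to_M] A, symmetric])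
    finally show "Rep_M01 (L1_to_M (f * g)) A = Rep_M01 (L1_to_M f * L1_to_M g) A" .
  qed
qed

section \<open>The derivation on the Volterra algebra\<close>

lemma lf_of_M_D_M:
  assumes m: "lrep \<Lambda> (\<lambda>x. x) u \<mu>" and g: "growth_bound \<Lambda> u C"
  shows "lf_of_M (D_M \<mu> \<nu>) = lf_conv (lf_of_M (X_M \<nu>)) \<mu>"
proof -
  obtain N :: "real measure" and v where r: "mrep N (\<lambda>x. x) v \<nu>" using mrep_canonical by metis
  show ?thesis
    by (rule lrep_unique[OF mrep_lrep[OF mrep_D_M[OF r m g]] lf_conv_lrep[OF mrep_lrep[OF mrep_X[OF r]] m]])
qed

text \<open>With x integrated first, each s meets the translate of A by - s, again a null set. So
  absolutely continuous measures are mapped to absolutely continuous ones, however singular \<mu>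
  is.\<close>

lemma D_M_L1_to_M_null:
  assumes m: "lrep \<Lambda> (\<lambda>x. x) u \<mu>" and g: "growth_bound \<Lambda> u C" and A: "A \<in> borel01" "emeasure lborel A = 0"
  shows "Rep_M01 (D_M \<mu> (L1_to_M f)) A = 0"
proof -
  note d = mrep_D_M[OF mrep_L1_to_M m g, of f]
  interpret P: pair_sigma_finite lborel \<Lambda>
    using m lborel.sigma_finite_measure_axioms by (intro pair_sigma_finite.intro) (auto simp: lrep_def lweight_def)
  note [measurable] = borel01_sets[OF A(1)]
  have "Rep_M01 (D_M \<mu> (L1_to_M f)) A = (LINT z|(lborel \<Otimes>\<^sub>M \<Lambda>). indicator A (case z of (x, s) \<Rightarrow> x + s) * (case z of (x, s) \<Rightarrow> of_real x * L1_fun f x * u s))"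
    by (rule mrepD(3)[OF d A(1)])
  also have "\<dots> = (LINT z|(lborel \<Otimes>\<^sub>M \<Lambda>). (case z of (x, s) \<Rightarrow> indicator A (x + s) * (of_real x * L1_fun f x * u s)))"
    by (simp add: split_beta')
  also have "\<dots> = (LINT s|\<Lambda>. LINT x|lborel. indicator A (x + s) * (of_real x * L1_fun f x * u s))"
    using integrable_borel01[OF mrepD(1,2)[OF d] A(1)] by (subst P.integral_snd) (auto simp: split_beta')
  also have "\<dots> = (LINT s|\<Lambda>. 0)"
  proof (intro Bochner_Integration.integral_cong refl)
    fix s
    have ae: "AE x in lborel. x \<notin> A" using A by (intro AE_not_in) (auto simp: null_sets_def borel01_def)
    have "AE x in lborel. s + 1 * x \<notin> A" by (rule AE_borel_affine[OF _ _ ae]) auto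
    then have z: "AE x in lborel. indicator A (x + s) * (of_real x * L1_fun f x * u s) = 0"
      by eventually_elim (simp add: add.commute)
    have "(LINT x|lborel. indicator A (x + s) * (of_real x * L1_fun f x * u s)) = (LINT x::real|lborel. 0)"
      by (rule integral_cong_AE[OF _ _ z]) measurable
    then show "(LINT x|lborel. indicator A (x + s) * (of_real x * L1_fun f x * u s)) = 0" by simp
  qed
  finally show ?thesis by simp
qed

text \<open>Provides the solution of the description defining \<open>D_L1 \<mu> f\<close> and shows
  that \<open>D_L1 \<mu>\<close> is the restriction of \<open>D_M \<mu>\<close>, from which it
  inherits its algebraic properties.\<close>

lemma L1_to_M_D_L1:
  assumes m: "lrep \<Lambda> (\<lambda>x. x) u \<mu>" and g: "growth_bound \<Lambda> u C"
  shows "L1_to_M (D_L1 \<mu> f) = D_M \<mu> (L1_to_M f)"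
proof -
  obtain h where h: "L1_to_M h = D_M \<mu> (L1_to_M f)" using L1_to_M_range[OF D_M_L1_to_M_null[OF m g]] by metis
  then have "lf_of_L1 h = lf_conv (lf_of_L1 (X_L1 f)) \<mu>"
    using lf_of_M_D_M[OF m g, of "L1_to_M f"] by (simp add: lf_of_M_L1_to_M[symmetric] L1_to_M_X)
  then have "D_L1 \<mu> f = h"
    unfolding D_L1_def by (intro the_equality) (assumption, metis lf_of_M_L1_to_M lf_of_M_inj L1_to_M_inj)
  then show ?thesis using h by simp
qed

lemma derivation_D_L1:
  assumes m: "lrep \<Lambda> (\<lambda>x. x) u \<mu>" and g: "growth_bound \<Lambda> u C"
  shows "derivation (D_L1 \<mu>)"
proof -
  note D = L1_to_M_D_L1[OF m g]
  have M: "D_M \<mu> (x + y) = D_M \<mu> x + D_M \<mu> y" "D_M \<mu> (c *\<^sub>C x) = c *\<^sub>C D_M \<mu> x" "D_M \<mu> (x * y) = D_M \<mu> x * y + x * D_M \<mu> y" for x y c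
    using derivation_D_M[OF m g] by (auto simp: derivation_def clinear_def)
  show ?thesis unfolding derivation_def clinear_def
    by (intro conjI allI; rule L1_to_M_inj) (simp_all add: D L1_to_M_add L1_to_M_scaleC L1_to_M_times M)
qed

section \<open>Continuity of translation in $L^1$\<close>

definition translation_continuous :: "(real \<Rightarrow> complex) \<Rightarrow> bool" where
  "translation_continuous f \<longleftrightarrow> integrable lborel f \<and>
     (\<forall>e>0. \<exists>d>0. \<forall>h. \<bar>h\<bar> < d \<longrightarrow> (LINT x|lborel. cmod (f (h + x) - f x)) < e)"

lemma integrable_translate: "integrable lborel (f :: real \<Rightarrow> complex) \<Longrightarrow> integrable lborel (\<lambda>x. f (h + x))"
  using lborel_integrable_real_affine[of f 1 h] by simp

lemma integral_translate: "(LINT x|lborel. f (h + x)) = (LINT x|lborel. f (x::real) :: real)"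
  using lborel_integral_real_affine[of 1 f h] by simp

text \<open>The three-term estimate; translating f - g does not change its norm.\<close>

lemma translation_continuous_approx:
  assumes f: "integrable lborel f"
    and ap: "\<And>e. e > 0 \<Longrightarrow> \<exists>g. translation_continuous g \<and> (LINT x|lborel. cmod (f x - g x)) < e"
  shows "translation_continuous f"
  unfolding translation_continuous_def
proof (intro conjI allI impI f)
  fix e :: real assume "e > 0"
  then obtain g where g: "translation_continuous g" "(LINT x|lborel. cmod (f x - g x)) < e / 3" using ap[of "e/3"] by auto
  then obtain d where d: "d > 0" "\<And>h. \<bar>h\<bar> < d \<Longrightarrow> (LINT x|lborel. cmod (g (h + x) - g x)) < e / 3"
    using \<open>e > 0\<close> unfolding translation_continuous_def by (meson divide_pos_pos zero_less_numeral)
  have gi: "integrable lborel g" using g by (simp add: translation_continuous_def)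
  note i = integrable_translate[OF f] integrable_translate[OF gi]
  have "(LINT x|lborel. cmod (f (h + x) - f x)) < e" if "\<bar>h\<bar> < d" for h
  proof -
    have "(LINT x|lborel. cmod (f (h + x) - f x))
      \<le> (LINT x|lborel. cmod (f (h + x) - g (h + x)) + (cmod (g (h + x) - g x) + cmod (f x - g x)))"
      using i[of h] f gi
    proof (intro integral_mono)
      fix x
      have "f (h + x) - f x = (f (h + x) - g (h + x)) + ((g (h + x) - g x) - (f x - g x))" by simp
      then show "cmod (f (h + x) - f x) \<le> cmod (f (h + x) - g (h + x)) + (cmod (g (h + x) - g x) + cmod (f x - g x))"
        by (metis norm_triangle_ineq norm_triangle_ineq4 add_left_mono order_trans)
    qed auto
    also have "\<dots> = (LINT x|lborel. cmod (f (h + x) - g (h + x))) + ((LINT x|lborel. cmod (g (h + x) - g x)) + (LINT x|lborel. cmod (f x - g x)))"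
      using i[of h] f gi by simp
    also have "(LINT x|lborel. cmod (f (h + x) - g (h + x))) = (LINT x|lborel. cmod (f x - g x))"
      by (rule integral_translate)
    finally show ?thesis using g(2) d(2)[OF that] by linarith
  qed
  then show "\<exists>d>0. \<forall>h. \<bar>h\<bar> < d \<longrightarrow> (LINT x|lborel. cmod (f (h + x) - f x)) < e" using d(1) by blast
qed

lemma translation_continuous_linear:
  assumes f: "translation_continuous f" and g: "translation_continuous g"
  shows "translation_continuous (\<lambda>x. f x + c * g x)"
  unfolding translation_continuous_def
proof (intro conjI allI impI)
  have i: "integrable lborel f" "integrable lborel g" using f g by (auto simp: translation_continuous_def)
  then show "integrable lborel (\<lambda>x. f x + c * g x)" by simp
  fix e :: real assume e: "e > 0"
  obtain d1 where d1: "d1 > 0" "\<And>h. \<bar>h\<bar> < d1 \<Longrightarrow> (LINT x|lborel. cmod (f (h + x) - f x)) < e / 2"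
    using f e unfolding translation_continuous_def by (meson half_gt_zero)
  \<comment> \<open>The summand 1 allows for c = 0.\<close>
  have "e / (2 * (cmod c + 1)) > 0" using e by (auto simp: add_nonneg_pos)
  then obtain d2 where d2: "d2 > 0" "\<And>h. \<bar>h\<bar> < d2 \<Longrightarrow> (LINT x|lborel. cmod (g (h + x) - g x)) < e / (2 * (cmod c + 1))"
    using g unfolding translation_continuous_def by blast
  have "(LINT x|lborel. cmod (f (h + x) + c * g (h + x) - (f x + c * g x))) < e" if h: "\<bar>h\<bar> < min d1 d2" for h
  proof -
    note ih = integrable_translate[OF i(1), of h] integrable_translate[OF i(2), of h]
    have "(LINT x|lborel. cmod (f (h + x) + c * g (h + x) - (f x + c * g x)))
      \<le> (LINT x|lborel. cmod (f (h + x) - f x) + cmod c * cmod (g (h + x) - g x))"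
      using i ih
    proof (intro integral_mono)
      fix x
      have "f (h + x) + c * g (h + x) - (f x + c * g x) = (f (h + x) - f x) + c * (g (h + x) - g x)" by (simp add: algebra_simps)
      then show "cmod (f (h + x) + c * g (h + x) - (f x + c * g x)) \<le> cmod (f (h + x) - f x) + cmod c * cmod (g (h + x) - g x)"
        by (metis norm_mult norm_triangle_ineq)
    qed auto
    also have "\<dots> = (LINT x|lborel. cmod (f (h + x) - f x)) + cmod c * (LINT x|lborel. cmod (g (h + x) - g x))"
      using i ih by simp
    also have "\<dots> < e / 2 + e / 2"
    proof (rule add_less_le_mono)
      have "cmod c * (LINT x|lborel. cmod (g (h + x) - g x)) \<le> (cmod c + 1) * (e / (2 * (cmod c + 1)))"
        using d2(2)[of h] h by (intro mult_mono) auto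
      also have "\<dots> = e / 2"
      proof -
        have "k * (e / (2 * k)) = e / 2" if "k \<noteq> 0" for k :: real using that by simp
        moreover have "cmod c + 1 \<noteq> 0" by (smt (verit) norm_ge_zero)
        ultimately show ?thesis by blast
      qed
      finally show "cmod c * (LINT x|lborel. cmod (g (h + x) - g x)) \<le> e / 2" .
    qed (use d1(2)[of h] h in auto)
    finally show ?thesis by simp
  qed
  then show "\<exists>d>0. \<forall>h. \<bar>h\<bar> < d \<longrightarrow> (LINT x|lborel. cmod (f (h + x) + c * g (h + x) - (f x + c * g x))) < e"
    using d1(1) d2(1) by (intro exI[of _ "min d1 d2"]) auto
qed

lemma translation_continuous_zero: "translation_continuous (\<lambda>x. 0)"
  by (auto simp: translation_continuous_def intro!: exI[of _ 1])

text \<open>Dominated convergence turns pointwise limits into L^1 limits. This serves countable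
  unions, the exhaustion of a set by bounded pieces, and simple approximations.\<close>

lemma translation_continuous_lim:
  assumes s: "\<And>i. translation_continuous (s i)" and f: "f \<in> borel_measurable borel"
    and lim: "\<And>x. (\<lambda>i. s i x) \<longlonglongrightarrow> f x" and w: "integrable lborel w" "\<And>i x. cmod (s i x) \<le> w x"
  shows "translation_continuous f"
proof -
  have si: "integrable lborel (s i)" for i using s by (simp add: translation_continuous_def)
  then have sm: "s i \<in> borel_measurable borel" for i using borel_measurable_integrable[of lborel "s i"] by simp
  have fw: "cmod (f x) \<le> w x" for x
    by (rule tendsto_upperbound[OF tendsto_norm[OF lim]]) (auto simp: w(2))
  have fi: "integrable lborel f"
    by (rule Bochner_Integration.integrable_bound[OF w(1)]) (use f fw in \<open>auto intro: order_trans[OF _ abs_ge_self]\<close>)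
  have "(\<lambda>i. LINT x|lborel. cmod (f x - s i x)) \<longlonglongrightarrow> (LINT (x::real)|lborel. 0)"
  proof (rule integral_dominated_convergence)
    show "integrable lborel (\<lambda>x. 2 * w x)" using w by simp
    show "AE x in lborel. (\<lambda>i. cmod (f x - s i x)) \<longlonglongrightarrow> 0"
      using lim by (intro AE_I2) (auto intro!: tendsto_eq_intros)
    show "AE x in lborel. norm (cmod (f x - s i x)) \<le> 2 * w x" for i
    proof (intro AE_I2)
      fix x have "cmod (f x - s i x) \<le> cmod (f x) + cmod (s i x)" by (rule norm_triangle_ineq4)
      then show "norm (cmod (f x - s i x)) \<le> 2 * w x" using fw[of x] w(2)[of i x] by simp
    qed
  qed (use f sm in auto)
  then have l: "(\<lambda>i. LINT x|lborel. cmod (f x - s i x)) \<longlonglongrightarrow> 0" by simp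
  show ?thesis
  proof (rule translation_continuous_approx[OF fi])
    fix e :: real assume "e > 0"
    then have "eventually (\<lambda>i. (LINT x|lborel. cmod (f x - s i x)) < e) sequentially"
      using l by (rule order_tendstoD(2)[rotated])
    then show "\<exists>g. translation_continuous g \<and> (LINT x|lborel. cmod (f x - g x)) < e"
      using s by (auto simp: eventually_sequentially)
  qed
qed

lemma translation_continuous_Ico: "translation_continuous (indicator {a..<b::real})"
proof -
  have i: "integrable lborel (indicator {a..<b} :: real \<Rightarrow> complex)"
  proof -
    have "emeasure lborel {a..<b} < \<infinity>" by (cases "a \<le> b") auto
    then have "integrable lborel (\<lambda>x. complex_of_real (indicator {a..<b} x))"
      by (intro integrable_of_real integrable_real_indicator) auto
    then show ?thesis by (simp add: of_real_indicator)
  qed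
  have le: "(LINT x|lborel. cmod (indicator {a..<b} (h + x) - indicator {a..<b} x)) \<le> 4 * \<bar>h\<bar>" for h
  proof -
    \<comment> \<open>The two indicators differ only where an endpoint lies within |h| of x; two
      intervals of length 2 |h| give the factor 4.\<close>
    let ?A = "{a - \<bar>h\<bar>..a + \<bar>h\<bar>}" and ?B = "{b - \<bar>h\<bar>..b + \<bar>h\<bar>}"
    have "(LINT x|lborel. cmod (indicator {a..<b} (h + x) - indicator {a..<b} x)) \<le> (LINT x|lborel. indicator ?A x + indicator ?B x)"
    proof (rule integral_mono)
      show "integrable lborel (\<lambda>x. cmod (indicator {a..<b} (h + x) - indicator {a..<b} x))"
        using i integrable_translate[OF i, of h] by simp
      show "integrable lborel (\<lambda>x. indicator ?A x + indicator ?B x :: real)" by (intro Bochner_Integration.integrable_add integrable_real_indicator) auto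
      show "cmod (indicator {a..<b} (h + x) - indicator {a..<b} x) \<le> indicator ?A x + indicator ?B x" for x
        by (auto simp: indicator_def)
    qed
    also have "\<dots> = (LINT x|lborel. indicator ?A x) + (LINT x|lborel. indicator ?B x)"
      by (intro Bochner_Integration.integral_add integrable_real_indicator) auto
    also have "\<dots> = 4 * \<bar>h\<bar>" by simp
    finally show ?thesis .
  qed
  show ?thesis
    unfolding translation_continuous_def
  proof (intro conjI allI impI i)
    fix e :: real assume "e > 0"
    have "(LINT x|lborel. cmod (indicator {a..<b} (h + x) - indicator {a..<b} x)) < e" if "\<bar>h\<bar> < e / 4" for h
      using le[of h] that by linarith
    then show "\<exists>d>0. \<forall>h. \<bar>h\<bar> < d \<longrightarrow> (LINT x|lborel. cmod (indicator {a..<b} (h + x) - indicator {a..<b} x)) < e"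
      using \<open>e > 0\<close> by (intro exI[of _ "e / 4"]) auto
  qed
qed

text \<open>Dynkin's argument again; cutting with [-n,n) keeps complements integrable.\<close>

lemma translation_continuous_indicator:
  assumes "A \<in> sets borel" shows "translation_continuous (indicator (A \<inter> {- real n..<real n}))"
proof -
  let ?I = "{- real n..<real n}"
  have borel: "sets (borel :: real measure) = sigma_sets UNIV (range lessThan)"
    by (subst borel_Iio) (simp add: sets_measure_of_conv)
  have stable: "Int_stable (range (lessThan :: real \<Rightarrow> _))"
  proof (rule Int_stableI_image)
    fix x y :: real
    show "\<exists>z\<in>UNIV. {..<x} \<inter> {..<y} = {..<z}" by (intro bexI[of _ "min x y"]) auto
  qed
  have sub: "range (lessThan :: real \<Rightarrow> _) \<subseteq> Pow UNIV" by auto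
  show ?thesis
    using stable sub assms[unfolded borel]
  proof (induction rule: sigma_sets_induct_disjoint)
    case (basic B)
    then obtain b where "B = {..<b}" by auto
    then have "B \<inter> ?I = {- real n..<min b (real n)}" by auto
    then show ?case using translation_continuous_Ico by metis
  next
    case empty
    show ?case using translation_continuous_zero by (simp add: indicator_def[abs_def])
  next
    case (compl B)
    have "indicator ((UNIV - B) \<inter> ?I) = (\<lambda>x. indicator ?I x + (-1) * indicator (B \<inter> ?I) x :: complex)"
      by (auto simp: indicator_def)
    then show ?case using translation_continuous_linear[OF translation_continuous_Ico compl(2), of "- real n" "real n" "-1"] by simp
  next
    case (union F)
    have F[measurable]: "F i \<in> sets borel" for i using union(2) by (auto simp: borel)
    have fin: "translation_continuous (\<lambda>x. \<Sum>i<k. indicator (F i \<inter> ?I) x)" for k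
    proof (induction k)
      case (Suc k)
      show ?case using translation_continuous_linear[OF Suc union(3), of 1 k] by simp
    qed (use translation_continuous_zero in simp)
    have eq: "(\<Sum>i<k. indicator (F i \<inter> ?I) x) = (indicator (\<Union>i<k. F i \<inter> ?I) x :: complex)" for k x
      using union(1) by (intro indicator_UN_disjoint[symmetric]) (auto simp: disjoint_family_on_def)
    show ?case
    proof (rule translation_continuous_lim[OF fin])
      show "(indicator (\<Union> (range F) \<inter> ?I) :: real \<Rightarrow> complex) \<in> borel_measurable borel" by measurable
      have e: "\<Union> (range F) \<inter> ?I = (\<Union>i. F i \<inter> ?I)" by auto
      show "(\<lambda>k. \<Sum>i<k. indicator (F i \<inter> ?I) x) \<longlonglongrightarrow> (indicator (\<Union> (range F) \<inter> ?I) x :: complex)" for x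
        unfolding eq e by (rule LIMSEQ_indicator_UN)
      show "integrable lborel (indicator ?I :: real \<Rightarrow> real)" by (rule integrable_real_indicator) auto
      show "cmod (\<Sum>i<k. indicator (F i \<inter> ?I) x) \<le> indicator ?I x" for k x
        unfolding eq by (auto split: split_indicator)
    qed
  qed
qed

lemma translation_continuousI:
  assumes "integrable lborel f" shows "translation_continuous f"
  using assms
proof (induction rule: integrable_induct)
  case (base A c)
  then have [measurable]: "A \<in> sets borel" by simp
  have "translation_continuous (\<lambda>x. indicator A x)"
  proof (rule translation_continuous_lim[OF translation_continuous_indicator])
    show "integrable lborel (indicator A :: real \<Rightarrow> real)" using base by (intro integrable_real_indicator) auto
    show "(\<lambda>n. indicator (A \<inter> {- real n..<real n}) x) \<longlonglongrightarrow> (indicator A x :: complex)" for x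
    proof (rule tendsto_eventually)
      obtain N where N: "\<bar>x\<bar> < real N" using reals_Archimedean2 by blast
      have "indicator (A \<inter> {- real n..<real n}) x = (indicator A x :: complex)" if "N \<le> n" for n
      proof -
        have "\<bar>x\<bar> < real n" using N that by (meson less_le_trans of_nat_le_iff)
        then have "x \<in> {- real n..<real n}" by auto
        then show ?thesis by (simp add: indicator_def)
      qed
      then show "\<forall>\<^sub>F n in sequentially. indicator (A \<inter> {- real n..<real n}) x = (indicator A x :: complex)"
        by (auto simp: eventually_sequentially)
    qed
  qed (auto split: split_indicator)
  from translation_continuous_linear[OF translation_continuous_zero this, of c]
  show ?case by (simp add: scaleR_conv_of_real of_real_indicator mult.commute)
next
  case (add f g)
  then show ?case using translation_continuous_linear[of f g 1] by simp
next
  case (lim f s)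
  show ?case
    by (rule translation_continuous_lim[OF lim(5) _ lim(2) _ lim(3)]) (use lim in auto)
qed

section \<open>Completeness of the measure algebra\<close>

lemma norm_M01_leI:
  assumes "0 \<le> c" and "\<And>P. finite P \<Longrightarrow> disjoint P \<Longrightarrow> P \<subseteq> sets borel \<Longrightarrow> \<Union>P \<subseteq> {0..<1} \<Longrightarrow> (\<Sum>B\<in>P. cmod (Rep_M01 m B)) \<le> c"
  shows "norm m \<le> c"
proof -
  have "variation (Rep_M01 m) {0..<1} \<le> ennreal c"
    unfolding variation_def by (rule SUP_least) (use assms(2) in \<open>auto intro!: ennreal_leI\<close>)
  then show ?thesis unfolding norm_M01.rep_eq using assms(1) by (simp add: enn2real_leI)
qed

lemma sum_le_norm_M01:
  assumes "finite P" "disjoint P" "P \<subseteq> sets borel" "\<Union>P \<subseteq> {0..<1}"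
  shows "(\<Sum>B\<in>P. cmod (Rep_M01 m B)) \<le> norm m"
proof -
  have "ennreal (\<Sum>B\<in>P. cmod (Rep_M01 m B)) \<le> variation (Rep_M01 m) {0..<1}"
    unfolding variation_def by (rule SUP_upper2[of P]) (use assms in auto)
  also have "\<dots> = ennreal (norm m)" using M01_facts(2)[of m] by (simp add: norm_M01.rep_eq)
  finally show ?thesis by simp
qed

lemma Rep_M01_empty: "Rep_M01 m {} = 0"
  using signed_on_empty[OF borel01_ring_borel01 cmeasure_signed(1)[OF M01_facts(1)]] signed_on_empty[OF borel01_ring_borel01 cmeasure_signed(2)[OF M01_facts(1)]]
  by (simp add: complex_eq_iff)

lemma sum_family_le_norm_M01:
  assumes "finite I" "disjoint_family_on A I" "\<And>i. i \<in> I \<Longrightarrow> A i \<in> borel01"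
  shows "(\<Sum>i\<in>I. cmod (Rep_M01 m (A i))) \<le> norm m"
proof -
  have "(\<Sum>i\<in>I. cmod (Rep_M01 m (A i))) = (\<Sum>B\<in>A ` I. cmod (Rep_M01 m B))"
  proof (rule sum.reindex_nontrivial[symmetric, unfolded o_def])
    fix i j assume "i \<in> I" "j \<in> I" "i \<noteq> j" "A i = A j"
    then have "A i = {}" using assms(2) by (fastforce simp: disjoint_family_on_def)
    then show "cmod (Rep_M01 m (A i)) = 0" by (simp add: Rep_M01_empty)
  qed (rule assms)
  also have "\<dots> \<le> norm m"
    using assms by (intro sum_le_norm_M01 disjoint_family_on_disjoint_image) (auto simp: borel01_def)
  finally show ?thesis .
qed

text \<open>The candidate is the setwise limit. Letting n tend to infinity in the estimate for
  finite disjoint families makes the convergence uniform over all such families, which yields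
  countable additivity, finite variation and convergence in norm. Completeness turns total
  boundedness into compactness of the closure.\<close>

instance M01 :: complete_space
proof
  fix X :: "nat \<Rightarrow> M01" assume X: "Cauchy X"
  define r where "r n = Rep_M01 (X n)" for n
  have diff: "r n A - r k A = Rep_M01 (X n - X k) A" for n k A by (simp add: r_def Rep_M01_ops)
  have N: "\<exists>N. \<forall>n\<ge>N. \<forall>k\<ge>N. norm (X n - X k) < e" if "e > 0" for e
    using X that unfolding Cauchy_def dist_norm by blast
  have "Cauchy (\<lambda>n. r n A)" for A
    unfolding Cauchy_def dist_norm diff using N Rep_M01_le_norm by (meson le_less_trans)
  then have "\<exists>l. (\<lambda>n. r n A) \<longlonglongrightarrow> l" for A using Cauchy_convergent_iff convergent_def by blast
  then obtain L where L: "\<And>A. (\<lambda>n. r n A) \<longlonglongrightarrow> L A" by metis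
  have sumle: "(\<Sum>i\<in>I. cmod (L (A i) - r k (A i))) \<le> e"
    if "\<forall>n\<ge>N. \<forall>k\<ge>N. norm (X n - X k) < e" "k \<ge> N" "finite I" "disjoint_family_on A I" "\<And>i. i \<in> I \<Longrightarrow> A i \<in> borel01"
    for I :: "'i set" and A k e N
  proof (rule tendsto_upperbound)
    show "(\<lambda>n. \<Sum>i\<in>I. cmod (r n (A i) - r k (A i))) \<longlonglongrightarrow> (\<Sum>i\<in>I. cmod (L (A i) - r k (A i)))"
      by (intro tendsto_intros L)
    have "(\<Sum>i\<in>I. cmod (r n (A i) - r k (A i))) \<le> e" if "n \<ge> N" for n
      using sum_family_le_norm_M01[of I A "X n - X k"] that \<open>\<forall>n\<ge>N. _\<close> \<open>k \<ge> N\<close> \<open>finite I\<close> \<open>disjoint_family_on A I\<close> \<open>\<And>i. i \<in> I \<Longrightarrow> A i \<in> borel01\<close>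
      unfolding diff by (meson less_imp_le order_trans)
    then show "\<forall>\<^sub>F n in sequentially. (\<Sum>i\<in>I. cmod (r n (A i) - r k (A i))) \<le> e" by (auto simp: eventually_sequentially)
  qed simp
  have cm: "cmeasure_on borel01 L"
    unfolding cmeasure_on_def
  proof (intro conjI allI impI)
    fix A assume "A \<notin> borel01"
    then have "r n A = 0" for n using M01_facts(1)[of "X n"] by (simp add: r_def cmeasure_on_def)
    then show "L A = 0" using L[of A] by (simp add: LIMSEQ_const_iff)
  next
    fix A :: "nat \<Rightarrow> real set" assume A: "range A \<subseteq> borel01" "disjoint_family A" "(\<Union>i. A i) \<in> borel01"
    show "(\<lambda>i. L (A i)) sums L (\<Union>i. A i)"
      unfolding sums_def
    proof (rule LIMSEQ_I)
      fix e :: real assume "e > 0"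
      then obtain N where N: "\<forall>n\<ge>N. \<forall>k\<ge>N. norm (X n - X k) < e / 3" using N[of "e/3"] by auto
      have "(\<lambda>i. r N (A i)) sums r N (\<Union>i. A i)" using M01_facts(1)[of "X N"] A unfolding cmeasure_on_def r_def by blast
      then obtain K where K: "\<And>k. k \<ge> K \<Longrightarrow> cmod ((\<Sum>i<k. r N (A i)) - r N (\<Union>i. A i)) < e / 3"
        unfolding sums_def using LIMSEQ_D[of _ _ "e/3"] \<open>e > 0\<close> by (metis divide_pos_pos zero_less_numeral)
      have "cmod ((\<Sum>i<k. L (A i)) - L (\<Union>i. A i)) < e" if "k \<ge> K" for k
      proof -
        have "(\<Sum>i<k. L (A i)) - L (\<Union>i. A i) = (\<Sum>i<k. L (A i) - r N (A i)) + (((\<Sum>i<k. r N (A i)) - r N (\<Union>i. A i)) - (L (\<Union>i. A i) - r N (\<Union>i. A i)))"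
          by (simp add: sum_subtractf)
        also have "cmod \<dots> \<le> cmod (\<Sum>i<k. L (A i) - r N (A i)) + (cmod ((\<Sum>i<k. r N (A i)) - r N (\<Union>i. A i)) + cmod (L (\<Union>i. A i) - r N (\<Union>i. A i)))"
          by (rule order_trans[OF norm_triangle_ineq add_left_mono[OF norm_triangle_ineq4]])
        also have "\<dots> < e"
        proof -
          have "cmod (\<Sum>i<k. L (A i) - r N (A i)) \<le> (\<Sum>i<k. cmod (L (A i) - r N (A i)))" by (rule norm_sum)
          also have "\<dots> \<le> e / 3" using A by (intro sumle[OF N]) (auto intro: disjoint_family_on_mono)
          finally have "cmod (\<Sum>i<k. L (A i) - r N (A i)) \<le> e / 3" .
          moreover have "cmod ((\<Sum>i<k. r N (A i)) - r N (\<Union>i. A i)) < e / 3" by (rule K[OF that])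
          \<comment> \<open>A family with one member, the whole union.\<close>
          moreover have "(\<Sum>i\<in>{()}. cmod (L (\<Union>i. A i) - r N (\<Union>i. A i))) \<le> e / 3"
            using A by (intro sumle[OF N]) (auto simp: disjoint_family_on_def)
          then have "cmod (L (\<Union>i. A i) - r N (\<Union>i. A i)) \<le> e / 3" by simp
          ultimately show ?thesis by linarith
        qed
        finally show ?thesis .
      qed
      then show "\<exists>no. \<forall>n\<ge>no. cmod ((\<Sum>i<n. L (A i)) - L (\<Union>i. A i)) < e" by blast
    qed
  qed
  have P_le: "(\<Sum>B\<in>P. cmod (L B - r k B)) \<le> e"
    if "\<forall>n\<ge>N. \<forall>k\<ge>N. norm (X n - X k) < e" "k \<ge> N" "finite P" "disjoint P" "P \<subseteq> sets borel" "\<Union>P \<subseteq> {0..<1}" for P :: "real set set" and k e N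
    using that by (intro sumle[OF that(1,2), of P "\<lambda>B. B"]) (auto simp: disjoint_family_on_def disjoint_def borel01_def)
  have "variation L {0..<1} < \<infinity>"
  proof -
    obtain N where N: "\<forall>n\<ge>N. \<forall>k\<ge>N. norm (X n - X k) < 1" using N[of 1] by auto
    have "variation L {0..<1} \<le> ennreal (1 + norm (X N))"
      unfolding variation_def
    proof (rule SUP_least)
      fix P :: "real set set" assume P: "P \<in> {P. finite P \<and> disjoint P \<and> P \<subseteq> sets borel \<and> \<Union>P \<subseteq> {0..<1}}"
      have "(\<Sum>B\<in>P. cmod (L B)) \<le> (\<Sum>B\<in>P. cmod (L B - r N B) + cmod (r N B))"
        by (intro sum_mono) (metis add.commute diff_add_cancel norm_triangle_ineq)
      also have "\<dots> = (\<Sum>B\<in>P. cmod (L B - r N B)) + (\<Sum>B\<in>P. cmod (r N B))" by (rule sum.distrib)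
      also have "\<dots> \<le> 1 + norm (X N)" using P P_le[OF N, of N P] sum_le_norm_M01[of P "X N"] unfolding r_def by (intro add_mono) auto
      finally have "ennreal (\<Sum>B\<in>P. cmod (L B)) \<le> ennreal (1 + norm (X N))" by (rule ennreal_leI)
      then show "(\<Sum>B\<in>P. ennreal (cmod (L B))) \<le> ennreal (1 + norm (X N))" by (subst sum_ennreal) auto
    qed
    then show ?thesis by (rule le_less_trans) simp
  qed
  with cm have l: "Rep_M01 (Abs_M01 L) = L" by (intro Abs_M01_inverse) simp
  have "X \<longlonglongrightarrow> Abs_M01 L"
  proof (rule LIMSEQ_I)
    fix e :: real assume "e > 0"
    then obtain N where N: "\<forall>n\<ge>N. \<forall>k\<ge>N. norm (X n - X k) < e / 2" using N[of "e/2"] by auto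
    have "norm (X n - Abs_M01 L) < e" if "n \<ge> N" for n
    proof -
      have "norm (Abs_M01 L - X n) \<le> e / 2"
        by (rule norm_M01_leI) (use \<open>e > 0\<close> P_le[OF N that] in \<open>auto simp: Rep_M01_ops l r_def\<close>)
      then show ?thesis using \<open>e > 0\<close> by (simp add: norm_minus_commute)
    qed
    then show "\<exists>no. \<forall>n\<ge>no. norm (X n - Abs_M01 L) < e" by blast
  qed
  then show "convergent X" by (auto simp: convergent_def)
qed

section \<open>Relatively compact sets of measures\<close>

lemma bounded_bilinear_scaleC:
  "bounded_bilinear (\<lambda>c (x :: 'a :: complex_normed_vector). c *\<^sub>C x)"
proof
  fix r :: real and a b :: complex and x y :: 'a
  show "(a + b) *\<^sub>C x = a *\<^sub>C x + b *\<^sub>C x" by (rule scaleC_add_left)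
  show "a *\<^sub>C (x + y) = a *\<^sub>C x + a *\<^sub>C y" by (rule scaleC_add_right)
  show "(r *\<^sub>R a) *\<^sub>C x = r *\<^sub>R a *\<^sub>C x" by (simp add: scaleC_of_real[symmetric] scaleC_scaleC scaleR_conv_of_real)
  show "a *\<^sub>C r *\<^sub>R x = r *\<^sub>R a *\<^sub>C x" by (simp add: scaleC_of_real[symmetric] scaleC_scaleC mult.commute)
  show "\<exists>K. \<forall>a (x::'a). norm (a *\<^sub>C x) \<le> norm a * norm x * K" by (auto simp: norm_scaleC intro!: exI[of _ 1])
qed

text \<open>Contains the images of the unit ball under the operators of finite rank below. It is a
  continuous image of a product of discs, built up one coordinate at a time.\<close>

lemma compact_combinations:
  fixes y :: "nat \<Rightarrow> 'a :: complex_normed_vector"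
  shows "compact {(\<Sum>j<n. c j *\<^sub>C y j) | c. \<forall>j. c j \<in> cball 0 1}"
proof (induction n)
  case 0
  have "{(\<Sum>j<0::nat. c j *\<^sub>C y j) | c. \<forall>j. c j \<in> cball 0 1} = {0}" by (auto intro!: exI[of _ "\<lambda>_. 0"])
  then show ?case by simp
next
  case (Suc n)
  let ?S = "\<lambda>n. {(\<Sum>j<n. c j *\<^sub>C y j) | c. \<forall>j. c j \<in> cball (0::complex) 1}"
  have "?S (Suc n) = (\<lambda>(x, c). x + c *\<^sub>C y n) ` (?S n \<times> cball 0 1)"
  proof (intro equalityI subsetI)
    fix z assume "z \<in> ?S (Suc n)"
    then obtain c where "z = (\<Sum>j<Suc n. c j *\<^sub>C y j)" "\<forall>j. c j \<in> cball 0 1" by blast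
    then show "z \<in> (\<lambda>(x, c). x + c *\<^sub>C y n) ` (?S n \<times> cball 0 1)"
      by (intro image_eqI[of _ _ "(\<Sum>j<n. c j *\<^sub>C y j, c n)"]) auto
  next
    fix z assume "z \<in> (\<lambda>(x, c). x + c *\<^sub>C y n) ` (?S n \<times> cball 0 1)"
    then obtain c d where z: "z = (\<Sum>j<n. c j *\<^sub>C y j) + d *\<^sub>C y n" "\<forall>j. c j \<in> cball 0 1" "d \<in> cball 0 1" by auto
    have "(\<Sum>j<n. (c(n := d)) j *\<^sub>C y j) = (\<Sum>j<n. c j *\<^sub>C y j)" by (intro sum.cong) auto
    then have "z = (\<Sum>j<Suc n. (c(n := d)) j *\<^sub>C y j)" using z by simp
    moreover have "\<forall>j. (c(n := d)) j \<in> cball 0 1" using z by simp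
    ultimately show "z \<in> ?S (Suc n)" by blast
  qed
  moreover have "continuous_on (?S n \<times> cball 0 1) (\<lambda>(x, c). x + c *\<^sub>C y n)"
    unfolding split_beta'
    by (intro continuous_on_add continuous_on_fst continuous_on_snd continuous_on_id continuous_on_const
        bounded_bilinear.continuous_on[OF bounded_bilinear_scaleC])
  ultimately show ?case using compact_continuous_image[OF _ compact_Times[OF Suc compact_cball]] by simp
qed

text \<open>The form in which norm limits of operators of finite rank are seen to be compact:
  uniform approximation by compact sets gives total boundedness.\<close>

lemma compact_closure_approx:
  fixes S :: "'a :: {real_normed_vector, complete_space} set"
  assumes "\<And>e. e > 0 \<Longrightarrow> \<exists>K. compact K \<and> (\<forall>x\<in>S. \<exists>y\<in>K. norm (x - y) \<le> e)"
  shows "compact (closure S)"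
  unfolding compact_eq_totally_bounded
proof (intro conjI allI impI)
  show "complete (closure S)" by (simp add: complete_eq_closed)
  fix e :: real assume "e > 0"
  \<comment> \<open>Three distances of at most e/4 stay below e: from a limit point to S, from S to
    K, from K to the finite net.\<close>
  then obtain K where K: "compact K" "\<And>x. x \<in> S \<Longrightarrow> \<exists>y\<in>K. norm (x - y) \<le> e / 4" using assms[of "e/4"] by auto
  then obtain k where k: "finite k" "K \<subseteq> (\<Union>x\<in>k. ball x (e / 4))"
    using \<open>e > 0\<close> unfolding compact_eq_totally_bounded by (metis divide_pos_pos zero_less_numeral)
  have "x \<in> (\<Union>x\<in>k. ball x e)" if x: "x \<in> closure S" for x
  proof -
    obtain z where z: "z \<in> S" "dist z x < e / 4" using x \<open>e > 0\<close> by (metis closure_approachable divide_pos_pos zero_less_numeral)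
    obtain y where y: "y \<in> K" "dist z y \<le> e / 4" using K(2)[OF z(1)] by (auto simp: dist_norm)
    obtain c where c: "c \<in> k" "dist c y < e / 4" using k(2) y(1) by auto
    have "dist c x \<le> dist c y + dist y z + dist z x" by (metis add_right_mono dist_triangle order_trans)
    then have "dist c x < e" using z y c \<open>e > 0\<close> by (simp add: dist_commute)
    then show ?thesis using c by auto
  qed
  then show "\<exists>k. finite k \<and> closure S \<subseteq> (\<Union>x\<in>k. ball x e)" using k(1) by blast
qed

section \<open>The measures $t\,\delta_t * \mu$\<close>

lemma TV_nonneg: "0 \<le> total_variation \<mu> A"
  by (simp add: total_variation.rep_eq)

text \<open>For t > 0 the set [0,1-t) lies in the compact interval [0,1-t], so
  \<open>enn2real\<close> loses nothing.\<close>

lemma variation_TV: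
  assumes "0 < t" shows "variation (Rep_lfmeas \<mu>) {0..<1 - t} = ennreal (total_variation \<mu> {0..<1 - t})"
proof -
  have "variation (Rep_lfmeas \<mu>) {0..<1 - t} \<le> variation (Rep_lfmeas \<mu>) {0..1 - t}" by (rule variation_mono) auto
  also have "\<dots> < \<infinity>" using assms by (intro lfmeas_facts(2)) simp
  finally show ?thesis by (simp add: total_variation.rep_eq)
qed

text \<open>\<Lambda> is left open: a dominating measure of \<mu> when (c) is to be derived,
  Lebesgue measure in \<open>growth_ac\<close> when (c) is given.\<close>

locale growth =
  fixes \<mu> :: lfmeas and \<Lambda> :: "real measure" and u :: "real \<Rightarrow> complex" and C :: real
  assumes sets_L: "sets \<Lambda> = sets borel" and rep: "lrep \<Lambda> (\<lambda>x. x) u \<mu>" and u_meas: "u \<in> borel_measurable borel"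
    and u_out: "\<And>x. x \<notin> {0..<1} \<Longrightarrow> u x = 0" and bound: "growth_bound \<Lambda> u C"
    and u_var: "\<And>A. A \<in> borel01 \<Longrightarrow> (\<integral>\<^sup>+x. ennreal (cmod (u x)) * indicator A x \<partial>\<Lambda>) \<le> 4 * variation (Rep_lfmeas \<mu>) A"
begin

lemma u_measL[measurable]: "u \<in> borel_measurable \<Lambda>" using u_meas sets_L by (simp cong: measurable_cong_sets)

lemma id_measL[measurable]: "(\<lambda>x. x) \<in> borel_measurable \<Lambda>" using sets_L by (simp cong: measurable_cong_sets)

lemma sfL: "sigma_finite_measure \<Lambda>" using rep by (auto simp: lrep_def lweight_def)

text \<open>Up to the factor 4 bounded by |\<mu>|([0,1-t)). At t = 0 it may be infinite, but 0 times
  infinity is 0 in \<open>ennreal\<close>, which is how \<open>Phi 0 = 0\<close> comes out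
  below.\<close>

definition mass :: "real \<Rightarrow> ennreal" where
  "mass t = (\<integral>\<^sup>+s. indicator {0..<1} (t + s) * ennreal (cmod (u s)) \<partial>\<Lambda>)"

lemma mass_bound: "t \<in> {0..1} \<Longrightarrow> ennreal t * mass t \<le> ennreal C"
proof (cases "t = 1")
  case True
  have "mass 1 = (\<integral>\<^sup>+s. 0 \<partial>\<Lambda>)" unfolding mass_def using u_out by (intro nn_integral_cong) (auto split: split_indicator)
  then show ?thesis using True by simp
qed (use bound in \<open>auto simp: growth_bound_def mass_def\<close>)

lemma mass_variation: "0 < t \<Longrightarrow> t < 1 \<Longrightarrow> mass t \<le> 4 * variation (Rep_lfmeas \<mu>) {0..<1 - t}"
proof -
  assume t: "0 < t" "t < 1"
  have "mass t = (\<integral>\<^sup>+s. ennreal (cmod (u s)) * indicator {0..<1 - t} s \<partial>\<Lambda>)"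
    unfolding mass_def using u_out t by (intro nn_integral_cong) (auto split: split_indicator)
  also have "\<dots> \<le> 4 * variation (Rep_lfmeas \<mu>) {0..<1 - t}" using t by (intro u_var) (auto simp: borel01_def)
  finally show ?thesis .
qed

lemma Phi_exists:
  assumes t: "t \<in> {0..1}" shows "\<exists>m. mrep \<Lambda> (\<lambda>s. t + s) (\<lambda>s. of_real t * u s) m"
proof (rule mrep_exists)
  show i: "integrable \<Lambda> (\<lambda>s. indicator {0..<1} (t + s) * (of_real t * u s))"
  proof (rule integrableI_bounded)
    have "(\<integral>\<^sup>+s. ennreal (norm (indicator {0..<1} (t + s) * (of_real t * u s))) \<partial>\<Lambda>) = (\<integral>\<^sup>+s. ennreal t * (indicator {0..<1} (t + s) * ennreal (cmod (u s))) \<partial>\<Lambda>)"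
      using t by (intro nn_integral_cong) (auto simp: norm_mult ennreal_mult split: split_indicator)
    also have "\<dots> = ennreal t * mass t" unfolding mass_def by (intro nn_integral_cmult) measurable
    also have "\<dots> < \<infinity>" using mass_bound[OF t] by (rule le_less_trans) simp
    finally show "(\<integral>\<^sup>+s. ennreal (norm (indicator {0..<1} (t + s) * (of_real t * u s))) \<partial>\<Lambda>) < \<infinity>" .
  qed measurable
  show "lweight \<Lambda> (\<lambda>s. t + s) (\<lambda>s. of_real t * u s)"
    unfolding lweight_def
  proof (intro conjI allI impI ballI sfL)
    fix a :: real assume "a < 1"
    show "integrable \<Lambda> (\<lambda>s. indicator {0..a} (t + s) * (of_real t * u s))"
    proof (rule Bochner_Integration.integrable_bound[OF i])
      show "AE s in \<Lambda>. norm (indicator {0..a} (t + s) * (of_real t * u s)) \<le> norm (indicator {0..<1} (t + s) * (of_real t * u s))"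
        using \<open>a < 1\<close> by (intro AE_I2) (auto split: split_indicator)
    qed measurable
  next
    fix s assume "of_real t * u s \<noteq> 0"
    then show "0 \<le> t + s" using u_out[of s] t by (cases "s \<in> {0..<1}") auto
  qed measurable
qed

definition Phi :: "real \<Rightarrow> M01" where
  "Phi t = (SOME m. mrep \<Lambda> (\<lambda>s. t + s) (\<lambda>s. of_real t * u s) m)"

lemma mrep_Phi: "t \<in> {0..1} \<Longrightarrow> mrep \<Lambda> (\<lambda>s. t + s) (\<lambda>s. of_real t * u s) (Phi t)"
  unfolding Phi_def by (rule someI_ex[OF Phi_exists])

lemma Rep_Phi: "t \<in> {0..1} \<Longrightarrow> A \<in> borel01 \<Longrightarrow> Rep_M01 (Phi t) A = of_real t * (LINT s|\<Lambda>. indicator A (t + s) * u s)"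
  unfolding integral_mult_right_zero[symmetric] using mrepD(3)[OF mrep_Phi] by (simp add: mult.left_commute)

lemma norm_Phi: "t \<in> {0..1} \<Longrightarrow> ennreal (norm (Phi t)) \<le> ennreal t * mass t"
proof -
  assume t: "t \<in> {0..1}"
  have "ennreal (norm (Phi t)) \<le> (\<integral>\<^sup>+s. indicator {0..<1} (t + s) * ennreal (cmod (of_real t * u s)) \<partial>\<Lambda>)"
    by (rule norm_mrep[OF mrep_Phi[OF t]])
  also have "\<dots> = (\<integral>\<^sup>+s. ennreal t * (indicator {0..<1} (t + s) * ennreal (cmod (u s))) \<partial>\<Lambda>)"
    using t by (intro nn_integral_cong) (auto simp: norm_mult ennreal_mult split: split_indicator)
  also have "\<dots> = ennreal t * mass t" unfolding mass_def by (intro nn_integral_cmult) measurable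
  finally show ?thesis .
qed

lemma Phi_0: "Phi 0 = 0"
  using norm_Phi[of 0] by simp

text \<open>The setwise form of the integral of \<open>Phi\<close> against \<nu>. Since the norm is
  a supremum over finite families of disjoint sets, this carries the norm estimates without a
  vector-valued integral.\<close>

lemma D_M_Phi:
  assumes r: "mrep N (\<lambda>x. x) v \<nu>" and v: "\<And>x. x \<notin> {0..<1} \<Longrightarrow> v x = 0" and A: "A \<in> borel01"
  shows "Rep_M01 (D_M \<mu> \<nu>) A = (LINT x|N. Rep_M01 (Phi x) A * v x)"
    and "integrable N (\<lambda>x. Rep_M01 (Phi x) A * v x)"
proof -
  have eq: "(of_real x * (LINT s|\<Lambda>. indicator A (x + s) * u s)) * v x = Rep_M01 (Phi x) A * v x" for x
    using v[of x] A by (cases "x \<in> {0..<1}") (auto simp: Rep_Phi)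
  show "Rep_M01 (D_M \<mu> \<nu>) A = (LINT x|N. Rep_M01 (Phi x) A * v x)"
    unfolding Rep_D_M[OF r rep bound A] eq ..
  interpret P: pair_sigma_finite N \<Lambda> using mrepD(4)[OF r] sfL by (rule pair_sigma_finite.intro)
  have i: "integrable N (\<lambda>x. LINT s|\<Lambda>. indicator A (x + s) * (of_real x * v x * u s))"
    using P.integrable_fst'[OF integrable_borel01[OF mrepD(1,2)[OF mrep_D_M[OF r rep bound]] A]] by simp
  have "(LINT s|\<Lambda>. indicator A (x + s) * (of_real x * v x * u s)) = Rep_M01 (Phi x) A * v x" for x
  proof -
    have e: "indicator A (x + s) * (of_real x * v x * u s) = (of_real x * v x) * (indicator A (x + s) * u s)" for s
      by (simp add: mult_ac)
    show ?thesis unfolding e integral_mult_right_zero eq[symmetric] by (simp add: mult_ac)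
  qed
  then show "integrable N (\<lambda>x. Rep_M01 (Phi x) A * v x)" using i by simp
qed

text \<open>\<open>Phi\<close> is replaced by the step function with value \<open>Phi (j/K)\<close>
  on [j/K, (j+1)/K). The factor 4 comes from the bound on the integral of the density |v|.\<close>

lemma D_M_approx:
  assumes K: "K > 0" and e: "0 \<le> e" and ue: "\<And>s t. s \<in> {0..1} \<Longrightarrow> t \<in> {0..1} \<Longrightarrow> \<bar>s - t\<bar> \<le> 1 / real K \<Longrightarrow> norm (Phi s - Phi t) \<le> e"
  shows "norm (D_M \<mu> \<nu> - (\<Sum>j<K. Rep_M01 \<nu> {real j / real K..<real (Suc j) / real K} *\<^sub>C Phi (real j / real K))) \<le> e * (4 * norm \<nu>)"
    (is "norm (_ - ?T) \<le> _")
proof -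
  obtain N v where N: "sets N = sets borel" and r: "mrep N (\<lambda>x. x) v \<nu>" and v[measurable]: "v \<in> borel_measurable borel" and
    v0: "\<And>x. x \<notin> {0..<1} \<Longrightarrow> v x = 0" and vn: "(\<integral>\<^sup>+x. ennreal (cmod (v x)) \<partial>N) \<le> 4 * ennreal (norm \<nu>)" and vi: "integrable N v"
    by (rule mrep_canonical[of \<nu>], rule that, assumption+)
  note [measurable_cong] = N
  define I where "I j = {real j / real K..<real (Suc j) / real K}" for j
  have Ib: "I j \<in> borel01" if "j < K" for j
  proof -
    have "real (Suc j) \<le> real K" using that by simp
    then have "real (Suc j) / real K \<le> 1" using K by simp
    moreover have "0 \<le> real j / real K" by simp
    ultimately show ?thesis unfolding I_def borel01_def by auto
  qed
  have iI: "integrable N (\<lambda>x. indicator (I j) x * v x)" if "j < K" for j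
    by (rule integrable_borel01[OF mrepD(1,2)[OF r] Ib[OF that]])
  define g where "g B x = Rep_M01 (Phi x) B - (\<Sum>j<K. indicator (I j) x * Rep_M01 (Phi (real j / real K)) B)" for B x
  have gi: "integrable N (\<lambda>x. g B x * v x)" and geq: "Rep_M01 (D_M \<mu> \<nu> - ?T) B = (LINT x|N. g B x * v x)" if B: "B \<in> borel01" for B
  proof -
    note D = D_M_Phi[OF r v0 B]
    have e: "g B x * v x = Rep_M01 (Phi x) B * v x - (\<Sum>j<K. Rep_M01 (Phi (real j / real K)) B * (indicator (I j) x * v x))" for x
      unfolding g_def left_diff_distrib sum_distrib_right
      by (intro arg_cong2[where f="(-)"] refl sum.cong) (simp only: mult_ac)
    have iS: "integrable N (\<lambda>x. \<Sum>j<K. Rep_M01 (Phi (real j / real K)) B * (indicator (I j) x * v x))"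
      using iI by (intro Bochner_Integration.integrable_sum integrable_mult_right) auto
    show "integrable N (\<lambda>x. g B x * v x)" unfolding e using D(2) iS by (rule Bochner_Integration.integrable_diff)
    have T: "Rep_M01 (\<Sum>j\<in>F. c j *\<^sub>C y j) B = (\<Sum>j\<in>F. c j * Rep_M01 (y j) B)" for F :: "nat set" and c y
      by (induction F rule: infinite_finite_induct) (auto simp: Rep_M01_ops)
    have "Rep_M01 ?T B = (\<Sum>j<K. Rep_M01 (Phi (real j / real K)) B * (LINT x|N. indicator (I j) x * v x))"
      unfolding T I_def[symmetric] using mrepD(3)[OF r Ib] by (intro sum.cong) (auto simp: mult.commute)
    also have "\<dots> = (LINT x|N. (\<Sum>j<K. Rep_M01 (Phi (real j / real K)) B * (indicator (I j) x * v x)))"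
      using iI by (subst Bochner_Integration.integral_sum) auto
    finally show "Rep_M01 (D_M \<mu> \<nu> - ?T) B = (LINT x|N. g B x * v x)"
      unfolding e using D iS by (simp add: Rep_M01_ops)
  qed
  \<comment> \<open>Summing over the family P before integrating over x is the point: for each x the
    sum is at most the norm of a difference of two values of \<open>Phi\<close>, however fine P
    is.\<close>
  have gsum: "(\<Sum>B\<in>P. cmod (g B x)) \<le> e"
    if P: "finite P" "disjoint P" "P \<subseteq> sets borel" "\<Union>P \<subseteq> {0..<1}" and x: "x \<in> {0..<1}" for P x
  proof -
    \<comment> \<open>The index of the cell that contains x.\<close>
    define j where "j = nat \<lfloor>x * real K\<rfloor>"
    have j: "real j \<le> x * real K" "x * real K < real j + 1" using x K by (auto simp: j_def)
    moreover have "x * real K < 1 * real K" using x K by (intro mult_strict_right_mono) auto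
    ultimately have "real j < real K" by linarith
    then have jK: "j < K" by simp
    have xj: "x \<in> I j" using j K by (auto simp: I_def field_simps)
    have un: "x \<notin> I i" if "i \<noteq> j" for i
    proof
      assume "x \<in> I i"
      then have "real i \<le> x * real K" "x * real K < real i + 1" using K by (auto simp: I_def field_simps)
      then have "real i < real j + 1" "real j < real i + 1" using j by linarith+
      then show False using that by linarith
    qed
    have "(\<Sum>i<K. indicator (I i) x * Rep_M01 (Phi (real i / real K)) B) = Rep_M01 (Phi (real j / real K)) B" for B
    proof -
      have "(\<Sum>i<K. indicator (I i) x * Rep_M01 (Phi (real i / real K)) B) = (\<Sum>i<K. if i = j then Rep_M01 (Phi (real i / real K)) B else 0)"
        using xj un by (intro sum.cong) auto
      then show ?thesis using jK by simp
    qed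
    then have "g B x = Rep_M01 (Phi x - Phi (real j / real K)) B" for B by (simp add: g_def Rep_M01_ops)
    then have "(\<Sum>B\<in>P. cmod (g B x)) \<le> norm (Phi x - Phi (real j / real K))"
      using sum_le_norm_M01[OF P] by simp
    also have "\<dots> \<le> e"
    proof (rule ue)
      show "real j / real K \<in> {0..1}" using jK by simp
      have "real j / real K \<le> x" using j K by (simp add: divide_le_eq)
      moreover have "x < (real j + 1) / real K" using j K by (simp add: less_divide_eq)
      then have "x < real j / real K + 1 / real K" by (simp add: add_divide_distrib)
      ultimately show "\<bar>x - real j / real K\<bar> \<le> 1 / real K" by linarith
    qed (use x in auto)
    finally show ?thesis .
  qed
  show ?thesis
  proof (rule norm_M01_leI)
    show "0 \<le> e * (4 * norm \<nu>)" using e by simp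
    fix P :: "real set set" assume P: "finite P" "disjoint P" "P \<subseteq> sets borel" "\<Union>P \<subseteq> {0..<1}"
    have Pb: "B \<in> borel01" if "B \<in> P" for B using P that by (auto simp: borel01_def)
    have "(\<Sum>B\<in>P. cmod (Rep_M01 (D_M \<mu> \<nu> - ?T) B)) \<le> (\<Sum>B\<in>P. LINT x|N. cmod (g B x * v x))"
      using geq Pb by (intro sum_mono) (simp add: integral_norm_bound)
    also have "\<dots> = (LINT x|N. (\<Sum>B\<in>P. cmod (g B x * v x)))"
      using gi Pb by (subst Bochner_Integration.integral_sum) auto
    also have "\<dots> \<le> (LINT x|N. e * cmod (v x))"
    proof (rule integral_mono)
      show "integrable N (\<lambda>x. \<Sum>B\<in>P. cmod (g B x * v x))" using gi Pb by (intro Bochner_Integration.integrable_sum) auto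
      show "integrable N (\<lambda>x. e * cmod (v x))" using vi by simp
      fix x
      show "(\<Sum>B\<in>P. cmod (g B x * v x)) \<le> e * cmod (v x)"
        using gsum[OF P, of x] v0[of x] by (cases "x \<in> {0..<1}") (auto simp: norm_mult mult_right_mono simp flip: sum_distrib_right)
    qed
    also have "\<dots> = e * (LINT x|N. cmod (v x))" by simp
    also have "\<dots> \<le> e * (4 * norm \<nu>)"
    proof (rule mult_left_mono[OF _ e])
      have "ennreal (LINT x|N. cmod (v x)) = (\<integral>\<^sup>+x. ennreal (cmod (v x)) \<partial>N)"
        by (rule nn_integral_eq_integral[symmetric]) (use vi in auto)
      also have "\<dots> \<le> ennreal (4 * norm \<nu>)" using vn by (simp add: ennreal_mult)
      finally show "(LINT x|N. cmod (v x)) \<le> 4 * norm \<nu>" by simp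
    qed
    finally show "(\<Sum>B\<in>P. cmod (Rep_M01 (D_M \<mu> \<nu> - ?T) B)) \<le> e * (4 * norm \<nu>)" .
  qed
qed

text \<open>Uniform continuity on [0,1] makes one step function good for all \<nu> in the unit ball;
  its coefficients are values of \<nu> and hence at most 1 in modulus.\<close>

lemma compact_D_M:
  assumes "continuous_on {0..1} Phi"
  shows "compact (closure (D_M \<mu> ` cball 0 1))"
proof (rule compact_closure_approx)
  fix e :: real assume "e > 0"
  have "uniformly_continuous_on {0..1} Phi" using assms by (rule compact_uniformly_continuous) simp
  then obtain d where d: "d > 0" "\<And>s t. s \<in> {0..1} \<Longrightarrow> t \<in> {0..1} \<Longrightarrow> \<bar>s - t\<bar> < d \<Longrightarrow> norm (Phi s - Phi t) < e / 4"
    unfolding uniformly_continuous_on_def dist_norm using \<open>e > 0\<close> by (metis abs_minus_commute divide_pos_pos norm_minus_commute real_norm_def zero_less_numeral)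
  obtain k where k: "inverse (real (Suc k)) < d" using reals_Archimedean[OF d(1)] by auto
  define K where "K = Suc k"
  \<comment> \<open>The bound e/4 compensates the factor 4 in \<open>D_M_approx\<close>.\<close>
  have ue: "norm (Phi s - Phi t) \<le> e / 4" if "s \<in> {0..1}" "t \<in> {0..1}" "\<bar>s - t\<bar> \<le> 1 / real K" for s t
    using d(2)[OF that(1,2)] that(3) k by (simp add: K_def inverse_eq_divide)
  show "\<exists>Q. compact Q \<and> (\<forall>x\<in>D_M \<mu> ` cball 0 1. \<exists>y\<in>Q. norm (x - y) \<le> e)"
  proof (intro exI conjI ballI)
    show "compact {(\<Sum>j<K. c j *\<^sub>C Phi (real j / real K)) | c. \<forall>j. c j \<in> cball 0 1}" by (rule compact_combinations)
    fix x assume "x \<in> D_M \<mu> ` cball 0 1"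
    then obtain \<nu> where nu: "x = D_M \<mu> \<nu>" "norm \<nu> \<le> 1" by auto
    let ?y = "\<Sum>j<K. Rep_M01 \<nu> {real j / real K..<real (Suc j) / real K} *\<^sub>C Phi (real j / real K)"
    have "?y \<in> {(\<Sum>j<K. c j *\<^sub>C Phi (real j / real K)) | c. \<forall>j. c j \<in> cball 0 1}"
      using Rep_M01_le_norm[of \<nu>] nu(2) by (auto intro!: exI[of _ "\<lambda>j. Rep_M01 \<nu> {real j / real K..<real (Suc j) / real K}"] intro: order_trans)
    moreover have "norm (x - ?y) \<le> (e / 4) * (4 * norm \<nu>)"
      unfolding nu(1) by (rule D_M_approx) (use ue \<open>e > 0\<close> in \<open>auto simp: K_def\<close>)
    then have "norm (x - ?y) \<le> e" using nu(2) \<open>e > 0\<close> by (simp add: mult_left_le order_trans)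
    ultimately show "\<exists>y\<in>{(\<Sum>j<K. c j *\<^sub>C Phi (real j / real K)) | c. \<forall>j. c j \<in> cball 0 1}. norm (x - y) \<le> e" by blast
  qed
qed

lemma norm_Phi_TV: "0 < t \<Longrightarrow> t < 1 \<Longrightarrow> norm (Phi t) \<le> 4 * (t * total_variation \<mu> {0..<1 - t})"
proof -
  assume t: "0 < t" "t < 1"
  have "ennreal (norm (Phi t)) \<le> ennreal t * mass t" using t by (intro norm_Phi) auto
  also have "\<dots> \<le> ennreal t * (4 * variation (Rep_lfmeas \<mu>) {0..<1 - t})" by (intro mult_left_mono mass_variation t) simp
  also have "\<dots> = ennreal (4 * (t * total_variation \<mu> {0..<1 - t}))"
    using t TV_nonneg by (simp add: variation_TV ennreal_mult mult_ac)
  finally show ?thesis using t TV_nonneg by (subst (asm) ennreal_le_iff) auto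
qed

end

section \<open>Norm continuity of \<open>Phi\<close> for absolutely continuous \<mu>, and
  compactness on L^1[0,1)\<close>

lemma mrep_lborel_diff:
  assumes a: "mrep lborel (\<lambda>x. x) f m" "integrable lborel f" "\<And>x. x \<notin> {0..<1} \<Longrightarrow> f x = 0"
    and b: "mrep lborel (\<lambda>x. x) g n" "integrable lborel g" "\<And>x. x \<notin> {0..<1} \<Longrightarrow> g x = 0"
  shows "mrep lborel (\<lambda>x. x) (\<lambda>x. f x - g x) (m - n)"
  unfolding mrep_def
proof (intro conjI lweight_lborel ballI)
  fix A assume A: "A \<in> borel01"
  show "Rep_M01 (m - n) A = (LINT x|lborel. indicator A x * (f x - g x))"
    using integrable_borel01[OF mrepD(1,2)[OF a(1)] A] integrable_borel01[OF mrepD(1,2)[OF b(1)] A]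
    by (simp add: Rep_M01_ops mrepD(3)[OF a(1) A] mrepD(3)[OF b(1) A] right_diff_distrib)
qed (use a b in auto)

locale growth_ac = growth \<mu> lborel u C for \<mu> u C
begin

text \<open>u need not be integrable on [0,1). But for t \<ge> b only its values on [0,1-b] are
  moved into [0,1), and the part g of u on that interval is integrable, so continuity of translation
  applies to g.\<close>

lemma Phi_continuous_pos:
  assumes t0: "t0 \<in> {0<..1}" and e: "e > 0"
  shows "\<exists>d>0. \<forall>t\<in>{0..1}. \<bar>t - t0\<bar> < d \<longrightarrow> norm (Phi t - Phi t0) < e"
proof -
  define b where "b = t0 / 2"
  have b: "0 < b" "b < 1" "b < t0" using t0 by (auto simp: b_def)
  define g where "g x = indicator {0..1 - b} x * u x" for x
  have gi: "integrable lborel g"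
    using rep b unfolding lrep_def lweight_def g_def[abs_def] by auto
  then have [measurable]: "g \<in> borel_measurable borel" using borel_measurable_integrable[OF gi] by simp
  note gt = integrable_translate[OF gi]
  define psi where "psi t x = indicator {0..<1} x * (of_real t * g (- t + x))" for t x
  have pi: "integrable lborel (psi t)" for t
  proof -
    have "integrable lborel (\<lambda>x. indicator {0..<1} x *\<^sub>R (of_real t * g (- t + x)))"
      using gt[of "-t"] by (intro integrable_mult_indicator) auto
    then show ?thesis by (simp add: psi_def[abs_def] scaleR_indicator)
  qed
  have p0: "psi t x = 0" if "x \<notin> {0..<1}" for t x using that by (simp add: psi_def)
  have rp: "mrep lborel (\<lambda>x. x) (psi t) (Phi t)" if t: "t \<in> {b..1}" for t
    unfolding mrep_def
  proof (intro conjI lweight_lborel[OF pi p0] ballI)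
    fix A assume A: "A \<in> borel01"
    have "Rep_M01 (Phi t) A = (LINT s|lborel. indicator A (t + s) * (of_real t * u s))"
      using t b by (intro mrepD(3)[OF mrep_Phi A]) auto
    also have "\<dots> = (LINT x|lborel. indicator A x * (of_real t * u (- t + x)))"
      using lborel_integral_real_affine[of 1 "\<lambda>x. indicator A x * (of_real t * u (- t + x))" t] by simp
    also have "\<dots> = (LINT x|lborel. indicator A x * psi t x)"
    proof (intro Bochner_Integration.integral_cong refl)
      fix x show "indicator A x * (of_real t * u (- t + x)) = indicator A x * psi t x"
      proof (cases "x \<in> A")
        case True
        then have x: "x \<in> {0..<1}" using A by (auto simp: borel01_def)
        then have "u (- t + x) = g (- t + x)" using t u_out[of "- t + x"] by (auto simp: g_def split: split_indicator)
        then show ?thesis using x by (simp add: psi_def)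
      qed simp
    qed
    finally show "Rep_M01 (Phi t) A = (LINT x|lborel. indicator A x * psi t x)" .
  qed
  define n where "n = (LINT x|lborel. cmod (g x))"
  have n0: "n \<ge> 0" unfolding n_def by simp
  \<comment> \<open>The first term pays for the change of the factor t, the second for the change of
    the translation.\<close>
  have est: "norm (Phi t - Phi t0) \<le> \<bar>t - t0\<bar> * n + t0 * (LINT x|lborel. cmod (g ((t0 - t) + x) - g x))" if t: "t \<in> {b..1}" for t
  proof -
    have i: "integrable lborel (\<lambda>x. \<bar>t - t0\<bar> * cmod (g (- t + x)) + t0 * cmod (g (- t + x) - g (- t0 + x)))"
      using gt[of "- t"] gt[of "- t0"] by simp
    have "ennreal (norm (Phi t - Phi t0)) \<le> (\<integral>\<^sup>+x. indicator {0..<1} x * ennreal (cmod (psi t x - psi t0 x)) \<partial>lborel)"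
      using t t0 b by (intro norm_mrep mrep_lborel_diff rp pi p0) auto
    also have "\<dots> \<le> (\<integral>\<^sup>+x. ennreal (\<bar>t - t0\<bar> * cmod (g (- t + x)) + t0 * cmod (g (- t + x) - g (- t0 + x))) \<partial>lborel)"
    proof (rule nn_integral_mono)
      fix x :: real
      have "psi t x - psi t0 x = indicator {0..<1} x * (of_real (t - t0) * g (- t + x) + of_real t0 * (g (- t + x) - g (- t0 + x)))"
        by (simp add: psi_def algebra_simps)
      also have "cmod \<dots> \<le> cmod (of_real (t - t0) * g (- t + x) + of_real t0 * (g (- t + x) - g (- t0 + x)))"
        by (auto simp: norm_mult split: split_indicator)
      also have "\<dots> \<le> cmod (of_real (t - t0) * g (- t + x)) + cmod (of_real t0 * (g (- t + x) - g (- t0 + x)))" by (rule norm_triangle_ineq)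
      also have "\<dots> = \<bar>t - t0\<bar> * cmod (g (- t + x)) + t0 * cmod (g (- t + x) - g (- t0 + x))"
        using t0 by (simp add: norm_mult flip: of_real_diff)
      finally show "indicator {0..<1} x * ennreal (cmod (psi t x - psi t0 x)) \<le> ennreal (\<bar>t - t0\<bar> * cmod (g (- t + x)) + t0 * cmod (g (- t + x) - g (- t0 + x)))"
        by (auto intro: ennreal_leI split: split_indicator)
    qed
    also have "\<dots> = ennreal (LINT x|lborel. \<bar>t - t0\<bar> * cmod (g (- t + x)) + t0 * cmod (g (- t + x) - g (- t0 + x)))"
      using i t0 by (intro nn_integral_eq_integral) auto
    finally have "norm (Phi t - Phi t0) \<le> (LINT x|lborel. \<bar>t - t0\<bar> * cmod (g (- t + x)) + t0 * cmod (g (- t + x) - g (- t0 + x)))"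
      using t0 by (subst (asm) ennreal_le_iff) (auto intro!: integral_nonneg_AE)
    also have "\<dots> = \<bar>t - t0\<bar> * (LINT x|lborel. cmod (g (- t + x))) + t0 * (LINT x|lborel. cmod (g (- t + x) - g (- t0 + x)))"
      using gt[of "- t"] gt[of "- t0"] by simp
    also have "(LINT x|lborel. cmod (g (- t + x))) = n" unfolding n_def by (rule integral_translate)
    also have "(LINT x|lborel. cmod (g (- t + x) - g (- t0 + x))) = (LINT x|lborel. cmod (g ((t0 - t) + x) - g x))"
      using integral_translate[of "\<lambda>x. cmod (g ((t0 - t) + x) - g x)" "- t0"] by (simp add: algebra_simps)
    finally show ?thesis .
  qed
  obtain d1 where d1: "d1 > 0" "\<And>h. \<bar>h\<bar> < d1 \<Longrightarrow> (LINT x|lborel. cmod (g (h + x) - g x)) < e / 2"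
    using translation_continuousI[OF gi] e unfolding translation_continuous_def by (meson half_gt_zero)
  \<comment> \<open>The three bounds keep t above b, make the translation term smaller than e/2, and
    make the factor term at most e/2; n + 1 allows for n = 0.\<close>
  define d where "d = min b (min d1 (e / (2 * (n + 1))))"
  have "d > 0" using b d1 e n0 by (simp add: d_def)
  moreover have "norm (Phi t - Phi t0) < e" if t: "t \<in> {0..1}" "\<bar>t - t0\<bar> < d" for t
  proof -
    have "\<bar>t - t0\<bar> < t0 / 2" using t by (simp add: d_def b_def)
    then have "b \<le> t" unfolding b_def by linarith
    then have tb: "t \<in> {b..1}" using t by simp
    have "\<bar>t - t0\<bar> * n \<le> (e / (2 * (n + 1))) * (n + 1)" using t n0 by (intro mult_mono) (auto simp: d_def)
    also have "\<dots> = e / 2"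
    proof -
      have "e / (2 * k) * k = e / 2" if "k \<noteq> 0" for k :: real using that by simp
      moreover have "n + 1 \<noteq> 0" using n0 by linarith
      ultimately show ?thesis by blast
    qed
    finally have 1: "\<bar>t - t0\<bar> * n \<le> e / 2" .
    have "(LINT x|lborel. cmod (g ((t0 - t) + x) - g x)) < e / 2" using t by (intro d1) (auto simp: d_def)
    moreover have "t0 * (LINT x|lborel. cmod (g ((t0 - t) + x) - g x)) \<le> 1 * (LINT x|lborel. cmod (g ((t0 - t) + x) - g x))"
      using t0 by (intro mult_right_mono) auto
    ultimately show ?thesis using est[OF tb] 1 by linarith
  qed
  ultimately show ?thesis by blast
qed

lemma Phi_continuous:
  assumes "((\<lambda>t. t * total_variation \<mu> {0..<1 - t}) \<longlongrightarrow> 0) (at_right 0)"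
  shows "continuous_on {0..1} Phi"
  unfolding continuous_on_iff dist_norm real_norm_def
proof (intro ballI allI impI)
  fix t0 e :: real assume t0: "t0 \<in> {0..1}" and e: "e > 0"
  show "\<exists>d>0. \<forall>t\<in>{0..1}. \<bar>t - t0\<bar> < d \<longrightarrow> norm (Phi t - Phi t0) < e"
  proof (cases "t0 = 0")
    case True
    have "eventually (\<lambda>t. t * total_variation \<mu> {0..<1 - t} < e / 4) (at_right 0)"
      using order_tendstoD(2)[OF assms, of "e / 4"] e by simp
    then obtain d where d: "d > 0" "\<And>t. 0 < t \<Longrightarrow> t < d \<Longrightarrow> t * total_variation \<mu> {0..<1 - t} < e / 4"
      unfolding eventually_at_right_field by auto
    have "norm (Phi t - Phi t0) < e" if "t \<in> {0..1}" "\<bar>t - t0\<bar> < min d 1" for t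
    proof (cases "t = 0")
      case False
      then have "norm (Phi t) \<le> 4 * (t * total_variation \<mu> {0..<1 - t})" using that True by (intro norm_Phi_TV) auto
      moreover have "t * total_variation \<mu> {0..<1 - t} < e / 4" using that True False by (intro d(2)) auto
      ultimately show ?thesis using True by (simp add: Phi_0)
    qed (use True e in simp)
    then show ?thesis using d(1) by (intro exI[of _ "min d 1"]) auto
  qed (use Phi_continuous_pos[of t0 e] t0 e in auto)
qed

end

text \<open>Compactness is pulled back along the embedding. Its range Z is closed, being described
  by evaluations, and its inverse G is Lipschitz on Z with constant 4.\<close>

lemma compact_D_L1:
  assumes m: "lrep \<Lambda> (\<lambda>x. x) u \<mu>" and g: "growth_bound \<Lambda> u C"
    and K: "compact (closure (D_M \<mu> ` cball 0 1))"
  shows "compact (closure (D_L1 \<mu> ` cball 0 1))"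
proof -
  define Z where "Z = (\<Inter>A\<in>{A\<in>borel01. emeasure lborel A = 0}. {m. Rep_M01 m A = 0})"
  have bl: "bounded_linear (\<lambda>m. Rep_M01 m A)" for A
    by (rule bounded_linear_intro[of _ 1]) (auto simp: Rep_M01_ops scaleR_conv_of_real Rep_M01_le_norm)
  have "closed {m. Rep_M01 m A = 0}" for A
    by (intro closed_Collect_eq linear_continuous_on bl continuous_on_const)
  then have "closed Z" unfolding Z_def by (intro closed_INT) auto
  then have cK: "compact (closure (D_M \<mu> ` cball 0 1) \<inter> Z)" using K by (rule compact_Int_closed[rotated])
  have Z: "Z = range L1_to_M"
  proof (intro equalityI subsetI)
    fix m assume "m \<in> Z"
    then show "m \<in> range L1_to_M" using L1_to_M_range[of m] unfolding Z_def by blast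
  qed (auto simp: Z_def L1_to_M_null)
  define G where "G = inv L1_to_M"
  have GJ: "G (L1_to_M f) = f" for f unfolding G_def by (rule inv_f_f) (auto intro: injI L1_to_M_inj)
  have cont: "continuous_on Z G"
    unfolding continuous_on_iff
  proof (intro ballI allI impI)
    fix x and e :: real assume "x \<in> Z" "e > 0"
    then obtain f where x: "x = L1_to_M f" unfolding Z by blast
    have "dist (G y) (G x) < e" if yZ: "y \<in> Z" and yx: "dist y x < e / 4" for y
    proof -
      obtain h where y: "y = L1_to_M h" using yZ unfolding Z by blast
      have "norm (h - f) \<le> 4 * norm (L1_to_M h - L1_to_M f)" using norm_le_L1_to_M[of "h - f"] by (simp add: L1_to_M_diff)
      then show ?thesis using yx unfolding x y GJ dist_norm by linarith
    qed
    then show "\<exists>d>0. \<forall>y\<in>Z. dist y x < d \<longrightarrow> dist (G y) (G x) < e" using \<open>e > 0\<close> by (intro exI[of _ "e / 4"]) auto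
  qed
  have "compact (G ` (closure (D_M \<mu> ` cball 0 1) \<inter> Z))"
    by (rule compact_continuous_image[OF continuous_on_subset[OF cont] cK]) auto
  moreover have "D_L1 \<mu> ` cball 0 1 \<subseteq> G ` (closure (D_M \<mu> ` cball 0 1) \<inter> Z)"
  proof
    fix y assume "y \<in> D_L1 \<mu> ` cball 0 1"
    then obtain f where f: "y = D_L1 \<mu> f" "norm f \<le> 1" by auto
    have "L1_to_M y = D_M \<mu> (L1_to_M f)" unfolding f(1) by (rule L1_to_M_D_L1[OF m g])
    moreover have "norm (L1_to_M f) \<le> 1" using norm_L1_to_M_le[of f] f(2) by linarith
    ultimately have "L1_to_M y \<in> closure (D_M \<mu> ` cball 0 1)"
      using closure_subset[of "D_M \<mu> ` cball 0 1"] by auto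
    then have "L1_to_M y \<in> closure (D_M \<mu> ` cball 0 1) \<inter> Z" unfolding Z by blast
    then show "y \<in> G ` (closure (D_M \<mu> ` cball 0 1) \<inter> Z)" using GJ[of y] by (metis image_eqI)
  qed
  ultimately have "closure (D_L1 \<mu> ` cball 0 1) \<subseteq> G ` (closure (D_M \<mu> ` cball 0 1) \<inter> Z)"
    by (intro closure_minimal compact_imp_closed)
  then show ?thesis using \<open>compact (G ` _)\<close> by (metis closed_closure compact_Int_closed inf.absorb_iff2)
qed

section \<open>Weak topologies\<close>

lemma zero_cdual: "(\<lambda>_. 0) \<in> cdual" 
  unfolding cdual_def mem_Collect_eq by (intro conjI bounded_linear_zero allI) simp

lemma openin_weak: "\<phi> \<in> cdual \<Longrightarrow> open U \<Longrightarrow> openin weak_topology (\<phi> -` U)"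
  unfolding weak_topology_def by (rule topology_generated_by_Basis) blast

lemma topspace_weak[simp]: "topspace (weak_topology :: 'a::complex_normed_vector topology) = UNIV"
  using openin_subset[OF openin_weak[OF zero_cdual open_UNIV]] by auto

lemma continuous_map_weak:
  assumes "\<And>\<phi> U. \<phi> \<in> cdual \<Longrightarrow> open U \<Longrightarrow> openin X (f -` (\<phi> -` U) \<inter> topspace X)"
  shows "continuous_map X weak_topology f"
  unfolding weak_topology_def continuous_on_generated_topo_iff
proof (intro conjI allI impI)
  show "f ` topspace X \<subseteq> \<Union>{\<phi> -` U | \<phi> U. \<phi> \<in> cdual \<and> open U}"
    unfolding topspace_weak[unfolded weak_topology_def topology_generated_by_topspace] by (rule subset_UNIV)
qed (use assms in auto)

lemma compact_imp_compactin_weak: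
  fixes K :: "'a::complex_normed_vector set"
  assumes "compact K" shows "compactin weak_topology K"
proof -
  have "continuous_map euclidean weak_topology (\<lambda>x::'a. x)"
  proof (rule continuous_map_weak)
    fix \<phi> :: "'a \<Rightarrow> complex" and U assume "\<phi> \<in> cdual" "open (U :: complex set)"
    then have "open (\<phi> -` U)" by (intro open_vimage linear_continuous_on) (auto simp: cdual_def)
    then show "openin euclidean ((\<lambda>x. x) -` (\<phi> -` U) \<inter> topspace euclidean)" by simp
  qed
  then show ?thesis using image_compactin[of euclidean K] assms by fastforce
qed

lemma Hausdorff_weak:
  assumes sep: "\<And>x y :: 'a::complex_normed_vector. x \<noteq> y \<Longrightarrow> \<exists>\<phi>\<in>cdual. \<phi> x \<noteq> \<phi> y"
  shows "Hausdorff_space (weak_topology :: 'a topology)"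
  unfolding Hausdorff_space_def
proof (intro allI impI)
  fix x y :: 'a assume "x \<in> topspace weak_topology \<and> y \<in> topspace weak_topology \<and> x \<noteq> y"
  then obtain \<phi> where p: "\<phi> \<in> cdual" "\<phi> x \<noteq> \<phi> y" using sep by blast
  then obtain U V where "open U" "open V" "\<phi> x \<in> U" "\<phi> y \<in> V" "U \<inter> V = {}" using separation_t2 by metis
  then show "\<exists>U V. openin weak_topology U \<and> openin weak_topology V \<and> x \<in> U \<and> y \<in> V \<and> disjnt U V"
    using openin_weak[OF p(1)] by (intro exI[of _ "\<phi> -` U"] exI[of _ "\<phi> -` V"]) (auto simp: disjnt_def)
qed

text \<open>The norm closure is weakly compact, hence weakly closed in a Hausdorff topology, and so
  contains the weak closure. Separation of points enters as a hypothesis and is later supplied by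
  evaluations at Borel sets.\<close>

lemma compact_imp_weakly_compact_operator:
  fixes T :: "'a::complex_normed_vector \<Rightarrow> 'b::complex_normed_vector"
  assumes sep: "\<And>x y :: 'b. x \<noteq> y \<Longrightarrow> \<exists>\<phi>\<in>cdual. \<phi> x \<noteq> \<phi> y" and T: "compact_operator T"
  shows "weakly_compact_operator T"
proof -
  let ?K = "closure (T ` cball 0 1)"
  have K: "compactin weak_topology ?K" using T by (intro compact_imp_compactin_weak) (simp add: compact_operator_def)
  have "closedin weak_topology ?K" by (rule compactin_imp_closedin[OF Hausdorff_weak[OF sep] K])
  then have "weak_topology closure_of (T ` cball 0 1) \<subseteq> ?K" by (intro closure_of_minimal closure_subset)
  then have "compactin weak_topology (weak_topology closure_of (T ` cball 0 1))"
    by (intro closed_compactin[OF K]) auto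
  then show ?thesis using T by (simp add: compact_operator_def weakly_compact_operator_def)
qed

text \<open>A cluster point in the form in which it is used: a closed condition on one functional
  that the sequence eventually satisfies passes to k.\<close>

lemma weak_cluster_point:
  fixes K :: "'a::complex_normed_vector set" and x :: "nat \<Rightarrow> 'a"
  assumes K: "compactin weak_topology K" and x: "\<And>n. x n \<in> K"
  obtains k where "k \<in> K"
    "\<And>\<phi> S. \<phi> \<in> cdual \<Longrightarrow> closed S \<Longrightarrow> eventually (\<lambda>n. \<phi> (x n) \<in> S) sequentially \<Longrightarrow> \<phi> k \<in> S"
proof (rule ccontr)
  note main = that
  assume no: "\<not> thesis"
  \<comment> \<open>If no k works, each point of K lies in a weakly open set that the sequence
    eventually avoids; finitely many of these cover K, and a late term of the sequence avoids them
    all.\<close>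
  define \<U> where "\<U> = {\<phi> -` (- S) | \<phi> S. \<phi> \<in> cdual \<and> closed S \<and> eventually (\<lambda>n. \<phi> (x n) \<in> S) sequentially}"
  have "K \<subseteq> \<Union>\<U>"
  proof
    fix k assume "k \<in> K"
    then obtain \<phi> S where "\<phi> \<in> cdual" "closed S" "eventually (\<lambda>n. \<phi> (x n) \<in> S) sequentially" "\<phi> k \<notin> S"
      using no main by blast
    then show "k \<in> \<Union>\<U>" unfolding \<U>_def by blast
  qed
  moreover have "openin weak_topology U" if "U \<in> \<U>" for U
    using that unfolding \<U>_def by (auto intro!: openin_weak)
  ultimately obtain \<F> where F: "finite \<F>" "\<F> \<subseteq> \<U>" "K \<subseteq> \<Union>\<F>"
    using K unfolding compactin_def by meson
  have "\<forall>V\<in>\<F>. eventually (\<lambda>n. x n \<notin> V) sequentially"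
    using F(2) unfolding \<U>_def by (auto elim!: eventually_mono)
  then have "eventually (\<lambda>n. \<forall>V\<in>\<F>. x n \<notin> V) sequentially" using F(1) by (simp add: eventually_ball_finite)
  then obtain n where "\<forall>V\<in>\<F>. x n \<notin> V" by (auto simp: eventually_sequentially)
  then show False using x[of n] F(3) by blast
qed

text \<open>These functionals do all the testing of weak limits, and with the embedding they also
  separate the points of L^1[0,1).\<close>

lemma Rep_M01_cdual: "(\<lambda>m. Rep_M01 m A) \<in> cdual"
proof -
  have "bounded_linear (\<lambda>m. Rep_M01 m A)"
    by (rule bounded_linear_intro[of _ 1]) (auto simp: Rep_M01_ops scaleR_conv_of_real Rep_M01_le_norm)
  then show ?thesis by (auto simp: cdual_def Rep_M01_ops)
qed

lemma scaleR_L1_to_M: "L1_to_M (r *\<^sub>R f) = r *\<^sub>R L1_to_M f"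
  unfolding scaleC_of_real[symmetric] by (rule L1_to_M_scaleC)

lemma bounded_linear_L1_to_M: "bounded_linear L1_to_M"
proof (rule bounded_linear_intro[of _ 1])
  show "norm (L1_to_M f) \<le> norm f * 1" for f using norm_L1_to_M_le[of f] by simp
qed (rule L1_to_M_add scaleR_L1_to_M)+

lemma cdual_L1_to_M:
  assumes "\<phi> \<in> cdual" shows "(\<lambda>f. \<phi> (L1_to_M f)) \<in> cdual"
  using assms bounded_linear_compose[OF _ bounded_linear_L1_to_M, of \<phi>] unfolding cdual_def mem_Collect_eq L1_to_M_scaleC by blast

lemma separate_M01:
  assumes "x \<noteq> y" shows "\<exists>\<phi>\<in>cdual. \<phi> x \<noteq> \<phi> (y :: M01)"
proof -
  obtain A where "Rep_M01 x A \<noteq> Rep_M01 y A" using M01_eqI_lc[of x y] assms by blast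
  then show ?thesis by (intro bexI[OF _ Rep_M01_cdual[of A]])
qed

lemma separate_L1:
  assumes "x \<noteq> y" shows "\<exists>\<phi>\<in>cdual. \<phi> x \<noteq> \<phi> (y :: L1_01)"
proof -
  obtain \<phi> where "\<phi> \<in> cdual" "\<phi> (L1_to_M x) \<noteq> \<phi> (L1_to_M y)" using separate_M01[of "L1_to_M x" "L1_to_M y"] L1_to_M_inj[of x y] assms by blast
  then show ?thesis by (intro bexI[OF _ cdual_L1_to_M])
qed

text \<open>Composition with the embedding takes functionals on M[0,1) to functionals on L^1[0,1),
  so the embedding is continuous for the weak topologies.\<close>

lemma compactin_weak_L1_to_M:
  assumes "compactin weak_topology W" shows "compactin weak_topology (L1_to_M ` W)"
proof (rule image_compactin[OF assms], rule continuous_map_weak)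
  fix \<phi> :: "M01 \<Rightarrow> complex" and U assume "\<phi> \<in> cdual" "open (U :: complex set)"
  then have "openin weak_topology ((\<lambda>f. \<phi> (L1_to_M f)) -` U)" by (intro openin_weak cdual_L1_to_M)
  then show "openin weak_topology (L1_to_M -` (\<phi> -` U) \<inter> topspace weak_topology)" by (simp add: vimage_def)
qed

section \<open>Finite additivity and the size of the variation\<close>

lemma signed_on_Union:
  assumes R: "borel01_ring R" and r: "signed_on R r" and P: "finite P" "disjoint P" "P \<subseteq> R"
  shows "\<Union>P \<in> R \<and> r (\<Union>P) = (\<Sum>B\<in>P. r B)"
  using P
proof (induction P)
  case empty
  then show ?case using borel01_ring_empty[OF R] signed_on_empty[OF R r] by simp
next
  case (insert B P)
  then have IH: "\<Union>P \<in> R" "r (\<Union>P) = (\<Sum>B\<in>P. r B)" by (auto simp: disjoint_def pairwise_insert)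
  have B: "B \<in> R" "B \<inter> \<Union>P = {}" using insert by (auto simp: disjoint_def)
  show ?case using signed_on_Un[OF R r B(1) IH(1) B(2)] borel01_ring_Un[OF R B(1) IH(1)] IH(2) insert by simp
qed

lemma signed_on_sum_abs:
  assumes R: "borel01_ring R" and r: "signed_on R r" and P: "finite P" "disjoint P" "P \<subseteq> R"
    and c: "\<And>B. B \<in> R \<Longrightarrow> B \<subseteq> \<Union>P \<Longrightarrow> \<bar>r B\<bar> \<le> c"
  shows "(\<Sum>B\<in>P. \<bar>r B\<bar>) \<le> 2 * c"
proof -
  let ?P = "{B\<in>P. 0 \<le> r B}" and ?Q = "{B\<in>P. \<not> 0 \<le> r B}"
  have u: "\<Union>?P \<in> R \<and> r (\<Union>?P) = (\<Sum>B\<in>?P. r B)" "\<Union>?Q \<in> R \<and> r (\<Union>?Q) = (\<Sum>B\<in>?Q. r B)"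
    using P by (intro signed_on_Union[OF R r]; force simp: disjoint_def)+
  have "(\<Sum>B\<in>P. \<bar>r B\<bar>) = (\<Sum>B\<in>?P. \<bar>r B\<bar>) + (\<Sum>B\<in>?Q. \<bar>r B\<bar>)"
    using P(1) by (subst sum.union_disjoint[symmetric]) (auto intro!: sum.cong)
  also have "\<dots> = (\<Sum>B\<in>?P. r B) - (\<Sum>B\<in>?Q. r B)" by (simp add: sum_negf)
  also have "\<dots> = r (\<Union>?P) - r (\<Union>?Q)" using u by simp
  also have "\<dots> \<le> c + c"
  proof -
    have "\<bar>r (\<Union>?P)\<bar> \<le> c" "\<bar>r (\<Union>?Q)\<bar> \<le> c" using u by (intro c; blast)+
    then show ?thesis by linarith
  qed
  finally show ?thesis by simp
qed

text \<open>Used contrapositively: a large variation yields a single Borel set of large measure.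
  Splitting into real and imaginary part, and each by sign, gives the factor 4.\<close>

lemma variation_le_4:
  assumes m: "cmeasure_on lc_borel01 m" and S: "S \<in> lc_borel01" and c: "0 \<le> c" "\<And>B. B \<in> sets borel \<Longrightarrow> B \<subseteq> S \<Longrightarrow> cmod (m B) \<le> c"
  shows "variation m S \<le> ennreal (4 * c)"
  unfolding variation_def
proof (rule SUP_least)
  fix P assume P: "P \<in> {P. finite P \<and> disjoint P \<and> P \<subseteq> sets borel \<and> \<Union>P \<subseteq> S}"
  then have PR: "P \<subseteq> lc_borel01" using borel01_ring_sub[OF borel01_ring_lc_borel01 S] by blast
  have cB: "cmod (m B) \<le> c" if "B \<in> lc_borel01" "B \<subseteq> \<Union>P" for B
    using that P by (intro c(2)) (auto simp: lc_borel01_def)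
  have "(\<Sum>B\<in>P. cmod (m B)) \<le> (\<Sum>B\<in>P. \<bar>Re (m B)\<bar> + \<bar>Im (m B)\<bar>)" by (intro sum_mono cmod_le)
  also have "\<dots> = (\<Sum>B\<in>P. \<bar>Re (m B)\<bar>) + (\<Sum>B\<in>P. \<bar>Im (m B)\<bar>)" by (rule sum.distrib)
  also have "\<dots> \<le> 2 * c + 2 * c"
    using P PR cB by (intro add_mono signed_on_sum_abs[OF borel01_ring_lc_borel01] cmeasure_signed[OF m])
      (auto intro: order_trans[OF abs_Re_le_cmod] order_trans[OF abs_Im_le_cmod])
  finally show "(\<Sum>B\<in>P. ennreal (cmod (m B))) \<le> ennreal (4 * c)" by (auto intro: ennreal_leI)
qed

section \<open>Necessity of the condition on the measure\<close>

lemma emeasure_lborel_translate: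
  assumes A: "A \<in> sets borel" shows "emeasure lborel ((\<lambda>x. x - c) -` A) = emeasure lborel (A :: real set)"
proof -
  have "emeasure lborel A = emeasure (distr lborel borel ((+) (- c))) A" by (simp add: lborel_distr_plus)
  also have "\<dots> = emeasure lborel ((+) (- c) -` A)" using A by (subst emeasure_distr) auto
  finally show ?thesis by (simp add: vimage_def add.commute)
qed

lemma norm_integral_le:
  fixes f :: "'a \<Rightarrow> complex"
  assumes "integrable M f" "integrable M g" "\<And>x. norm (f x) \<le> g x"
  shows "norm (LINT x|M. f x) \<le> (LINT x|M. g x)"
  using assms by (intro order_trans[OF integral_norm_bound] integral_mono) auto

text \<open>The set \<open>K\<close> is a weak closure in $M[0,1)$, or the image of one in $L^1[0,1)$.\<close>

locale growth_weak = growth +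
  fixes K :: "M01 set"
  assumes K: "compactin weak_topology K" and D_K: "\<And>f. norm f \<le> 1 \<Longrightarrow> D_M \<mu> (L1_to_M f) \<in> K"
begin

text \<open>Half-open intervals suit limits from the right: t0 + s < b persists for t slightly above
  t0, and t0 + s \<ge> b for every larger t. From the left an atom of \<mu> at b - t0 could
  interfere.\<close>

lemma Phi_Ico_right_continuous:
  assumes t: "0 < t0" "t0 < 1" and b: "b \<le> 1"
  shows "((\<lambda>t. Rep_M01 (Phi t) {0..<b}) \<longlongrightarrow> Rep_M01 (Phi t0) {0..<b}) (at_right t0)"
proof (rule tendsto_at_right_sequentially[OF t(2)])
  fix S :: "nat \<Rightarrow> real" assume S: "\<And>n. t0 < S n" "\<And>n. S n < 1" "S \<longlonglongrightarrow> t0"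
  have B: "{0..<b} \<in> borel01" using b by (auto simp: borel01_def)
  have "(\<lambda>n. LINT s|\<Lambda>. indicator {0..<b} (S n + s) * u s) \<longlonglongrightarrow> (LINT s|\<Lambda>. indicator {0..<b} (t0 + s) * u s)"
  proof (rule integral_dominated_convergence)
    \<comment> \<open>For t > t0 only s \<le> 1 - t0 matters, and there \<mu> is finite because t0 >
      0.\<close>
    have "integrable \<Lambda> (\<lambda>s. indicator {0..1 - t0} s * u s)" using rep t by (auto simp: lrep_def lweight_def)
    then show "integrable \<Lambda> (\<lambda>s. cmod (indicator {0..1 - t0} s * u s))" by simp
    show "AE s in \<Lambda>. norm (indicator {0..<b} (S n + s) * u s) \<le> cmod (indicator {0..1 - t0} s * u s)" for n
    proof (rule AE_I2)
      fix s
      show "norm (indicator {0..<b} (S n + s) * u s) \<le> cmod (indicator {0..1 - t0} s * u s)"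
        using S(1)[of n] b u_out[of s] by (cases "s \<in> {0..<1}") (auto simp: norm_mult split: split_indicator)
    qed
    show "AE s in \<Lambda>. (\<lambda>n. indicator {0..<b} (S n + s) * u s) \<longlonglongrightarrow> indicator {0..<b} (t0 + s) * u s"
    proof (rule AE_I2)
      fix s
      show "(\<lambda>n. indicator {0..<b} (S n + s) * u s) \<longlonglongrightarrow> indicator {0..<b} (t0 + s) * u s"
      proof (cases "s \<in> {0..<1}")
        case s: True
        show ?thesis
        proof (cases "t0 + s < b")
          case True
          then have "eventually (\<lambda>n. S n < b - s) sequentially" using order_tendstoD(2)[OF S(3), of "b - s"] by simp
          then have "eventually (\<lambda>n. indicator {0..<b} (S n + s) * u s = indicator {0..<b} (t0 + s) * u s) sequentially"
          proof eventually_elim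
            case (elim n)
            then show ?case using S(1)[of n] s t True by (auto split: split_indicator)
          qed
          then show ?thesis by (rule tendsto_eventually)
        next
          case False
          then have e: "indicator {0..<b} (S n + s) * u s = indicator {0..<b} (t0 + s) * u s" for n
            using S(1)[of n] by (auto split: split_indicator)
          show ?thesis unfolding e by simp
        qed
      qed (simp add: u_out)
    qed
  qed measurable
  then have "(\<lambda>n. of_real (S n) * (LINT s|\<Lambda>. indicator {0..<b} (S n + s) * u s)) \<longlonglongrightarrow> of_real t0 * (LINT s|\<Lambda>. indicator {0..<b} (t0 + s) * u s)"
    by (intro tendsto_intros S(3))
  moreover have "S n \<in> {0..1}" for n using S(1)[of n] S(2)[of n] t by simp
  ultimately show "(\<lambda>n. Rep_M01 (Phi (S n)) {0..<b}) \<longlonglongrightarrow> Rep_M01 (Phi t0) {0..<b}"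
    using t B by (simp add: Rep_Phi)
qed

text \<open>\<open>Phi t0\<close> is a weak cluster point of \<open>D_M \<mu> (L1_to_M f)\<close> along an approximate identity \<open>f\<close> shifted by \<open>t0\<close>.\<close>

lemma Phi_in_K:
  assumes t: "0 < t0" "t0 < 1"
  shows "Phi t0 \<in> K" and "A \<in> borel01 \<Longrightarrow> emeasure lborel A = 0 \<Longrightarrow> Rep_M01 (Phi t0) A = 0"
proof -
  \<comment> \<open>Starting at k0 keeps the supports of the approximate identity inside
    [0,1).\<close>
  obtain k0 where k0: "inverse (real (Suc k0)) < 1 - t0" using reals_Archimedean[of "1 - t0"] t by auto
  define r where "r n = real (Suc (k0 + n))" for n
  have r: "r n > 0" "1 / r n < 1 - t0" for n
  proof -
    show "r n > 0" by (simp add: r_def)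
    have "1 / r n \<le> inverse (real (Suc k0))" by (simp add: r_def inverse_eq_divide frac_le)
    then show "1 / r n < 1 - t0" using k0 by linarith
  qed
  have rlim: "(\<lambda>n. 1 / r n) \<longlonglongrightarrow> 0"
    unfolding r_def using LIMSEQ_ignore_initial_segment[OF LIMSEQ_inverse_real_of_nat, of k0]
    by (simp add: inverse_eq_divide add.commute)
  \<comment> \<open>The intervals lie to the right of t0, where \<open>Phi\<close> is continuous on
    the sets [0,b).\<close>
  define I where "I n = {t0..<t0 + 1 / r n}" for n
  have Ib: "I n \<subseteq> {t0..<1}" for n using r(2)[of n] by (auto simp: I_def)
  define v where "v n x = complex_of_real (r n * indicator (I n) x)" for n x
  have ri: "integrable lborel (\<lambda>x. r n * indicator (I n) x)" and rI: "(LINT x|lborel. r n * indicator (I n) x) = 1" for n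
  proof -
    have "0 \<le> 1 / r n" using r(1)[of n] by simp
    then have em: "emeasure lborel (I n) = ennreal (1 / r n)" by (simp add: I_def)
    then show "integrable lborel (\<lambda>x. r n * indicator (I n) x)" by (intro integrable_mult_right integrable_real_indicator) (auto simp: I_def)
    have "measure lborel (I n) = 1 / r n" using em \<open>0 \<le> 1 / r n\<close> by (simp add: measure_def)
    then show "(LINT x|lborel. r n * indicator (I n) x) = 1" using r(1)[of n] by simp
  qed
  have vi: "integrable lborel (v n)" for n unfolding v_def[abs_def] using ri by (rule integrable_of_real)
  have v0: "v n x = 0" if "x \<notin> {0..<1}" for n x using Ib[of n] that t by (auto simp: v_def split: split_indicator)
  define f where "f n = abs_L1_01 (v n)" for n
  have df: "AE x in lborel. L1_fun (f n) x = v n x" for n unfolding f_def by (rule L1_fun_abs[OF vi v0])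
  have nfe: "norm (f n) = (LINT x|lborel. r n * indicator (I n) x)" for n
    unfolding norm_L1_fun
  proof (rule integral_cong_AE)
    show "AE x in lborel. cmod (L1_fun (f n) x) = r n * indicator (I n) x"
      using df[of n] by eventually_elim (use r(1)[of n] in \<open>auto simp: v_def norm_mult split: split_indicator\<close>)
  qed (use borel_measurable_integrable[OF ri[of n]] in auto)
  have nf: "norm (f n) \<le> 1" for n unfolding nfe rI by simp
  have mv: "mrep lborel (\<lambda>x. x) (v n) (L1_to_M (f n))" for n
    by (rule mrep_AE_cong[OF mrep_L1_to_M df vi v0])
  obtain k where k: "k \<in> K" and clus: "\<And>\<phi> S. \<phi> \<in> cdual \<Longrightarrow> closed S \<Longrightarrow> eventually (\<lambda>n. \<phi> (D_M \<mu> (L1_to_M (f n))) \<in> S) sequentially \<Longrightarrow> \<phi> k \<in> S"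
    by (rule weak_cluster_point[OF K, of "\<lambda>n. D_M \<mu> (L1_to_M (f n))"], rule D_K[OF nf], rule that, assumption+)
  \<comment> \<open>Every term vanishes on the null set A, and {0} is closed.\<close>
  have null: "Rep_M01 k A = 0" if "A \<in> borel01" "emeasure lborel A = 0" for A
    using clus[OF Rep_M01_cdual, of "{0}" A] D_M_L1_to_M_null[OF rep bound that] by simp
  \<comment> \<open>On [0,b) each term is the average of \<open>Phi x\<close> over x in
    \<open>I n\<close>, which right continuity eventually brings within e of \<open>Phi t0\<close>.
    The closed ball of radius e passes to the cluster point.\<close>
  have "k = Phi t0"
  proof (rule M01_eqI)
    fix b :: real assume b: "0 < b" "b < 1"
    have B: "{0..<b} \<in> borel01" using b by (auto simp: borel01_def)
    let ?q = "\<lambda>x. Rep_M01 (Phi x) {0..<b}"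
    have "cmod (Rep_M01 k {0..<b} - ?q t0) \<le> e" if e: "e > 0" for e
    proof -
      have "eventually (\<lambda>x. dist (?q x) (?q t0) < e) (at_right t0)"
        using tendstoD[OF Phi_Ico_right_continuous[OF t, of b] e] b by simp
      then obtain y where y: "y > t0" "\<And>x. t0 < x \<Longrightarrow> x < y \<Longrightarrow> cmod (?q x - ?q t0) < e"
        unfolding eventually_at_right_field dist_norm by auto
      have "eventually (\<lambda>n. 1 / r n < y - t0) sequentially" using order_tendstoD(2)[OF rlim, of "y - t0"] y(1) by simp
      then have "eventually (\<lambda>n. Rep_M01 (D_M \<mu> (L1_to_M (f n))) {0..<b} \<in> cball (?q t0) e) sequentially"
      proof eventually_elim
        case (elim n)
        note D = D_M_Phi[OF mv v0 B, of n]
        have vI: "(LINT x|lborel. v n x) = 1" unfolding v_def integral_complex_of_real rI by simp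
        have "Rep_M01 (D_M \<mu> (L1_to_M (f n))) {0..<b} - ?q t0 = (LINT x|lborel. ?q x * v n x) - (LINT x|lborel. ?q t0 * v n x)"
          using D(1) vI by simp
        also have "\<dots> = (LINT x|lborel. ?q x * v n x - ?q t0 * v n x)"
          using D(2) vi[of n] by (intro Bochner_Integration.integral_diff[symmetric]) auto
        also have "cmod \<dots> \<le> (LINT x|lborel. e * (r n * indicator (I n) x))"
        proof (rule norm_integral_le)
          show "integrable lborel (\<lambda>x. ?q x * v n x - ?q t0 * v n x)" using D(2) vi[of n] by simp
          show "integrable lborel (\<lambda>x. e * (r n * indicator (I n) x))" by (intro integrable_mult_right ri)
          fix x :: real
          show "norm (?q x * v n x - ?q t0 * v n x) \<le> e * (r n * indicator (I n) x)"
          proof (cases "x \<in> I n")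
            case True
            then have x: "t0 \<le> x" "x < y" using elim by (auto simp: I_def)
            have "cmod (?q x - ?q t0) \<le> e" using x y(2)[of x] e by (cases "x = t0") auto
            then have "cmod (?q x - ?q t0) * r n \<le> e * r n" using r(1)[of n] by (intro mult_right_mono) auto
            moreover have "?q x * v n x - ?q t0 * v n x = (?q x - ?q t0) * of_real (r n)" using True by (simp add: v_def algebra_simps)
            ultimately show ?thesis using True r(1)[of n] by (simp add: norm_mult)
          qed (simp add: v_def)
        qed
        also have "\<dots> = e * (LINT x|lborel. r n * indicator (I n) x)" by (rule integral_mult_right_zero)
        also have "\<dots> = e" unfolding rI by simp
        finally show ?case by (simp add: dist_norm norm_minus_commute)
      qed
      from clus[OF Rep_M01_cdual closed_cball this] show ?thesis by (simp add: dist_norm norm_minus_commute)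
    qed
    then have "cmod (Rep_M01 k {0..<b} - ?q t0) \<le> 0" by (rule field_le_epsilon[of _ 0, simplified add_0]) 
    then show "Rep_M01 k {0..<b} = ?q t0" by simp
  qed
  then show "Phi t0 \<in> K" "A \<in> borel01 \<Longrightarrow> emeasure lborel A = 0 \<Longrightarrow> Rep_M01 (Phi t0) A = 0" using k null by auto
qed

text \<open>Undoes the translation: values of \<mu> on Borel subsets of [0,1-t) can be read off from
  \<open>Phi t\<close>.\<close>

lemma Rep_Phi_translate:
  assumes t: "0 < t" "t < 1" and A: "A \<in> lc_borel01" "A \<subseteq> {0..<1 - t}"
  shows "(\<lambda>x. x - t) -` A \<in> borel01" "Rep_M01 (Phi t) ((\<lambda>x. x - t) -` A) = of_real t * Rep_lfmeas \<mu> A"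
proof -
  have Ab: "A \<in> sets borel" using A by (auto simp: lc_borel01_def)
  have "(\<lambda>x. x - t) -` A \<inter> space borel \<in> sets borel" by (rule measurable_sets[OF _ Ab]) measurable
  moreover have "(\<lambda>x. x - t) -` A \<subseteq> {0..<1}"
  proof
    fix x assume "x \<in> (\<lambda>x. x - t) -` A"
    then have "x - t \<in> {0..<1 - t}" using A(2) by auto
    then show "x \<in> {0..<1}" using t by simp
  qed
  ultimately show B: "(\<lambda>x. x - t) -` A \<in> borel01" by (simp add: borel01_def)
  have "Rep_M01 (Phi t) ((\<lambda>x. x - t) -` A) = of_real t * (LINT s|\<Lambda>. indicator ((\<lambda>x. x - t) -` A) (t + s) * u s)"
    using t B by (intro Rep_Phi) auto
  also have "(LINT s|\<Lambda>. indicator ((\<lambda>x. x - t) -` A) (t + s) * u s) = (LINT s|\<Lambda>. indicator A s * u s)"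
    by (intro Bochner_Integration.integral_cong) (auto simp: indicator_def)
  also have "\<dots> = Rep_lfmeas \<mu> A" using rep A by (simp add: lrep_def)
  finally show "Rep_M01 (Phi t) ((\<lambda>x. x - t) -` A) = of_real t * Rep_lfmeas \<mu> A" .
qed

lemma abs_continuous: "lf_abs_continuous \<mu>"
  unfolding lf_abs_continuous_def
proof (intro ballI impI)
  fix A assume A: "A \<in> lc_borel01" "emeasure lborel A = 0"
  then obtain a where a: "a < 1" "A \<subseteq> {0..a}" by (auto simp: lc_borel01_def)
  \<comment> \<open>Half of the room that A leaves below 1, so that A shifted by t stays inside
    [0,1).\<close>
  define t where "t = (1 - max a 0) / 2"
  have t: "0 < t" "t < 1" "a < 1 - t" using a by (auto simp: t_def max_def field_simps)
  have sub: "A \<subseteq> {0..<1 - t}" using a t by auto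
  note T = Rep_Phi_translate[OF t(1,2) A(1) sub]
  have "emeasure lborel ((\<lambda>x. x - t) -` A) = 0" using A by (subst emeasure_lborel_translate) (auto simp: lc_borel01_def)
  then have "Rep_M01 (Phi t) ((\<lambda>x. x - t) -` A) = 0" by (intro Phi_in_K(2)[OF t(1,2) T(1)])
  then show "Rep_lfmeas \<mu> A = 0" using T(2) t by simp
qed

section \<open>Mass away from 1, mass near 1, and the gliding hump\<close>

definition initial_mass :: "real \<Rightarrow> real" where "initial_mass b = enn2real (\<integral>\<^sup>+s. ennreal (cmod (u s)) * indicator {0..b} s \<partial>\<Lambda>)"

text \<open>If t + s \<le> b then s \<le> b, so only the finite mass of \<mu> on [0,b] is involved,
  and the factor t makes it vanish as t tends to 0.\<close>

lemma Phi_initial: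
  assumes t: "0 < t" "t < 1" and b: "b < 1" and B: "B \<in> borel01" "B \<subseteq> {0..b}"
  shows "cmod (Rep_M01 (Phi t) B) \<le> t * initial_mass b"
proof -
  have fin: "(\<integral>\<^sup>+s. ennreal (cmod (u s)) * indicator {0..b} s \<partial>\<Lambda>) < \<infinity>"
    using b by (intro le_less_trans[OF u_var]) (auto simp: borel01_def ennreal_mult_less_top intro: lfmeas_facts(2)[unfolded infinity_ennreal_def])
  have i: "integrable \<Lambda> (\<lambda>s. indicator B (t + s) * (of_real t * u s))"
    using t by (intro integrable_borel01[OF mrepD(1,2)[OF mrep_Phi] B(1)]) auto
  have "ennreal (cmod (Rep_M01 (Phi t) B)) \<le> (\<integral>\<^sup>+s. ennreal (cmod (indicator B (t + s) * (of_real t * u s))) \<partial>\<Lambda>)"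
    using t mrepD(3)[OF mrep_Phi B(1), of t] integral_norm_bound_ennreal[OF i] by simp
  also have "\<dots> \<le> (\<integral>\<^sup>+s. ennreal t * (ennreal (cmod (u s)) * indicator {0..b} s) \<partial>\<Lambda>)"
  proof (rule nn_integral_mono)
    fix s
    show "ennreal (cmod (indicator B (t + s) * (of_real t * u s))) \<le> ennreal t * (ennreal (cmod (u s)) * indicator {0..b} s)"
    proof (cases "t + s \<in> B \<and> s \<in> {0..<1}")
      case True
      then have "s \<in> {0..b}" using B(2) t by (auto dest!: subsetD)
      then show ?thesis using True t by (simp add: norm_mult ennreal_mult)
    next
      case False
      then have z: "indicator B (t + s) * (of_real t * u s) = 0" using u_out[of s] by auto
      show ?thesis unfolding z by simp
    qed
  qed
  also have "\<dots> = ennreal t * (\<integral>\<^sup>+s. ennreal (cmod (u s)) * indicator {0..b} s \<partial>\<Lambda>)"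
    by (intro nn_integral_cmult) measurable
  also have "\<dots> = ennreal (t * initial_mass b)" using fin t by (simp add: initial_mass_def ennreal_mult)
  finally show ?thesis using t by (subst (asm) ennreal_le_iff) (auto simp: initial_mass_def)
qed

text \<open>For fixed t the measure \<open>Phi t\<close> is finite, so by dominated convergence
  little of it lies close to 1, uniformly over all Borel sets there.\<close>

lemma Phi_tail:
  assumes t: "t \<in> {0..1}" and e: "e > 0"
  shows "\<exists>d<1. \<forall>B\<in>borel01. B \<subseteq> {d<..<1} \<longrightarrow> cmod (Rep_M01 (Phi t) B) \<le> e"
proof -
  let ?w = "\<lambda>s. indicator {0..<1} (t + s) * (of_real t * u s)"
  define d where "d n = 1 - 1 / real (Suc n)" for n
  have i: "integrable \<Lambda> ?w" by (rule mrepD(2)[OF mrep_Phi[OF t]])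
  have "(\<lambda>n. LINT s|\<Lambda>. indicator {d n<..<1} (t + s) * cmod (?w s)) \<longlonglongrightarrow> (LINT s|\<Lambda>. 0)"
  proof (rule integral_dominated_convergence)
    show "integrable \<Lambda> (\<lambda>s. cmod (?w s))" using i by simp
    show "AE s in \<Lambda>. norm (indicator {d n<..<1} (t + s) * cmod (?w s)) \<le> cmod (?w s)" for n
      by (intro AE_I2) (auto split: split_indicator)
    show "AE s in \<Lambda>. (\<lambda>n. indicator {d n<..<1} (t + s) * cmod (?w s)) \<longlonglongrightarrow> 0"
    proof (intro AE_I2 tendsto_eventually)
      fix s
      show "eventually (\<lambda>n. indicator {d n<..<1} (t + s) * cmod (?w s) = 0) sequentially"
      proof (cases "t + s < 1")
        case True
        have "(\<lambda>n. 1 - 1 / real (Suc n)) \<longlonglongrightarrow> 1 - 0"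
          by (intro tendsto_diff tendsto_const LIMSEQ_inverse_real_of_nat[unfolded inverse_eq_divide])
        then have "eventually (\<lambda>n. t + s < d n) sequentially"
          using order_tendstoD(1)[of d 1 sequentially "t + s"] True by (simp add: d_def[abs_def])
        then show ?thesis by eventually_elim auto
      qed auto
    qed
  qed measurable
  then have "(\<lambda>n. LINT s|\<Lambda>. indicator {d n<..<1} (t + s) * cmod (?w s)) \<longlonglongrightarrow> 0" by simp
  then have "eventually (\<lambda>n. (LINT s|\<Lambda>. indicator {d n<..<1} (t + s) * cmod (?w s)) < e) sequentially"
    using e by (rule order_tendstoD(2))
  then obtain n where n: "(LINT s|\<Lambda>. indicator {d n<..<1} (t + s) * cmod (?w s)) < e" by (auto simp: eventually_sequentially)
  have "cmod (Rep_M01 (Phi t) B) \<le> e" if B: "B \<in> borel01" "B \<subseteq> {d n<..<1}" for B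
  proof -
    have ib: "integrable \<Lambda> (\<lambda>s. indicator B (t + s) * (of_real t * u s))"
      by (rule integrable_borel01[OF mrepD(1,2)[OF mrep_Phi[OF t]] B(1)])
    have "cmod (Rep_M01 (Phi t) B) \<le> (LINT s|\<Lambda>. indicator {d n<..<1} (t + s) * cmod (?w s))"
      unfolding mrepD(3)[OF mrep_Phi[OF t] B(1)]
    proof (rule norm_integral_le[OF ib])
      show "integrable \<Lambda> (\<lambda>s. indicator {d n<..<1} (t + s) * cmod (?w s))"
      proof (rule Bochner_Integration.integrable_bound[OF integrable_norm[OF i]])
        show "AE s in \<Lambda>. norm (indicator {d n<..<1} (t + s) * cmod (?w s)) \<le> norm (norm (?w s))"
          by (intro AE_I2) (auto split: split_indicator)
      qed measurable
      fix s
      show "norm (indicator B (t + s) * (of_real t * u s)) \<le> indicator {d n<..<1} (t + s) * cmod (?w s)"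
      proof (cases "t + s \<in> B")
        case True
        then have "t + s \<in> {d n<..<1}" "t + s \<in> {0..<1}" using B by (auto simp: borel01_def)
        then show ?thesis using True by simp
      qed simp
    qed
    then show ?thesis using n by simp
  qed
  moreover have "d n < 1" by (simp add: d_def)
  ultimately show ?thesis by blast
qed

lemma Rep_M01_Un: "A \<in> borel01 \<Longrightarrow> B \<in> borel01 \<Longrightarrow> A \<inter> B = {} \<Longrightarrow> Rep_M01 m (A \<union> B) = Rep_M01 m A + Rep_M01 m B"
  using signed_on_Un[OF borel01_ring_borel01 cmeasure_signed(1)[OF M01_facts(1)], of A B m] signed_on_Un[OF borel01_ring_borel01 cmeasure_signed(2)[OF M01_facts(1)], of A B m]
  by (simp add: complex_eq_iff)

text \<open>Up to \<open>e\<close>, the measure \<open>Phi t\<close> lives on \<open>{a<..a'}\<close>.\<close>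

lemma gliding_hump_step:
  assumes e: "e > 0" and big: "\<And>d. d > 0 \<Longrightarrow> \<exists>t. 0 < t \<and> t < d \<and> t * total_variation \<mu> {0..<1 - t} \<ge> 64 * e"
    and a: "0 \<le> a" "a < 1"
  shows "\<exists>a' t A. a < a' \<and> a' < 1 \<and> 1 - a' \<le> (1 - a) / 2 \<and> 0 < t \<and> t < 1 \<and> t \<le> 1 - a \<and> A \<in> borel01 \<and> A \<subseteq> {a<..a'} \<and>
    6 * e \<le> cmod (Rep_M01 (Phi t) A) \<and>
    (\<forall>B\<in>borel01. B \<subseteq> {0..a} \<longrightarrow> cmod (Rep_M01 (Phi t) B) \<le> e) \<and>
    (\<forall>B\<in>borel01. B \<subseteq> {a'<..<1} \<longrightarrow> cmod (Rep_M01 (Phi t) B) \<le> e)"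
proof -
  have s0: "0 \<le> initial_mass a" by (simp add: initial_mass_def)
  \<comment> \<open>t below 1 - a makes the chosen times tend to 0 along the construction; t below e
    / (initial_mass a + 1) keeps \<open>Phi t\<close> within e on subsets of [0,a].\<close>
  have "0 < min (1 - a) (e / (initial_mass a + 1))" using a e s0 by (simp add: add_nonneg_pos)
  then obtain t where t: "0 < t" "t < min (1 - a) (e / (initial_mass a + 1))" "t * total_variation \<mu> {0..<1 - t} \<ge> 64 * e"
    using big by blast
  have t1: "t < 1" "t \<le> 1 - a" using t(2) a by auto
  have "t * initial_mass a \<le> e / (initial_mass a + 1) * (initial_mass a + 1)" using t s0 by (intro mult_mono) auto
  also have "\<dots> = e" using s0 by simp
  finally have low: "cmod (Rep_M01 (Phi t) B) \<le> e" if "B \<in> borel01" "B \<subseteq> {0..a}" for B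
    using Phi_initial[OF t(1) t1(1) a(2) that] by linarith
  have S: "{0..<1 - t} \<in> lc_borel01" using t(1) by (intro lc_borel01_Ico) simp
  \<comment> \<open>If all values on Borel subsets were below 8 e / t, the variation would be at
    most 32 e / t, against the given 64 e / t. Of 8 e there remain 6 e after an error e on either
    side of the window.\<close>
  obtain B where B: "B \<in> sets borel" "B \<subseteq> {0..<1 - t}" "8 * e / t \<le> cmod (Rep_lfmeas \<mu> B)"
  proof (rule ccontr)
    assume no: "\<not> thesis"
    have "variation (Rep_lfmeas \<mu>) {0..<1 - t} \<le> ennreal (4 * (8 * e / t))"
    proof (rule variation_le_4[OF lfmeas_facts(1) S])
      fix B assume "B \<in> sets borel" "B \<subseteq> {0..<1 - t}"
      then show "cmod (Rep_lfmeas \<mu> B) \<le> 8 * e / t" using no that by (meson linorder_not_le less_imp_le)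
    qed (use e t in auto)
    then have "total_variation \<mu> {0..<1 - t} \<le> 4 * (8 * e / t)"
      using e t by (simp add: variation_TV TV_nonneg)
    then have "t * total_variation \<mu> {0..<1 - t} \<le> t * (4 * (8 * e / t))" using t(1) by (intro mult_left_mono) auto
    also have "\<dots> = 32 * e" using t(1) by simp
    finally show False using t(3) e by linarith
  qed
  have Blc: "B \<in> lc_borel01" by (rule borel01_ring_sub[OF borel01_ring_lc_borel01 S B(1,2)])
  define B1 where "B1 = (\<lambda>x. x - t) -` B"
  note T = Rep_Phi_translate[OF t(1) t1(1) Blc B(2), folded B1_def]
  have B1: "8 * e \<le> cmod (Rep_M01 (Phi t) B1)"
  proof -
    have "t * (8 * e / t) \<le> t * cmod (Rep_lfmeas \<mu> B)" using B(3) t(1) by (intro mult_left_mono) auto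
    then show ?thesis using t(1) by (simp add: T(2) norm_mult)
  qed
  obtain d where d: "d < 1" "\<And>B. B \<in> borel01 \<Longrightarrow> B \<subseteq> {d<..<1} \<Longrightarrow> cmod (Rep_M01 (Phi t) B) \<le> e"
    using Phi_tail[of t e] t(1) t1 e by auto
  \<comment> \<open>The midpoint keeps a' above a and halves the distance to 1.\<close>
  define a' where "a' = max d ((1 + a) / 2)"
  have a': "a < a'" "a' < 1" "1 - a' \<le> (1 - a) / 2" using a d(1) by (auto simp: a'_def field_simps max_def)
  have high: "cmod (Rep_M01 (Phi t) B) \<le> e" if "B \<in> borel01" "B \<subseteq> {a'<..<1}" for B
    using that by (intro d(2)) (auto simp: a'_def)
  define A where "A = B1 \<inter> {a<..a'}"
  have bs: "B1 \<inter> {0..a} \<in> borel01" "A \<in> borel01" "B1 \<inter> {a'<..<1} \<in> borel01" using T(1) by (auto simp: A_def borel01_def)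
  have "B1 = (B1 \<inter> {0..a} \<union> A) \<union> B1 \<inter> {a'<..<1}" using T(1) a' by (auto simp: A_def borel01_def)
  then have "Rep_M01 (Phi t) B1 = Rep_M01 (Phi t) ((B1 \<inter> {0..a} \<union> A) \<union> B1 \<inter> {a'<..<1})" by simp
  also have "\<dots> = (Rep_M01 (Phi t) (B1 \<inter> {0..a}) + Rep_M01 (Phi t) A) + Rep_M01 (Phi t) (B1 \<inter> {a'<..<1})"
    using bs a' by (subst Rep_M01_Un; (subst Rep_M01_Un)?) (auto simp: A_def borel01_ring_Un[OF borel01_ring_borel01])
  finally have eq: "Rep_M01 (Phi t) B1 = (Rep_M01 (Phi t) (B1 \<inter> {0..a}) + Rep_M01 (Phi t) A) + Rep_M01 (Phi t) (B1 \<inter> {a'<..<1})" .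
  have "cmod (Rep_M01 (Phi t) B1) \<le> (cmod (Rep_M01 (Phi t) (B1 \<inter> {0..a})) + cmod (Rep_M01 (Phi t) A)) + cmod (Rep_M01 (Phi t) (B1 \<inter> {a'<..<1}))"
    unfolding eq by (rule order_trans[OF norm_triangle_ineq add_right_mono[OF norm_triangle_ineq]])
  moreover have "cmod (Rep_M01 (Phi t) (B1 \<inter> {0..a})) \<le> e" by (rule low[OF bs(1)]) auto
  moreover have "cmod (Rep_M01 (Phi t) (B1 \<inter> {a'<..<1})) \<le> e" by (rule high[OF bs(3)]) auto
  ultimately have "6 * e \<le> cmod (Rep_M01 (Phi t) A)" using B1 by linarith
  moreover have "A \<subseteq> {a<..a'}" by (auto simp: A_def)
  ultimately show ?thesis using a' t(1) t1 bs(2) low high by blast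
qed

lemma vanishing: "((\<lambda>t. t * total_variation \<mu> {0..<1 - t}) \<longlongrightarrow> 0) (at_right 0)"
proof (rule ccontr)
  assume "\<not> ?thesis"
  then obtain e0 where e0: "e0 > 0" and "\<not> eventually (\<lambda>t. dist (t * total_variation \<mu> {0..<1 - t}) 0 < e0) (at_right 0)"
    unfolding tendsto_iff by auto
  then have nd: "\<not> (\<exists>d>0. \<forall>t>0. t < d \<longrightarrow> dist (t * total_variation \<mu> {0..<1 - t}) 0 < e0)"
    unfolding eventually_at_right_field by simp
  define e where "e = e0 / 64"
  have e: "e > 0" using e0 by (simp add: e_def)
  have big: "\<exists>t. 0 < t \<and> t < d \<and> t * total_variation \<mu> {0..<1 - t} \<ge> 64 * e" if d: "d > 0" for d
  proof -
    obtain t where t: "0 < t" "t < d" "\<not> dist (t * total_variation \<mu> {0..<1 - t}) 0 < e0" using nd d by blast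
    then have "t * total_variation \<mu> {0..<1 - t} \<ge> 64 * e" using TV_nonneg by (simp add: e_def)
    then show ?thesis using t by blast
  qed
  \<comment> \<open>One step as a relation, from which functions of the left endpoint can be chosen
    and iterated.\<close>
  define Q where "Q a a' t A \<longleftrightarrow> a < a' \<and> a' < 1 \<and> 1 - a' \<le> (1 - a) / 2 \<and> 0 < t \<and> t < 1 \<and> t \<le> 1 - a \<and> A \<in> borel01 \<and> A \<subseteq> {a<..a'} \<and>
    6 * e \<le> cmod (Rep_M01 (Phi t) A) \<and>
    (\<forall>B\<in>borel01. B \<subseteq> {0..a} \<longrightarrow> cmod (Rep_M01 (Phi t) B) \<le> e) \<and>
    (\<forall>B\<in>borel01. B \<subseteq> {a'<..<1} \<longrightarrow> cmod (Rep_M01 (Phi t) B) \<le> e)" for a a' t A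
  have "\<exists>a' t A. Q a a' t A" if "0 \<le> a" "a < 1" for a using gliding_hump_step[OF e big that] unfolding Q_def .
  then have "\<exists>p. 0 \<le> a \<and> a < 1 \<longrightarrow> Q a (fst p) (fst (snd p)) (snd (snd p))" for a by (cases "0 \<le> a \<and> a < 1") auto
  then obtain pp where pp: "\<And>a. 0 \<le> a \<and> a < 1 \<longrightarrow> Q a (fst (pp a)) (fst (snd (pp a))) (snd (snd (pp a)))" by metis
  define nxt tt AA where "nxt a = fst (pp a)" and "tt a = fst (snd (pp a))" and "AA a = snd (snd (pp a))" for a
  have nx: "Q a (nxt a) (tt a) (AA a)" if "0 \<le> a" "a < 1" for a using pp[of a] that by (simp add: nxt_def tt_def AA_def)
  \<comment> \<open>Each window starts where the previous one ends, so the windows are disjoint, and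
    1 - a k \<le> (1/2)^k.\<close>
  define a where "a k = (nxt ^^ k) 0" for k
  have aS: "a (Suc k) = nxt (a k)" for k by (simp add: a_def)
  have a01: "0 \<le> a k \<and> a k < 1" for k
  proof (induction k)
    case (Suc k)
    then show ?case using nx[of "a k"] unfolding aS Q_def by auto
  qed (simp add: a_def)
  define t where "t k = tt (a k)" for k
  define A where "A k = AA (a k)" for k
  have q: "Q (a k) (a (Suc k)) (t k) (A k)" for k using nx[of "a k"] a01[of k] by (simp add: aS t_def A_def)
  have mono: "a i \<le> a j" if "i \<le> j" for i j
    using that by (rule lift_Suc_mono_le[rotated]) (use q in \<open>auto simp: Q_def less_imp_le\<close>)
  have ar: "1 - a k \<le> (1 / 2) ^ k" for k
  proof (induction k)
    case (Suc k)
    have "1 - a (Suc k) \<le> (1 - a k) / 2" using q[of k] by (simp add: Q_def)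
    then show ?case using Suc by simp
  qed (simp add: a_def)
  have tl: "t \<longlonglongrightarrow> 0"
  proof (rule tendsto_sandwich[OF _ _ tendsto_const])
    show "(\<lambda>k. (1 / 2 :: real) ^ k) \<longlonglongrightarrow> 0" by (rule LIMSEQ_realpow_zero) auto
    show "eventually (\<lambda>k. 0 \<le> t k) sequentially" using q by (auto simp: Q_def less_imp_le)
    have "t k \<le> (1 / 2) ^ k" for k using q[of k] ar[of k] unfolding Q_def by linarith
    then show "eventually (\<lambda>k. t k \<le> (1 / 2) ^ k) sequentially" by simp
  qed
  have PK: "Phi (t k) \<in> K" for k using q[of k] by (intro Phi_in_K(1)) (auto simp: Q_def)
  obtain k where clus: "\<And>\<phi> S. \<phi> \<in> cdual \<Longrightarrow> closed S \<Longrightarrow> eventually (\<lambda>n. \<phi> (Phi (t n)) \<in> S) sequentially \<Longrightarrow> \<phi> k \<in> S"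
    by (rule weak_cluster_point[OF K, of "\<lambda>n. Phi (t n)"], rule PK, rule that, assumption+)
  \<comment> \<open>On [0,b) the values of \<open>Phi (t n)\<close> are at most
    \<open>t n * initial_mass b\<close>, which tends to 0.\<close>
  have "k = 0"
  proof (rule M01_eqI)
    fix b :: real assume b: "0 < b" "b < 1"
    have "cmod (Rep_M01 k {0..<b}) \<le> 0 + r" if r: "r > 0" for r
    proof -
      have "(\<lambda>n. t n * initial_mass b) \<longlonglongrightarrow> 0 * initial_mass b" by (intro tendsto_intros tl)
      then have "eventually (\<lambda>n. t n * initial_mass b < r) sequentially" using order_tendstoD(2)[of _ 0 sequentially r] r by simp
      then have "eventually (\<lambda>n. Rep_M01 (Phi (t n)) {0..<b} \<in> cball 0 r) sequentially"
      proof eventually_elim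
        case (elim n)
        have "cmod (Rep_M01 (Phi (t n)) {0..<b}) \<le> t n * initial_mass b"
          using q[of n] b by (intro Phi_initial) (auto simp: Q_def borel01_def)
        then show ?case using elim by simp
      qed
      from clus[OF Rep_M01_cdual closed_cball this] show ?thesis by simp
    qed
    then have "cmod (Rep_M01 k {0..<b}) \<le> 0" by (rule field_le_epsilon)
    then show "Rep_M01 k {0..<b} = Rep_M01 0 {0..<b}" by (simp add: Rep_M01_ops)
  qed
  \<comment> \<open>One set for all n: inside the window of step n it coincides with
    \<open>A n\<close>, and the rest costs at most 2 e. The lower bound 4 e that remains of 6 e is a
    closed condition, which the cluster point 0 violates.\<close>
  define U where "U = (\<Union>k. A k)"
  have Ab: "A j \<in> borel01" and AI: "A j \<subseteq> {a j<..a (Suc j)}" for j using q[of j] by (simp_all add: Q_def)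
  have "A j \<in> sets borel" "A j \<subseteq> {0..<1}" for j using Ab[of j] by (simp_all add: borel01_def)
  then have Ub: "U \<in> borel01" unfolding U_def borel01_def by blast
  have "4 * e \<le> cmod (Rep_M01 (Phi (t n)) U)" for n
  proof -
    note An = Ab[of n] AI[of n]
    have bs: "U \<inter> {0..a n} \<in> borel01" "U \<inter> {a (Suc n)<..<1} \<in> borel01" using Ub by (auto simp: borel01_def)
    have "U \<inter> {a n<..a (Suc n)} \<subseteq> A n"
    proof
      fix x assume x: "x \<in> U \<inter> {a n<..a (Suc n)}"
      then obtain j where j: "x \<in> A j" by (auto simp: U_def)
      then have xj: "a j < x" "x \<le> a (Suc j)" using subsetD[OF AI[of j]] by auto
      have "\<not> j < n"
      proof
        assume "j < n"
        then have "a (Suc j) \<le> a n" by (intro mono) simp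
        then show False using xj x by simp
      qed
      moreover have "\<not> n < j"
      proof
        assume "n < j"
        then have "a (Suc n) \<le> a j" by (intro mono) simp
        then show False using xj x by simp
      qed
      ultimately have "j = n" by simp
      then show "x \<in> A n" using j by simp
    qed
    moreover have "A n \<subseteq> U" by (auto simp: U_def)
    moreover have "U \<subseteq> {0..a n} \<union> {a n<..a (Suc n)} \<union> {a (Suc n)<..<1}"
    proof
      fix x assume "x \<in> U"
      then have "0 \<le> x" "x < 1" using Ub by (auto simp: borel01_def)
      then show "x \<in> {0..a n} \<union> {a n<..a (Suc n)} \<union> {a (Suc n)<..<1}" by auto
    qed
    ultimately have "U = (U \<inter> {0..a n} \<union> A n) \<union> U \<inter> {a (Suc n)<..<1}" by blast
    then have "Rep_M01 (Phi (t n)) U = Rep_M01 (Phi (t n)) ((U \<inter> {0..a n} \<union> A n) \<union> U \<inter> {a (Suc n)<..<1})" by simp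
    also have "\<dots> = (Rep_M01 (Phi (t n)) (U \<inter> {0..a n}) + Rep_M01 (Phi (t n)) (A n)) + Rep_M01 (Phi (t n)) (U \<inter> {a (Suc n)<..<1})"
    proof -
      have 1: "Rep_M01 m (U \<inter> {0..a n} \<union> A n) = Rep_M01 m (U \<inter> {0..a n}) + Rep_M01 m (A n)" for m
        using An bs by (intro Rep_M01_Un) auto
      have "a n \<le> a (Suc n)" by (rule mono) simp
      then have "(U \<inter> {0..a n} \<union> A n) \<inter> (U \<inter> {a (Suc n)<..<1}) = {}" using An(2) by auto
      then show ?thesis
        using An bs by (subst Rep_M01_Un) (auto simp: 1 borel01_ring_Un[OF borel01_ring_borel01])
    qed
    finally have eq: "Rep_M01 (Phi (t n)) (A n) = Rep_M01 (Phi (t n)) U - (Rep_M01 (Phi (t n)) (U \<inter> {0..a n}) + Rep_M01 (Phi (t n)) (U \<inter> {a (Suc n)<..<1}))" by simp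
    have "cmod (Rep_M01 (Phi (t n)) (A n)) \<le> cmod (Rep_M01 (Phi (t n)) U) + (cmod (Rep_M01 (Phi (t n)) (U \<inter> {0..a n})) + cmod (Rep_M01 (Phi (t n)) (U \<inter> {a (Suc n)<..<1})))"
      unfolding eq by (rule order_trans[OF norm_triangle_ineq4 add_left_mono[OF norm_triangle_ineq]])
    moreover have "cmod (Rep_M01 (Phi (t n)) (U \<inter> {0..a n})) \<le> e" "cmod (Rep_M01 (Phi (t n)) (U \<inter> {a (Suc n)<..<1})) \<le> e"
      "6 * e \<le> cmod (Rep_M01 (Phi (t n)) (A n))"
      using q[of n] bs unfolding Q_def by blast+
    ultimately show ?thesis by linarith
  qed
  then have "eventually (\<lambda>n. Rep_M01 (Phi (t n)) U \<in> {z. 4 * e \<le> cmod z}) sequentially" by simp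
  then have "Rep_M01 k U \<in> {z. 4 * e \<le> cmod z}"
    by (rule clus[OF Rep_M01_cdual, rotated]) (intro closed_Collect_le continuous_intros)
  then show False using e \<open>k = 0\<close> by (simp add: Rep_M01_ops)
qed

end

section \<open>The equivalence\<close>

text \<open>Boundedness is given only near 0. For t \<ge> d the interval [0,1-t) is contained in
  [0,1-d), so one value of the total variation covers the remaining t; the factor 4 is that of the
  density estimate.\<close>

lemma growth_bound_exists:
  assumes B: "Bfun (\<lambda>t. t * total_variation \<mu> {0..<1 - t}) (at_right 0)"
    and u_out: "\<And>x. x \<notin> {0..<1} \<Longrightarrow> u x = 0"
    and var: "\<And>A. A \<in> borel01 \<Longrightarrow> (\<integral>\<^sup>+x. ennreal (cmod (u x)) * indicator A x \<partial>\<Lambda>) \<le> 4 * variation (Rep_lfmeas \<mu>) A"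
  shows "\<exists>C. growth_bound \<Lambda> u C"
proof -
  let ?T = "\<lambda>t. total_variation \<mu> {0..<1 - t}"
  note T0 = TV_nonneg and V = variation_TV
  obtain M where M: "M > 0" "eventually (\<lambda>t. norm (t * ?T t) \<le> M) (at_right 0)" using B by (rule BfunE)
  then obtain d where d: "d > 0" "\<And>t. 0 < t \<Longrightarrow> t < d \<Longrightarrow> norm (t * ?T t) \<le> M" unfolding eventually_at_right_field by auto
  define C where "C = 4 * max M (?T d)"
  have le: "t * ?T t \<le> max M (?T d)" if t: "0 < t" "t < 1" for t
  proof (cases "t < d")
    case True
    then show ?thesis using d(2)[OF t(1) True] by auto
  next
    case False
    have "ennreal (?T t) \<le> ennreal (?T d)"
      unfolding V[OF t(1), symmetric] V[OF d(1), symmetric] by (rule variation_mono) (use False in auto)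
    then have "?T t \<le> ?T d" using T0 by simp
    moreover have "t * ?T t \<le> 1 * ?T t" using t T0 by (intro mult_right_mono) auto
    ultimately show ?thesis by linarith
  qed
  have "growth_bound \<Lambda> u C"
    unfolding growth_bound_def
  proof (intro conjI ballI)
    show "0 \<le> C" using M T0 by (simp add: C_def le_max_iff_disj)
    fix t :: real assume t: "t \<in> {0..<1}"
    show "ennreal t * (\<integral>\<^sup>+s. indicator {0..<1} (t + s) * ennreal (cmod (u s)) \<partial>\<Lambda>) \<le> ennreal C"
    proof (cases "t = 0")
      case False
      then have t: "0 < t" "t < 1" using t by auto
      have "(\<integral>\<^sup>+s. indicator {0..<1} (t + s) * ennreal (cmod (u s)) \<partial>\<Lambda>) = (\<integral>\<^sup>+s. ennreal (cmod (u s)) * indicator {0..<1 - t} s \<partial>\<Lambda>)"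
        using u_out t by (intro nn_integral_cong) (auto split: split_indicator)
      also have "\<dots> \<le> 4 * ennreal (?T t)" unfolding V[OF t(1), symmetric] using t by (intro var) (auto simp: borel01_def)
      finally have "ennreal t * (\<integral>\<^sup>+s. indicator {0..<1} (t + s) * ennreal (cmod (u s)) \<partial>\<Lambda>) \<le> ennreal t * (4 * ennreal (?T t))"
        by (rule mult_left_mono) simp
      also have "\<dots> = ennreal (4 * (t * ?T t))" using t T0 by (simp add: ennreal_mult mult_ac)
      also have "\<dots> \<le> ennreal C" using le[OF t] by (intro ennreal_leI) (simp add: C_def)
      finally show ?thesis .
    qed simp
  qed
  then show ?thesis ..
qed

theorem theorem2p2:
  fixes \<mu> :: lfmeas
  assumes "Bfun (\<lambda>t. t * total_variation \<mu> {0..<1 - t}) (at_right 0)"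
  shows "(compact_derivation (D_L1 \<mu>) \<longleftrightarrow> weakly_compact_derivation (D_L1 \<mu>))
       \<and> (weakly_compact_derivation (D_L1 \<mu>) \<longleftrightarrow>
            lf_abs_continuous \<mu> \<and>
            ((\<lambda>t. t * total_variation \<mu> {0..<1 - t}) \<longlongrightarrow> 0) (at_right 0))
       \<and> (lf_abs_continuous \<mu> \<and>
            ((\<lambda>t. t * total_variation \<mu> {0..<1 - t}) \<longlongrightarrow> 0) (at_right 0)
          \<longleftrightarrow> compact_derivation (D_M \<mu>))
       \<and> (compact_derivation (D_M \<mu>) \<longleftrightarrow> weakly_compact_derivation (D_M \<mu>))"
proof -
  obtain \<Lambda> u where L: "sets \<Lambda> = sets borel" "lrep \<Lambda> (\<lambda>x. x) u \<mu>" "u \<in> borel_measurable borel" "\<And>x. x \<notin> {0..<1} \<Longrightarrow> u x = 0"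
    "\<And>A. A \<in> borel01 \<Longrightarrow> (\<integral>\<^sup>+x. ennreal (cmod (u x)) * indicator A x \<partial>\<Lambda>) \<le> 4 * variation (Rep_lfmeas \<mu>) A"
    by (rule lrep_canonical[of \<mu>], rule that, assumption+)
  obtain C where C: "growth_bound \<Lambda> u C" using growth_bound_exists[OF assms L(4,5)] by blast
  interpret growth \<mu> \<Lambda> u C by unfold_locales (use L C in auto)
  note dM = derivation_D_M[OF L(2) C] and dL = derivation_D_L1[OF L(2) C]
  let ?c = "lf_abs_continuous \<mu> \<and> ((\<lambda>t. t * total_variation \<mu> {0..<1 - t}) \<longlongrightarrow> 0) (at_right 0)"
  \<comment> \<open>Under absolute continuity \<mu> is represented a second time, now by a density
    with respect to Lebesgue measure, so that \<open>growth_ac\<close> applies.\<close>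
  have c_K: "compact (closure (D_M \<mu> ` cball 0 1))" if c: ?c
  proof -
    have ac: "\<And>A. A \<in> lc_borel01 \<Longrightarrow> emeasure lborel A = 0 \<Longrightarrow> Rep_lfmeas \<mu> A = 0"
      using c by (auto simp: lf_abs_continuous_def)
    obtain v where v: "lrep lborel (\<lambda>x. x) v \<mu>" "v \<in> borel_measurable borel" "\<And>x. x \<notin> {0..<1} \<Longrightarrow> v x = 0"
      "\<And>A. A \<in> borel01 \<Longrightarrow> (\<integral>\<^sup>+x. ennreal (cmod (v x)) * indicator A x \<partial>lborel) \<le> 4 * variation (Rep_lfmeas \<mu>) A"
      by (rule lrep_of_density[OF lborel.sigma_finite_measure_axioms sets_lborel ac], assumption, assumption, rule that, assumption+)
    obtain C' where C': "growth_bound lborel v C'" using growth_bound_exists[OF assms v(3,4)] by blast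
    interpret ac: growth_ac \<mu> v C' by unfold_locales (use v C' in auto)
    show ?thesis using ac.compact_D_M ac.Phi_continuous c by blast
  qed
  have c_d: "compact_derivation (D_M \<mu>)" if ?c
    using c_K[OF that] dM by (simp add: compact_derivation_def compact_operator_def derivation_def)
  have c_a: "compact_derivation (D_L1 \<mu>)" if ?c
    using compact_D_L1[OF L(2) C c_K[OF that]] dL by (simp add: compact_derivation_def compact_operator_def derivation_def)
  have a_b: "weakly_compact_derivation (D_L1 \<mu>)" if "compact_derivation (D_L1 \<mu>)"
    using that compact_imp_weakly_compact_operator[OF separate_L1] by (auto simp: compact_derivation_def weakly_compact_derivation_def)
  have d_e: "weakly_compact_derivation (D_M \<mu>)" if "compact_derivation (D_M \<mu>)"
    using that compact_imp_weakly_compact_operator[OF separate_M01] by (auto simp: compact_derivation_def weakly_compact_derivation_def)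
  \<comment> \<open>Only the values of \<open>D_M \<mu>\<close> on the embedded unit ball of L^1
    have to lie in W, so weak compactness on L^1 and on M can be exploited by the same
    argument.\<close>
  have c: ?c if W: "compactin weak_topology W" "\<And>f. norm f \<le> 1 \<Longrightarrow> D_M \<mu> (L1_to_M f) \<in> W" for W
  proof -
    interpret growth_weak \<mu> \<Lambda> u C W by unfold_locales (use W in auto)
    show ?thesis using abs_continuous vanishing by blast
  qed
  have b_c: ?c if "weakly_compact_derivation (D_L1 \<mu>)"
  proof (rule c)
    let ?W = "weak_topology closure_of (D_L1 \<mu> ` cball 0 1)"
    show "compactin weak_topology (L1_to_M ` ?W)"
      using that by (intro compactin_weak_L1_to_M) (simp add: weakly_compact_derivation_def weakly_compact_operator_def)
    fix f :: L1_01 assume "norm f \<le> 1"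
    then have "D_L1 \<mu> f \<in> ?W" using closure_of_subset[of "D_L1 \<mu> ` cball 0 1" weak_topology] by auto
    then show "D_M \<mu> (L1_to_M f) \<in> L1_to_M ` ?W" unfolding L1_to_M_D_L1[OF L(2) C, symmetric] by (rule imageI)
  qed
  have e_c: ?c if "weakly_compact_derivation (D_M \<mu>)"
  proof (rule c)
    let ?W = "weak_topology closure_of (D_M \<mu> ` cball 0 1)"
    show "compactin weak_topology ?W"
      using that by (simp add: weakly_compact_derivation_def weakly_compact_operator_def)
    fix f :: L1_01 assume "norm f \<le> 1"
    then have "norm (L1_to_M f) \<le> 1" using norm_L1_to_M_le[of f] by linarith
    then show "D_M \<mu> (L1_to_M f) \<in> ?W" using closure_of_subset[of "D_M \<mu> ` cball 0 1" weak_topology] by auto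
  qed
  show ?thesis using c_d c_a a_b d_e b_c e_c by blast
qed

end
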